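(* For any positive integers $m\ge n$, the algebra $\mathcal{T}_{n,m}$ is Cohen--Macaulay.
   Context: Let $\mathbb{K}$ be an algebraically closed field of characteristic zero. A semistandard Young tableau of partition shape $\lambda$ is a filling of the Ferrers diagram of $\lambda$ (English notation) with positive integers, strictly increasing down columns and weakly increasing from left to right along rows. For positive integers $m\ge n$, $\mathrm{SSYT}_m^n$ denotes the set of all semistandard Young tableaux of all partition shapes with at most $n$ rows and with entries in $\{1,\dots,m\}$ (including the empty tableau $\emptyset$). For $T$ of shape $\lambda$ and $T'$ of shape $\mu$, $T\star T'$ is the semistandard Young tableau of shape $\lambda+\mu$ obtained by horizontally concatenating the rows of $T$ and $T'$ and sorting the entries in each row in weakly increasing order. $(\mathrm{SSYT}_m^n,\star,\emptyset)$ is a commutative monoid, and the tableaux algebra $\mathcal{T}_{n,m}$ is its monoid algebra over $\mathbb{K}$. *)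

theory Defs
  imports
    "HOL-Algebra.QuotRing"
    "HOL-Algebra.Ring_Divisibility"
    "HOL-Library.Poly_Mapping"
    "HOL-Library.Extended_Nat"
    "HOL-Computational_Algebra.Polynomial"
begin

section \<open>Cohen--Macaulay rings\<close>

definition krull_dim :: "('a, 'b) ring_scheme \<Rightarrow> enat" where
  "krull_dim R =
     Sup {enat k | k. \<exists>P :: nat \<Rightarrow> 'a set.
            (\<forall>i\<le>k. primeideal (P i) R) \<and> (\<forall>i<k. P i \<subset> P (Suc i))}"

definition nonzerodivisor :: "('a, 'b) ring_scheme \<Rightarrow> 'a \<Rightarrow> bool" where
  "nonzerodivisor R x \<longleftrightarrow>
     x \<in> carrier R \<and> (\<forall>y\<in>carrier R. x \<otimes>\<^bsub>R\<^esub> y = \<zero>\<^bsub>R\<^esub> \<longrightarrow> y = \<zero>\<^bsub>R\<^esub>)"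

text \<open>
  The sequence \<open>x\<^sub>1, \<dots>, x\<^sub>k\<close> is regular if the class of each \<open>x\<^sub>i\<close> is a nonzerodivisor on
  \<open>R / (x\<^sub>1, \<dots>, x\<^sub>i\<^sub>-\<^sub>1)\<close> and \<open>R / (x\<^sub>1, \<dots>, x\<^sub>k)\<close> is not the zero ring.
\<close>
definition regular_sequence :: "('a, 'b) ring_scheme \<Rightarrow> 'a list \<Rightarrow> bool" where
  "regular_sequence R xs \<longleftrightarrow>
     set xs \<subseteq> carrier R \<and>
     (\<forall>i<length xs.
        nonzerodivisor (R Quot genideal R (set (take i xs)))
          (genideal R (set (take i xs)) +>\<^bsub>R\<^esub> xs ! i)) \<and>
     genideal R (set xs) \<noteq> carrier R"

text \<open>For a Noetherian local ring with maximal ideal \<open>M\<close> this is the depth of the ring.\<close>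
definition depth :: "('a, 'b) ring_scheme \<Rightarrow> 'a set \<Rightarrow> enat" where
  "depth R M = Sup {enat (length xs) | xs. regular_sequence R xs \<and> set xs \<subseteq> M}"

definition fraction_rel :: "('a, 'b) ring_scheme \<Rightarrow> 'a set \<Rightarrow> (('a \<times> 'a) \<times> ('a \<times> 'a)) set" where
  "fraction_rel R S =
     {((a, s), (b, t)). (a, s) \<in> carrier R \<times> S \<and> (b, t) \<in> carrier R \<times> S \<and>
        (\<exists>u\<in>S. u \<otimes>\<^bsub>R\<^esub> (t \<otimes>\<^bsub>R\<^esub> a \<ominus>\<^bsub>R\<^esub> s \<otimes>\<^bsub>R\<^esub> b) = \<zero>\<^bsub>R\<^esub>)}"

definition fraction_class :: "('a, 'b) ring_scheme \<Rightarrow> 'a set \<Rightarrow> 'a \<Rightarrow> 'a \<Rightarrow> ('a \<times> 'a) set" where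
  "fraction_class R S a s = fraction_rel R S `` {(a, s)}"

text \<open>
  The ring of fractions \<open>S\<^sup>-\<^sup>1R\<close> of a commutative ring at a multiplicative subset \<open>S\<close>.
  The operations do not depend on the representatives, so each union below is over
  copies of one and the same class.
\<close>
definition fraction_ring :: "('a, 'b) ring_scheme \<Rightarrow> 'a set \<Rightarrow> ('a \<times> 'a) set ring" where
  "fraction_ring R S =
     \<lparr>carrier = (carrier R \<times> S) // fraction_rel R S,
      mult = (\<lambda>A B. \<Union>(a, s)\<in>A. \<Union>(b, t)\<in>B. fraction_class R S (a \<otimes>\<^bsub>R\<^esub> b) (s \<otimes>\<^bsub>R\<^esub> t)),
      one = fraction_class R S \<one>\<^bsub>R\<^esub> \<one>\<^bsub>R\<^esub>,
      zero = fraction_class R S \<zero>\<^bsub>R\<^esub> \<one>\<^bsub>R\<^esub>,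
      add = (\<lambda>A B. \<Union>(a, s)\<in>A. \<Union>(b, t)\<in>B.
               fraction_class R S (t \<otimes>\<^bsub>R\<^esub> a \<oplus>\<^bsub>R\<^esub> s \<otimes>\<^bsub>R\<^esub> b) (s \<otimes>\<^bsub>R\<^esub> t))\<rparr>"

definition localization_at :: "('a, 'b) ring_scheme \<Rightarrow> 'a set \<Rightarrow> ('a \<times> 'a) set ring" where
  "localization_at R P = fraction_ring R (carrier R - P)"

definition cohen_macaulay_local :: "('a, 'b) ring_scheme \<Rightarrow> bool" where
  "cohen_macaulay_local R \<longleftrightarrow>
     cring R \<and> noetherian_ring R \<and>
     (\<exists>M. maximalideal M R \<and> (\<forall>N. maximalideal N R \<longrightarrow> N = M) \<and> depth R M = krull_dim R)"

definition cohen_macaulay :: "('a, 'b) ring_scheme \<Rightarrow> bool" where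
  "cohen_macaulay R \<longleftrightarrow>
     cring R \<and> noetherian_ring R \<and>
     (\<forall>M. maximalideal M R \<longrightarrow> cohen_macaulay_local (localization_at R M))"

section \<open>Monoid algebras\<close>

definition monoid_algebra :: "('a, 'b) monoid_scheme \<Rightarrow> ('a \<Rightarrow>\<^sub>0 'k::comm_ring_1) ring" where
  "monoid_algebra M =
     \<lparr>carrier = {f. Poly_Mapping.keys f \<subseteq> carrier M},
      mult = (\<lambda>f g. \<Sum>x\<in>Poly_Mapping.keys f. \<Sum>y\<in>Poly_Mapping.keys g.
                Poly_Mapping.single (x \<otimes>\<^bsub>M\<^esub> y)
                  (Poly_Mapping.lookup f x * Poly_Mapping.lookup g y)),
      one = Poly_Mapping.single \<one>\<^bsub>M\<^esub> 1,
      zero = 0,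
      add = (+)\<rparr>"

section \<open>Semistandard Young tableaux\<close>

text \<open>
  A tableau is the list of its rows from top to bottom. All rows of a semistandard tableau
  are nonempty, so the representation is unique and the number of rows is the length of the
  list; the empty tableau is \<open>[]\<close>. The shape is \<open>map length T\<close>.
\<close>
type_synonym tableau = "nat list list"

definition is_partition :: "nat list \<Rightarrow> bool" where
  "is_partition p \<longleftrightarrow> sorted_wrt (\<ge>) p \<and> (\<forall>k\<in>set p. 0 < k)"

definition semistandard :: "tableau \<Rightarrow> bool" where
  "semistandard T \<longleftrightarrow>
     is_partition (map length T) \<and>
     (\<forall>r\<in>set T. sorted r \<and> (\<forall>k\<in>set r. 0 < k)) \<and>
     (\<forall>i j. Suc i < length T \<and> j < length (T ! Suc i) \<longrightarrow> T ! i ! j < T ! Suc i ! j)"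

definition SSYT :: "nat \<Rightarrow> nat \<Rightarrow> tableau set" where
  "SSYT n m = {T. semistandard T \<and> length T \<le> n \<and> (\<forall>r\<in>set T. set r \<subseteq> {1..m})}"

fun tableau_star :: "tableau \<Rightarrow> tableau \<Rightarrow> tableau" where
  "tableau_star [] U = U"
| "tableau_star T [] = T"
| "tableau_star (r # T) (s # U) = sort (r @ s) # tableau_star T U"

definition SSYT_monoid :: "nat \<Rightarrow> nat \<Rightarrow> tableau monoid" where
  "SSYT_monoid n m = \<lparr>carrier = SSYT n m, mult = tableau_star, one = []\<rparr>"

definition tableaux_algebra :: "nat \<Rightarrow> nat \<Rightarrow> (tableau \<Rightarrow>\<^sub>0 'k::field) ring" where
  "tableaux_algebra n m = monoid_algebra (SSYT_monoid n m)"

end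

theory Submission
  imports Defs "HOL-Library.Function_Algebras" "HOL-Library.List_Lenlexorder"
begin

text \<open>
  Let \<open>f(i, k)\<close> be the number of entries at most \<open>k\<close> in row \<open>i\<close> of a semistandard tableau. The rows are
  sorted, so the numbers \<open>f(i, k)\<close> determine the tableau; the columns are strictly increasing exactly
  when \<open>f(i + 1, k + 1) \<le> f(i, k)\<close>; and \<open>\<star>\<close> adds these numbers, since it merges rows as multisets.
  Hence the monoid of tableaux is the monoid \<open>S\<close> of all functions \<open>f\<close> from a finite set \<open>P\<close> of positions
  to the naturals that satisfy finitely many inequalities \<open>f b \<le> f a\<close> (Gelfand--Tsetlin patterns), and
  the tableaux algebra is the algebra \<open>A\<close> spanned by the monomials \<open>x\<^sup>f\<close> with \<open>f \<in> S\<close>, a Hibi ring.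
  Put \<open>p = card P\<close>. Four facts about \<open>A\<close> give the theorem.

  \<^item> \<open>A\<close> is Noetherian (\<open>noetherian_A\<close>). Divisibility of monomials inside \<open>S\<close> is the componentwise order
    of the vectors of all \<open>f a\<close> and all \<open>f a - f b\<close>, so Dickson's lemma applies to leading monomials.

  \<^item> Chains of primes of \<open>A\<close> have length at most \<open>p\<close> (\<open>prime_chain_length_le\<close>). Along a chain of length \<open>k\<close>
    there are \<open>N\<^sup>k\<close> linearly independent products in degree \<open>O(N)\<close>, but only \<open>O(N\<^sup>p)\<close> monomials are there.

  \<^item> Over an algebraically closed field \<open>A / M\<close> is the ground field for each maximal ideal \<open>M\<close>
    (\<open>nullstellensatz\<close>). If \<open>t\<close> were transcendental modulo \<open>M\<close>, then division by leading monomials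
    over \<open>K[t]\<close> would express all elements of \<open>A / M\<close> with powers of one polynomial \<open>D(t)\<close> as
    denominators, and \<open>1 / (t - r)\<close> is not of this form when \<open>D(r) \<noteq> 0\<close>.

  \<^item> Let \<open>\<theta>\<^sub>i\<close> be the sum of the monomials \<open>x\<^sup>I\<close> over the sets \<open>I\<close> of size \<open>i\<close> whose indicator function is in
    \<open>S\<close>. For any constants, \<open>\<theta>\<^sub>1 - c\<^sub>1, \<dots>, \<theta>\<^sub>p - c\<^sub>p\<close> satisfies the cancellation conditions of a regular sequence (\<open>weakly_regular_\<theta>\<close>), because \<open>A\<close> is
    a free module over the polynomial ring in these elements. The module basis is the descent basis of
    Garsia and Stanton: sort the positions by decreasing value of \<open>f\<close>, ties broken by the label. The
    resulting word and the gaps between consecutive values that its descents do not force determine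
    \<open>f\<close>. The product of the parameters, each taken as often as its gap says, with the remaining monomial
    has the leading monomial \<open>x\<^sup>f\<close> for a suitable order (\<open>basis_leading\<close>).

  By the last two facts each maximal ideal contains a regular sequence of length \<open>p\<close>. It stays regular
  in the localization, so the depth there is at least \<open>p\<close>. The depth is at most the dimension
  (\<open>depth_le_krull_dim\<close>), and the dimension is at most \<open>p\<close>; all three numbers are equal.
\<close>

section \<open>Regular sequences and chains of primes\<close>

lemma (in cring) nonzerodivisor_Quot_iff:
  assumes I: "ideal I R" and x: "x \<in> carrier R"
  shows "nonzerodivisor (R Quot I) (I +> x) \<longleftrightarrow> (\<forall>y\<in>carrier R. x \<otimes> y \<in> I \<longrightarrow> y \<in> I)"
proof -
  interpret I: ideal I R by (rule I)
  have z: "I +> a = I \<longleftrightarrow> a \<in> I" if "a \<in> carrier R" for a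
    using that I.rcos_const_imp_mem[of a] a_rcos_zero[OF I, of a] by auto
  have c: "carrier (R Quot I) = (\<lambda>a. I +> a) ` carrier R"
    by (auto simp: FactRing_def A_RCOSETS_def')
  have m: "(I +> x) \<otimes>\<^bsub>R Quot I\<^esub> (I +> y) = I +> (x \<otimes> y)" if "y \<in> carrier R" for y
    using that x by (simp add: FactRing_def I.rcoset_mult_add)
  have o: "\<zero>\<^bsub>R Quot I\<^esub> = I" by (simp add: FactRing_def)
  show ?thesis
    unfolding nonzerodivisor_def c o using x by (auto simp: m z)
qed

text \<open>
  A regular sequence without the condition that it generates a proper ideal, stated by membership in
  ideals rather than in quotient rings. For a sequence inside a proper ideal it is regularity.
\<close>
definition weakly_regular :: "('a, 'b) ring_scheme \<Rightarrow> 'a list \<Rightarrow> bool" where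
  "weakly_regular R xs \<longleftrightarrow> set xs \<subseteq> carrier R \<and>
     (\<forall>i<length xs. \<forall>y\<in>carrier R. xs ! i \<otimes>\<^bsub>R\<^esub> y \<in> genideal R (set (take i xs)) \<longrightarrow>
        y \<in> genideal R (set (take i xs)))"

lemma (in cring) regular_sequence_iff:
  "regular_sequence R xs \<longleftrightarrow> weakly_regular R xs \<and> genideal R (set xs) \<noteq> carrier R"
proof (cases "set xs \<subseteq> carrier R")
  case True
  have "nonzerodivisor (R Quot genideal R (set (take i xs))) (genideal R (set (take i xs)) +> xs ! i)
    \<longleftrightarrow> (\<forall>y\<in>carrier R. xs ! i \<otimes> y \<in> genideal R (set (take i xs)) \<longrightarrow> y \<in> genideal R (set (take i xs)))"
    if "i < length xs" for i
    using that True set_take_subset[of i xs]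
    by (intro nonzerodivisor_Quot_iff genideal_ideal) (auto dest: nth_mem)
  then show ?thesis using True unfolding regular_sequence_def weakly_regular_def by auto
next
  case False
  then show ?thesis unfolding regular_sequence_def weakly_regular_def by auto
qed

text \<open>
  The powers of \<open>x\<close> times the elements outside \<open>P\<close> form a multiplicative set that does not meet \<open>I\<close>,
  because \<open>x\<close> can be cancelled modulo \<open>I\<close>. An ideal that is maximal among those above \<open>I\<close> and disjoint
  from this set is prime, is contained in \<open>P\<close> and misses \<open>x\<close>.
\<close>
lemma exists_smaller_prime:
  fixes R (structure)
  assumes "cring R" and "noetherian_ring R" and P: "primeideal P R" and I: "ideal I R" and IP: "I \<subseteq> P"
    and x: "x \<in> P" and reg: "\<And>y. y \<in> carrier R \<Longrightarrow> x \<otimes>\<^bsub>R\<^esub> y \<in> I \<Longrightarrow> y \<in> I"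
  shows "\<exists>Q. primeideal Q R \<and> I \<subseteq> Q \<and> Q \<subset> P"
proof -
  interpret cring R by fact
  interpret N: noetherian_ring R by fact
  interpret P: primeideal P R by fact
  interpret I: ideal I R by fact
  have xc: "x \<in> carrier R" using x P.a_subset by auto
  define S where "S = {x [^] n \<otimes> s |n s. s \<in> carrier R - P \<and> n \<in> (UNIV::nat set)}"
  have Sc: "S \<subseteq> carrier R" using xc by (auto simp: S_def)
  have Smult: "a \<otimes> b \<in> S" if ab: "a \<in> S" "b \<in> S" for a b
  proof -
    obtain n s m t where *: "a = x [^] (n::nat) \<otimes> s" "b = x [^] (m::nat) \<otimes> t" "s \<in> carrier R" "t \<in> carrier R" "s \<notin> P" "t \<notin> P"
      using ab by (auto simp: S_def)
    have "a \<otimes> b = x [^] (n + m) \<otimes> (s \<otimes> t)"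
      using * xc by (simp add: nat_pow_mult[symmetric] m_ac)
    moreover have "s \<otimes> t \<notin> P" using * P.I_prime by blast
    ultimately show ?thesis using * by (auto simp: S_def)
  qed
  have pow_reg: "y \<in> I" if "x [^] (n::nat) \<otimes> y \<in> I" "y \<in> carrier R" for n y
    using that
  proof (induction n arbitrary: y)
    case 0
    then show ?case by simp
  next
    case (Suc n)
    have "x \<otimes> (x [^] n \<otimes> y) \<in> I" using Suc.prems xc by (simp add: m_ac)
    from reg[OF _ this] have "x [^] n \<otimes> y \<in> I" using Suc.prems(2) xc by simp
    from Suc.IH[OF this Suc.prems(2)] show ?case .
  qed
  have SI: "S \<inter> I = {}"
  proof -
    have False if "x [^] n \<otimes> s \<in> I" "s \<in> carrier R" "s \<notin> P" for n :: nat and s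
      using pow_reg[OF that(1,2)] that(3) IP by blast
    then show ?thesis by (auto simp: S_def)
  qed
  define A where "A = {J. ideal J R \<and> I \<subseteq> J \<and> S \<inter> J = {}}"
  have "\<exists>J\<in>A. \<forall>X\<in>A. J \<subseteq> X \<longrightarrow> X = J"
  proof (rule subset_Zorn_nonempty)
    show "A \<noteq> {}" using I SI by (auto simp: A_def)
    fix C assume C: "C \<noteq> {}" "subset.chain A C"
    then have "subset.chain {J. ideal J R} C" by (auto simp: subset.chain_def A_def)
    then have "\<Union>C \<in> C" using N.ideal_chain_is_trivial C by blast
    then show "\<Union>C \<in> A" using C by (auto simp: subset.chain_def)
  qed
  then obtain J where JA: "J \<in> A" and JA_max: "\<forall>X\<in>A. J \<subseteq> X \<longrightarrow> X = J" ..
  have J: "ideal J R" "I \<subseteq> J" "S \<inter> J = {}" using JA by (auto simp: A_def)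
  have Jmax: "X = J" if "ideal X R" "I \<subseteq> X" "S \<inter> X = {}" "J \<subseteq> X" for X
    using JA_max that by (auto simp: A_def)
  interpret J: ideal J R by fact
  have one_S: "s \<in> S" if "s \<in> carrier R - P" for s
    using that by (auto simp: S_def intro!: exI[of _ 0] exI[of _ s])
  have xS: "x \<in> S"
    using xc P.I_notcarr P.one_imp_carrier by (auto simp: S_def intro!: exI[of _ "1::nat"] exI[of _ \<one>])
  \<comment> \<open>the ideal of all \<open>y\<close> with \<open>a \<otimes> y \<in> J\<close> is strictly larger than \<open>J\<close>, so it meets \<open>S\<close>\<close>
  have step: "\<exists>s\<in>S. a \<otimes> s \<in> J" if "a \<in> carrier R" "b \<in> carrier R" "a \<otimes> b \<in> J" "b \<notin> J" for a b
  proof (rule ccontr)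
    assume no: "\<not> ?thesis"
    let ?X = "{y \<in> carrier R. a \<otimes> y \<in> J}"
    have "ideal ?X R" using J.helper_max_prime[OF is_cring that(1)] .
    moreover have "J \<subseteq> ?X" using J.a_subset that(1) J.I_l_closed by auto
    moreover have "S \<inter> ?X = {}" using no by auto
    ultimately have "?X = J" using Jmax[of ?X] J(2) by auto
    then show False using that by auto
  qed
  have "primeideal J R"
  proof (rule primeidealI[OF J(1) is_cring])
    show "carrier R \<noteq> J" using xS Sc J(3) by auto
    fix a b assume ab: "a \<in> carrier R" "b \<in> carrier R" "a \<otimes> b \<in> J"
    show "a \<in> J \<or> b \<in> J"
    proof (rule ccontr)
      assume n: "\<not> ?thesis"
      obtain s where s: "s \<in> S" "a \<otimes> s \<in> J" using step[of a b] ab n by auto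
      have "s \<in> carrier R" "s \<otimes> a \<in> J" using s Sc ab m_comm by auto
      then obtain t where "t \<in> S" "s \<otimes> t \<in> J" using step[of s a] ab n by auto
      then show False using Smult s J(3) by blast
    qed
  qed
  moreover have "J \<subset> P" using one_S J J.a_subset xS x by blast
  ultimately show ?thesis using J by auto
qed

text \<open>
  The chain is built downwards from \<open>P\<close>: the last element of the sequence leads to a strictly smaller
  prime that still contains the others.
\<close>
lemma prime_chain_of_regular_sequence:
  fixes R (structure)
  assumes R: "cring R" "noetherian_ring R" and P: "primeideal P R" and xs: "weakly_regular R xs" "set xs \<subseteq> P"
  shows "\<exists>Q. (\<forall>i\<le>length xs. primeideal (Q i) R) \<and> (\<forall>i<length xs. Q i \<subset> Q (Suc i)) \<and> Q (length xs) = P"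
  using P xs
proof (induction xs arbitrary: P rule: rev_induct)
  case Nil
  then show ?case by (intro exI[of _ "\<lambda>_. P"]) auto
next
  case (snoc x xs)
  interpret cring R by fact
  interpret P: primeideal P R by (rule snoc.prems)
  let ?I = "genideal R (set xs)"
  have sc: "set xs \<subseteq> carrier R" using snoc.prems by (auto simp: weakly_regular_def)
  have I: "ideal ?I R" using sc by (rule genideal_ideal)
  have "?I \<subseteq> P" using snoc.prems by (intro genideal_minimal) (auto simp: P.is_ideal)
  moreover have "y \<in> ?I" if "y \<in> carrier R" "x \<otimes>\<^bsub>R\<^esub> y \<in> ?I" for y
    using snoc.prems(2) that by (auto simp: weakly_regular_def nth_append dest!: spec[of _ "length xs"])
  ultimately obtain P' where P': "primeideal P' R" "?I \<subseteq> P'" "P' \<subset> P"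
    using exists_smaller_prime[OF R snoc.prems(1) I, of x] snoc.prems(3) by (metis in_set_conv_decomp subset_code(1))
  have "weakly_regular R xs"
    unfolding weakly_regular_def
  proof (intro conjI allI impI sc)
    fix i assume i: "i < length xs"
    have "set (take i (xs @ [x])) = set (take i xs)" "(xs @ [x]) ! i = xs ! i"
      using i by (auto simp: nth_append)
    moreover have "i < length (xs @ [x])" using i by simp
    ultimately show "\<forall>y\<in>carrier R. xs ! i \<otimes> y \<in> Idl set (take i xs) \<longrightarrow> y \<in> Idl set (take i xs)"
      using snoc.prems(2) unfolding weakly_regular_def by metis
  qed
  moreover have "set xs \<subseteq> P'" using P'(2) genideal_self[OF sc] by auto
  ultimately obtain Q where Q: "\<forall>i\<le>length xs. primeideal (Q i) R" "\<forall>i<length xs. Q i \<subset> Q (Suc i)" "Q (length xs) = P'"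
    using snoc.IH[OF P'(1)] by auto
  show ?case
    by (rule exI[of _ "Q(Suc (length xs) := P)"]) (use Q P' snoc.prems in \<open>auto simp: le_Suc_eq less_Suc_eq\<close>)
qed

lemma depth_le_krull_dim:
  assumes R: "cring R" "noetherian_ring R" and M: "primeideal M R"
  shows "depth R M \<le> krull_dim R"
  unfolding depth_def
proof (rule Sup_least, clarify)
  fix xs assume "regular_sequence R xs" "set xs \<subseteq> M"
  then have "weakly_regular R xs" using cring.regular_sequence_iff[OF R(1)] by auto
  from prime_chain_of_regular_sequence[OF R M this \<open>set xs \<subseteq> M\<close>]
  show "enat (length xs) \<le> krull_dim R"
    unfolding krull_dim_def by (intro Sup_upper) auto
qed

section \<open>Localization\<close>

locale localization = cring R for R (structure) +
  fixes S :: "'a set"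
  assumes S_subset: "S \<subseteq> carrier R" and one_S: "\<one> \<in> S"
    and mult_S: "s \<in> S \<Longrightarrow> t \<in> S \<Longrightarrow> s \<otimes> t \<in> S"
begin

abbreviation "fr a s \<equiv> fraction_class R S a s"
abbreviation "L \<equiv> (fraction_ring R S :: (('a \<times> 'a) set) ring)"

lemma S_carrier [simp, intro]: "s \<in> S \<Longrightarrow> s \<in> carrier R"
  using S_subset by auto

lemma fraction_rel_iff:
  "((a, s), (b, t)) \<in> fraction_rel R S \<longleftrightarrow>
     a \<in> carrier R \<and> s \<in> S \<and> b \<in> carrier R \<and> t \<in> S \<and> (\<exists>u\<in>S. u \<otimes> (t \<otimes> a) = u \<otimes> (s \<otimes> b))"
proof -
  have "u \<otimes> (t \<otimes> a \<ominus> s \<otimes> b) = \<zero> \<longleftrightarrow> u \<otimes> (t \<otimes> a) = u \<otimes> (s \<otimes> b)"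
    if "a \<in> carrier R" "s \<in> S" "b \<in> carrier R" "t \<in> S" "u \<in> S" for u
  proof -
    have "u \<otimes> (t \<otimes> a \<ominus> s \<otimes> b) = u \<otimes> (t \<otimes> a) \<ominus> u \<otimes> (s \<otimes> b)"
      using that S_carrier[of s] S_carrier[of t] S_carrier[of u] by algebra
    then show ?thesis using that by simp
  qed
  then show ?thesis by (auto simp: fraction_rel_def)
qed

lemma equiv_fraction_rel: "equiv (carrier R \<times> S) (fraction_rel R S)"
proof (rule equivI)
  show "fraction_rel R S \<subseteq> (carrier R \<times> S) \<times> (carrier R \<times> S)" by (auto simp: fraction_rel_def)
  show "refl_on (carrier R \<times> S) (fraction_rel R S)"
    using one_S by (auto simp: refl_on_def fraction_rel_iff intro!: bexI[of _ \<one>])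
  show "sym (fraction_rel R S)"
    by (rule symI) (clarsimp simp: fraction_rel_iff, metis)
  show "trans (fraction_rel R S)"
  proof (rule transI, clarify)
    fix a s b t c r
    assume "((a, s), (b, t)) \<in> fraction_rel R S" "((b, t), (c, r)) \<in> fraction_rel R S"
    then obtain u v where *: "a \<in> carrier R" "s \<in> S" "b \<in> carrier R" "t \<in> S" "c \<in> carrier R" "r \<in> S"
      "u \<in> S" "v \<in> S" and e: "u \<otimes> (t \<otimes> a) = u \<otimes> (s \<otimes> b)" "v \<otimes> (r \<otimes> b) = v \<otimes> (t \<otimes> c)"
      unfolding fraction_rel_iff by blast
    have "(u \<otimes> v \<otimes> t) \<otimes> (r \<otimes> a) = v \<otimes> r \<otimes> (u \<otimes> (t \<otimes> a))" using * by (simp add: m_ac)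
    also have "\<dots> = u \<otimes> s \<otimes> (v \<otimes> (r \<otimes> b))" unfolding e(1) using * by (simp add: m_ac)
    also have "\<dots> = (u \<otimes> v \<otimes> t) \<otimes> (s \<otimes> c)" unfolding e(2) using * by (simp add: m_ac)
    finally show "((a, s), (c, r)) \<in> fraction_rel R S"
      using * mult_S by (auto simp: fraction_rel_iff intro!: bexI[of _ "u \<otimes> v \<otimes> t"])
  qed
qed

lemma fr_eq_iff:
  assumes "a \<in> carrier R" "s \<in> S" "b \<in> carrier R" "t \<in> S"
  shows "fr a s = fr b t \<longleftrightarrow> (\<exists>u\<in>S. u \<otimes> (t \<otimes> a) = u \<otimes> (s \<otimes> b))"
  using eq_equiv_class_iff[OF equiv_fraction_rel, of "(a, s)" "(b, t)"] assms
  by (simp add: fraction_class_def fraction_rel_iff)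

lemma fr_eqI:
  assumes "a \<in> carrier R" "s \<in> S" "b \<in> carrier R" "t \<in> S" "t \<otimes> a = s \<otimes> b"
  shows "fr a s = fr b t"
  using assms one_S by (subst fr_eq_iff) auto

lemma mem_fr_iff:
  assumes "a \<in> carrier R" "s \<in> S"
  shows "(b, t) \<in> fr a s \<longleftrightarrow> b \<in> carrier R \<and> t \<in> S \<and> fr a s = fr b t"
proof -
  have "(b, t) \<in> fr a s \<longleftrightarrow> ((a, s), (b, t)) \<in> fraction_rel R S" by (simp add: fraction_class_def)
  then show ?thesis using assms fr_eq_iff fraction_rel_iff by metis
qed

lemma carrier_L: "carrier L = {fr a s |a s. a \<in> carrier R \<and> s \<in> S}"
  by (auto simp: fraction_ring_def fraction_class_def quotient_def)

lemma fr_closed [simp, intro]: "a \<in> carrier R \<Longrightarrow> s \<in> S \<Longrightarrow> fr a s \<in> carrier L"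
  unfolding carrier_L by blast

lemma L_cases:
  assumes "x \<in> carrier L" obtains a s where "a \<in> carrier R" "s \<in> S" "x = fr a s"
  using assms unfolding carrier_L by blast

lemma one_L: "\<one>\<^bsub>L\<^esub> = fr \<one> \<one>" and zero_L: "\<zero>\<^bsub>L\<^esub> = fr \<zero> \<one>"
  by (simp_all add: fraction_ring_def)

text \<open>
  The operations of the ring of fractions are unions over all pairs of representatives; they can be
  evaluated once the result is known to be the same for all of them.
\<close>
lemma UN_fr_const:
  assumes "a \<in> carrier R" "s \<in> S" "b \<in> carrier R" "t \<in> S"
    and "\<And>a' s' b' t'. \<lbrakk>a' \<in> carrier R; s' \<in> S; b' \<in> carrier R; t' \<in> S; fr a s = fr a' s'; fr b t = fr b' t'\<rbrakk>
       \<Longrightarrow> f a' s' b' t' = C"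
  shows "(\<Union>(a', s')\<in>fr a s. \<Union>(b', t')\<in>fr b t. f a' s' b' t') = C"
proof -
  have "(\<Union>(b', t')\<in>fr b t. f a' s' b' t') = C" if "(a', s') \<in> fr a s" for a' s'
  proof -
    have "(case z of (b', t') \<Rightarrow> f a' s' b' t') = C" if "z \<in> fr b t" for z
      using that \<open>(a', s') \<in> fr a s\<close> assms(1-4) by (cases z) (simp add: mem_fr_iff assms(5))
    moreover have "(b, t) \<in> fr b t" using assms by (simp add: mem_fr_iff)
    ultimately show ?thesis by (intro UN_constant_eq ballI)
  qed
  moreover have "(a, s) \<in> fr a s" using assms by (simp add: mem_fr_iff)
  ultimately show ?thesis by (intro UN_constant_eq[of "(a, s)"]) (simp_all add: Ball_def split_paired_All)
qed

lemma mult_frac: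
  assumes "a \<in> carrier R" "s \<in> S" "b \<in> carrier R" "t \<in> S"
  shows "fr a s \<otimes>\<^bsub>L\<^esub> fr b t = fr (a \<otimes> b) (s \<otimes> t)"
  unfolding fraction_ring_def monoid.simps
proof (rule UN_fr_const[OF assms])
  fix a' s' b' t' assume *: "a' \<in> carrier R" "s' \<in> S" "b' \<in> carrier R" "t' \<in> S"
    and "fr a s = fr a' s'" "fr b t = fr b' t'"
  then obtain u v where uv: "u \<in> S" "v \<in> S" "u \<otimes> (s' \<otimes> a) = u \<otimes> (s \<otimes> a')" "v \<otimes> (t' \<otimes> b) = v \<otimes> (t \<otimes> b')"
    using assms fr_eq_iff[of a s a' s'] fr_eq_iff[of b t b' t'] by blast
  have "(u \<otimes> v) \<otimes> ((s \<otimes> t) \<otimes> (a' \<otimes> b')) = (u \<otimes> (s \<otimes> a')) \<otimes> (v \<otimes> (t \<otimes> b'))" using * assms uv(1,2) by (simp add: m_ac)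
  also have "\<dots> = (u \<otimes> v) \<otimes> ((s' \<otimes> t') \<otimes> (a \<otimes> b))"
    unfolding uv(3)[symmetric] uv(4)[symmetric] using * assms uv(1,2) by (simp add: m_ac)
  finally show "fr (a' \<otimes> b') (s' \<otimes> t') = fr (a \<otimes> b) (s \<otimes> t)"
    using * assms uv mult_S by (subst fr_eq_iff) auto
qed

lemma add_frac:
  assumes "a \<in> carrier R" "s \<in> S" "b \<in> carrier R" "t \<in> S"
  shows "fr a s \<oplus>\<^bsub>L\<^esub> fr b t = fr (t \<otimes> a \<oplus> s \<otimes> b) (s \<otimes> t)"
  unfolding fraction_ring_def ring_record_simps
proof (rule UN_fr_const[OF assms])
  fix a' s' b' t' assume *: "a' \<in> carrier R" "s' \<in> S" "b' \<in> carrier R" "t' \<in> S"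
    and "fr a s = fr a' s'" "fr b t = fr b' t'"
  then obtain u v where uv: "u \<in> S" "v \<in> S" "u \<otimes> (s' \<otimes> a) = u \<otimes> (s \<otimes> a')" "v \<otimes> (t' \<otimes> b) = v \<otimes> (t \<otimes> b')"
    using assms fr_eq_iff[of a s a' s'] fr_eq_iff[of b t b' t'] by blast
  have c: "a \<in> carrier R" "s \<in> carrier R" "b \<in> carrier R" "t \<in> carrier R" "a' \<in> carrier R" "s' \<in> carrier R"
     "b' \<in> carrier R" "t' \<in> carrier R" "u \<in> carrier R" "v \<in> carrier R"
    using * assms uv by auto
  have "(u \<otimes> v) \<otimes> ((s \<otimes> t) \<otimes> (t' \<otimes> a' \<oplus> s' \<otimes> b')) =
      (v \<otimes> t \<otimes> t') \<otimes> (u \<otimes> (s \<otimes> a')) \<oplus> (u \<otimes> s \<otimes> s') \<otimes> (v \<otimes> (t \<otimes> b'))" using c by algebra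
  also have "\<dots> = (u \<otimes> v) \<otimes> ((s' \<otimes> t') \<otimes> (t \<otimes> a \<oplus> s \<otimes> b))"
    unfolding uv(3)[symmetric] uv(4)[symmetric] using c by algebra
  finally show "fr (t' \<otimes> a' \<oplus> s' \<otimes> b') (s' \<otimes> t') = fr (t \<otimes> a \<oplus> s \<otimes> b) (s \<otimes> t)"
    using * assms uv mult_S by (subst fr_eq_iff) auto
qed

lemma cring_L: "cring L"
proof (rule cringI)
  show "abelian_group L"
  proof (rule abelian_groupI)
    fix x assume "x \<in> carrier L"
    then obtain a s where x: "a \<in> carrier R" "s \<in> S" "x = fr a s" by (rule L_cases)
    show "\<zero>\<^bsub>L\<^esub> \<oplus>\<^bsub>L\<^esub> x = x" using x one_S by (simp add: zero_L add_frac)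
    have "fr (\<ominus> a) s \<oplus>\<^bsub>L\<^esub> x = fr (s \<otimes> \<ominus> a \<oplus> s \<otimes> a) (s \<otimes> s)" using x by (simp add: add_frac)
    also have "s \<otimes> \<ominus> a \<oplus> s \<otimes> a = \<zero>" using x by (simp add: r_minus l_neg)
    also have "fr \<zero> (s \<otimes> s) = \<zero>\<^bsub>L\<^esub>" unfolding zero_L using x one_S mult_S by (intro fr_eqI) auto
    finally show "\<exists>y\<in>carrier L. y \<oplus>\<^bsub>L\<^esub> x = \<zero>\<^bsub>L\<^esub>" using x by (intro bexI[of _ "fr (\<ominus> a) s"]) auto
    fix y assume "y \<in> carrier L"
    then obtain b t where y: "b \<in> carrier R" "t \<in> S" "y = fr b t" by (rule L_cases)
    show "x \<oplus>\<^bsub>L\<^esub> y \<in> carrier L" using x y mult_S by (auto simp: add_frac)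
    show "x \<oplus>\<^bsub>L\<^esub> y = y \<oplus>\<^bsub>L\<^esub> x" using x y by (simp add: add_frac m_comm a_comm)
    fix z assume "z \<in> carrier L"
    then obtain c r where z: "c \<in> carrier R" "r \<in> S" "z = fr c r" by (rule L_cases)
    show "x \<oplus>\<^bsub>L\<^esub> y \<oplus>\<^bsub>L\<^esub> z = x \<oplus>\<^bsub>L\<^esub> (y \<oplus>\<^bsub>L\<^esub> z)"
      using x y z mult_S by (simp add: add_frac r_distr m_ac a_ac)
  next
    show "\<zero>\<^bsub>L\<^esub> \<in> carrier L" using one_S by (simp add: zero_L fr_closed)
  qed
  show "comm_monoid L"
  proof (rule comm_monoidI)
    fix x assume "x \<in> carrier L"
    then obtain a s where x: "a \<in> carrier R" "s \<in> S" "x = fr a s" by (rule L_cases)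
    show "\<one>\<^bsub>L\<^esub> \<otimes>\<^bsub>L\<^esub> x = x" using x one_S by (simp add: one_L mult_frac)
    fix y assume "y \<in> carrier L"
    then obtain b t where y: "b \<in> carrier R" "t \<in> S" "y = fr b t" by (rule L_cases)
    show "x \<otimes>\<^bsub>L\<^esub> y \<in> carrier L" using x y mult_S by (auto simp: mult_frac)
    show "x \<otimes>\<^bsub>L\<^esub> y = y \<otimes>\<^bsub>L\<^esub> x" using x y by (simp add: mult_frac m_comm)
    fix z assume "z \<in> carrier L"
    then obtain c r where z: "c \<in> carrier R" "r \<in> S" "z = fr c r" by (rule L_cases)
    show "x \<otimes>\<^bsub>L\<^esub> y \<otimes>\<^bsub>L\<^esub> z = x \<otimes>\<^bsub>L\<^esub> (y \<otimes>\<^bsub>L\<^esub> z)" using x y z mult_S by (simp add: mult_frac m_assoc)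
  next
    show "\<one>\<^bsub>L\<^esub> \<in> carrier L" using one_S by (simp add: one_L fr_closed)
  qed
  fix x y z assume "x \<in> carrier L" "y \<in> carrier L" "z \<in> carrier L"
  then obtain a s b t c r where *: "a \<in> carrier R" "s \<in> S" "x = fr a s" "b \<in> carrier R" "t \<in> S" "y = fr b t"
    "c \<in> carrier R" "r \<in> S" "z = fr c r" by (metis L_cases)
  have cc: "a \<in> carrier R" "s \<in> carrier R" "b \<in> carrier R" "t \<in> carrier R" "c \<in> carrier R" "r \<in> carrier R"
    using * by auto
  have "(s \<otimes> r \<otimes> (t \<otimes> r)) \<otimes> ((t \<otimes> a \<oplus> s \<otimes> b) \<otimes> c) = (s \<otimes> t \<otimes> r) \<otimes> (t \<otimes> r \<otimes> (a \<otimes> c) \<oplus> s \<otimes> r \<otimes> (b \<otimes> c))"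
    using cc by algebra
  then have "fr ((t \<otimes> a \<oplus> s \<otimes> b) \<otimes> c) (s \<otimes> t \<otimes> r) = fr (t \<otimes> r \<otimes> (a \<otimes> c) \<oplus> s \<otimes> r \<otimes> (b \<otimes> c)) (s \<otimes> r \<otimes> (t \<otimes> r))"
    using * mult_S by (intro fr_eqI) auto
  then show "(x \<oplus>\<^bsub>L\<^esub> y) \<otimes>\<^bsub>L\<^esub> z = x \<otimes>\<^bsub>L\<^esub> z \<oplus>\<^bsub>L\<^esub> y \<otimes>\<^bsub>L\<^esub> z"
    using * mult_S by (simp add: add_frac mult_frac)
qed

sublocale L: cring L by (rule cring_L)

text \<open>
  Ideals of the localization are exactly the extensions of their contractions. This carries finite
  generation, chains of primes and regular sequences between the two rings.
\<close>

definition ext :: "'a set \<Rightarrow> ('a \<times> 'a) set set" where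
  "ext I = {fr a s |a s. a \<in> I \<and> s \<in> S}"

lemma fr_mem_ext_iff:
  assumes I: "ideal I R" and "a \<in> carrier R" "s \<in> S"
  shows "fr a s \<in> ext I \<longleftrightarrow> (\<exists>u\<in>S. u \<otimes> a \<in> I)"
proof
  interpret I: ideal I R by fact
  assume "fr a s \<in> ext I"
  then obtain b t where b: "fr a s = fr b t" "b \<in> I" "t \<in> S" unfolding ext_def by blast
  then obtain u where u: "u \<in> S" "u \<otimes> (t \<otimes> a) = u \<otimes> (s \<otimes> b)" using assms fr_eq_iff I.Icarr by metis
  have "u \<otimes> (s \<otimes> b) \<in> I" using u b assms by (intro I.I_l_closed) auto
  then have "(u \<otimes> t) \<otimes> a \<in> I" using u b assms by (simp add: m_assoc)
  then show "\<exists>u\<in>S. u \<otimes> a \<in> I" using u b mult_S by blast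
next
  interpret I: ideal I R by fact
  assume "\<exists>u\<in>S. u \<otimes> a \<in> I"
  then obtain u where u: "u \<in> S" "u \<otimes> a \<in> I" ..
  have "fr a s = fr (u \<otimes> a) (u \<otimes> s)" using u assms mult_S by (intro fr_eqI) (auto simp: m_ac)
  then show "fr a s \<in> ext I" using u assms mult_S unfolding ext_def by blast
qed

lemma ideal_ext:
  assumes I: "ideal I R" shows "ideal (ext I) L"
proof (rule idealI)
  interpret I: ideal I R by fact
  show "ring L" by (rule L.ring_axioms)
  have addc: "x \<oplus>\<^bsub>L\<^esub> y \<in> ext I" if xy: "x \<in> ext I" "y \<in> ext I" for x y
  proof -
    obtain a s b t where *: "x = fr a s" "y = fr b t" "a \<in> I" "b \<in> I" "s \<in> S" "t \<in> S"
      using xy unfolding ext_def by blast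
    have "t \<otimes> a \<oplus> s \<otimes> b \<in> I" using * by (intro I.a_closed I.I_l_closed) auto
    then show ?thesis using * mult_S I.Icarr unfolding ext_def by (auto simp: add_frac)
  qed
  have multc: "y \<otimes>\<^bsub>L\<^esub> x \<in> ext I" if xy: "x \<in> ext I" "y \<in> carrier L" for x y
  proof -
    obtain a s where x: "x = fr a s" "a \<in> I" "s \<in> S" using xy unfolding ext_def by blast
    obtain b t where y: "b \<in> carrier R" "t \<in> S" "y = fr b t" using L_cases xy by metis
    have "b \<otimes> a \<in> I" using x y by (intro I.I_l_closed) auto
    then show ?thesis using x y mult_S I.Icarr unfolding ext_def by (auto simp: mult_frac)
  qed
  have sub: "ext I \<subseteq> carrier L" using I.Icarr by (auto simp: ext_def)
  have zero: "\<zero>\<^bsub>L\<^esub> \<in> ext I" using one_S I.zero_closed unfolding ext_def zero_L by blast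
  show "subgroup (ext I) (add_monoid L)"
  proof (rule L.add.subgroupI[OF sub])
    show "ext I \<noteq> {}" using zero by auto
    fix x assume x: "x \<in> ext I"
    then have "\<ominus>\<^bsub>L\<^esub> x = (\<ominus>\<^bsub>L\<^esub> \<one>\<^bsub>L\<^esub>) \<otimes>\<^bsub>L\<^esub> x" using sub by (simp add: L.l_minus subset_iff)
    then show "\<ominus>\<^bsub>L\<^esub> x \<in> ext I" using multc[OF x] by simp
    fix y assume "y \<in> ext I" with x show "x \<oplus>\<^bsub>L\<^esub> y \<in> ext I" by (rule addc)
  qed
  fix a x assume ax: "a \<in> ext I" "x \<in> carrier L"
  show "x \<otimes>\<^bsub>L\<^esub> a \<in> ext I" by (rule multc[OF ax])
  then show "a \<otimes>\<^bsub>L\<^esub> x \<in> ext I" using ax sub L.m_comm[of a x] by auto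
qed

definition contr :: "('a \<times> 'a) set set \<Rightarrow> 'a set" where
  "contr J = {a \<in> carrier R. fr a \<one> \<in> J}"

lemma fr_hom: "(\<lambda>a. fr a \<one>) \<in> ring_hom R L"
  using one_S by (auto simp: ring_hom_def mult_frac add_frac one_L)

lemma ideal_contr:
  assumes "ideal J L" shows "ideal (contr J) R"
proof -
  interpret h: ring_hom_ring R L "\<lambda>a. fr a \<one>"
    using fr_hom ring_axioms L.ring_axioms by (intro ring_hom_ringI2)
  show ?thesis using h.ideal_vimage[OF assms] by (simp add: contr_def)
qed

lemma mem_ideal_iff_contr:
  assumes "ideal J L" "a \<in> carrier R" "s \<in> S"
  shows "fr a s \<in> J \<longleftrightarrow> a \<in> contr J"
proof -
  interpret J: ideal J L by fact
  have "fr (s \<otimes> a) (\<one> \<otimes> s) = fr a \<one>"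
    using assms one_S by (intro fr_eqI) (auto simp: m_ac)
  then have e: "fr s \<one> \<otimes>\<^bsub>L\<^esub> fr a s = fr a \<one>" using assms one_S by (simp add: mult_frac)
  have e': "fr \<one> s \<otimes>\<^bsub>L\<^esub> fr a \<one> = fr a s" using assms one_S by (simp add: mult_frac)
  have c: "fr s \<one> \<in> carrier L" "fr \<one> s \<in> carrier L" using assms one_S by auto
  show ?thesis
  proof
    assume "fr a s \<in> J"
    from J.I_l_closed[OF this c(1)] show "a \<in> contr J" using assms e by (simp add: contr_def)
  next
    assume "a \<in> contr J"
    then have "fr a \<one> \<in> J" by (simp add: contr_def)
    from J.I_l_closed[OF this c(2)] show "fr a s \<in> J" using e' by simp
  qed
qed

lemma ext_contr: "ideal J L \<Longrightarrow> ext (contr J) = J"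
proof safe
  fix x assume J: "ideal J L" 
  { assume "x \<in> ext (contr J)"
    then show "x \<in> J" using mem_ideal_iff_contr[OF J] by (auto simp: ext_def contr_def) }
  assume x: "x \<in> J"
  then have "x \<in> carrier L" using J ideal.Icarr by metis
  then obtain a s where "a \<in> carrier R" "s \<in> S" "x = fr a s" by (rule L_cases)
  then show "x \<in> ext (contr J)" using mem_ideal_iff_contr[OF J] x unfolding ext_def by blast
qed

lemma ext_genideal:
  assumes "A \<subseteq> carrier R"
  shows "ext (genideal R A) = genideal L ((\<lambda>a. fr a \<one>) ` A)"
proof
  let ?B = "(\<lambda>a. fr a \<one>) ` A"
  have B: "?B \<subseteq> carrier L" using assms one_S by auto
  have iB: "ideal (genideal L ?B) L" by (rule L.genideal_ideal[OF B])
  have "A \<subseteq> contr (genideal L ?B)" using L.genideal_self[OF B] assms by (auto simp: contr_def)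
  then have "genideal R A \<subseteq> contr (genideal L ?B)" by (intro genideal_minimal ideal_contr iB)
  then have "ext (genideal R A) \<subseteq> ext (contr (genideal L ?B))" by (auto simp: ext_def)
  then show "ext (genideal R A) \<subseteq> genideal L ?B" using ext_contr[OF iB] by simp
  show "genideal L ?B \<subseteq> ext (genideal R A)"
    using genideal_self[OF assms] one_S
    by (intro L.genideal_minimal ideal_ext genideal_ideal assms) (auto simp: ext_def)
qed

lemma noetherian_L:
  assumes "noetherian_ring R" shows "noetherian_ring L"
proof (rule L.noetherian_ringI)
  interpret N: noetherian_ring R by fact
  fix J assume J: "ideal J L"
  obtain A where A: "A \<subseteq> carrier R" "finite A" "contr J = genideal R A"
    using N.finetely_gen[OF ideal_contr[OF J]] by auto
  then have "J = genideal L ((\<lambda>a. fr a \<one>) ` A)" using ext_contr[OF J] ext_genideal by metis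
  then show "\<exists>A\<subseteq>carrier L. finite A \<and> J = genideal L A"
    using A one_S by (intro exI[of _ "(\<lambda>a. fr a \<one>) ` A"]) auto
qed

lemma prime_contr:
  assumes "primeideal P L" shows "primeideal (contr P) R"
proof (rule primeidealI)
  interpret P: primeideal P L by fact
  show "ideal (contr P) R" by (rule ideal_contr[OF P.is_ideal])
  show "cring R" by (rule is_cring)
  show "carrier R \<noteq> contr P"
    using P.one_imp_carrier P.I_notcarr one_L one_closed by (metis (mono_tags, lifting) contr_def mem_Collect_eq)
  fix a b assume ab: "a \<in> carrier R" "b \<in> carrier R" "a \<otimes> b \<in> contr P"
  then have "fr a \<one> \<otimes>\<^bsub>L\<^esub> fr b \<one> \<in> P" using one_S by (simp add: mult_frac contr_def)
  then show "a \<in> contr P \<or> b \<in> contr P" using P.I_prime ab one_S by (auto simp: contr_def)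
qed

lemma contr_strict_mono:
  assumes I: "ideal I L" and J: "ideal J L" and "I \<subset> J"
  shows "contr I \<subset> contr J"
proof (rule psubsetI)
  show "contr I \<subseteq> contr J" using \<open>I \<subset> J\<close> by (auto simp: contr_def)
  show "contr I \<noteq> contr J" using ext_contr[OF I] ext_contr[OF J] \<open>I \<subset> J\<close> by (metis order_less_irrefl)
qed

text \<open>
  An element \<open>b / t\<close> lies in the extension of an ideal iff some \<open>u \<in> S\<close> moves \<open>b\<close> into the ideal, and
  multiplication by \<open>u\<close> commutes with the condition for regularity.
\<close>
lemma weakly_regular_L:
  assumes xs: "weakly_regular R xs" shows "weakly_regular L (map (\<lambda>a. fr a \<one>) xs)"
  unfolding weakly_regular_def
proof (intro conjI allI impI ballI)
  have sc: "set xs \<subseteq> carrier R" using xs by (simp add: weakly_regular_def)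
  then show "set (map (\<lambda>a. fr a \<one>) xs) \<subseteq> carrier L" using one_S by auto
  fix i y assume i: "i < length (map (\<lambda>a. fr a \<one>) xs)" and y: "y \<in> carrier L"
  let ?I = "genideal R (set (take i xs))"
  have sci: "set (take i xs) \<subseteq> carrier R" using sc set_take_subset by fast
  have I: "ideal ?I R" using sci by (rule genideal_ideal)
  interpret I: ideal ?I R by (rule I)
  have e: "genideal L (set (take i (map (\<lambda>a. fr a \<one>) xs))) = ext ?I"
    using ext_genideal[OF sci] by (simp add: take_map)
  have x: "xs ! i \<in> carrier R" using sc i nth_mem[of i xs] by (simp add: subset_iff)
  obtain b t where b: "b \<in> carrier R" "t \<in> S" "y = fr b t" using y by (rule L_cases)
  assume "map (\<lambda>a. fr a \<one>) xs ! i \<otimes>\<^bsub>L\<^esub> y \<in> genideal L (set (take i (map (\<lambda>a. fr a \<one>) xs)))"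
  then have "fr (xs ! i \<otimes> b) t \<in> ext ?I" using i b x one_S unfolding e by (simp add: mult_frac)
  then obtain u where u: "u \<in> S" "u \<otimes> (xs ! i \<otimes> b) \<in> ?I"
    using fr_mem_ext_iff[OF I] b x by auto
  then have "xs ! i \<otimes> (u \<otimes> b) \<in> ?I" using x b by (simp add: m_ac)
  then have "u \<otimes> b \<in> ?I" using xs i u b unfolding weakly_regular_def by auto
  then have "fr b t \<in> ext ?I" using fr_mem_ext_iff[OF I] b u by auto
  then show "y \<in> genideal L (set (take i (map (\<lambda>a. fr a \<one>) xs)))" using b e by simp
qed

end

section \<open>A criterion for the Cohen--Macaulay property\<close>

lemma krull_dim_leI:
  assumes "\<And>k P. \<forall>i\<le>k. primeideal (P i) R \<Longrightarrow> \<forall>i<k. P i \<subset> P (Suc i) \<Longrightarrow> k \<le> d"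
  shows "krull_dim R \<le> enat d"
  unfolding krull_dim_def
proof (rule Sup_least, clarify)
  fix k P assume "\<forall>i\<le>k. primeideal (P i) R" "\<forall>i<k. P i \<subset> P (Suc i)"
  then have "k \<le> d" by (rule assms)
  then show "enat k \<le> enat d" by simp
qed

lemma (in cring) localization_at_prime:
  assumes "primeideal M R" shows "localization R (carrier R - M)"
proof -
  interpret M: primeideal M R by fact
  show ?thesis
    using M.I_prime M.one_imp_carrier M.I_notcarr by unfold_locales auto
qed

text \<open>
  In the localization at \<open>M\<close> the dimension is at most \<open>d\<close>, because chains of primes contract to chains
  in \<open>R\<close>, and the depth is at least \<open>d\<close>, because \<open>xs\<close> stays regular. Depth is at most dimension.
\<close>
lemma (in cring) cohen_macaulay_localization:
  assumes N: "noetherian_ring R" and M: "maximalideal M R"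
    and dim: "\<And>k P. \<forall>i\<le>k. primeideal (P i) R \<Longrightarrow> \<forall>i<k. P i \<subset> P (Suc i) \<Longrightarrow> k \<le> d"
    and xs: "weakly_regular R xs" "set xs \<subseteq> M" "length xs = d"
  shows "cohen_macaulay_local (localization_at R M)"
proof -
  interpret M: primeideal M R by (rule maximalideal_prime[OF M])
  interpret loc: localization R "carrier R - M" by (rule localization_at_prime[OF M.primeideal])
  let ?L = "fraction_ring R (carrier R - M)"
  let ?f = "fraction_class R (carrier R - M)"
  define E where "E = loc.ext M"
  have iE: "ideal E ?L" unfolding E_def by (rule loc.ideal_ext[OF M.is_ideal])
  have memE: "?f a s \<in> E \<longleftrightarrow> a \<in> M" if as: "a \<in> carrier R" "s \<in> carrier R - M" for a s
  proof -
    have "(\<exists>u\<in>carrier R - M. u \<otimes> a \<in> M) \<longleftrightarrow> a \<in> M"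
      using M.I_prime[OF _ as(1)] as(1) by (auto intro!: bexI[OF _ loc.one_S])
    then show ?thesis unfolding E_def loc.fr_mem_ext_iff[OF M.is_ideal as] .
  qed
  have oneE: "\<one>\<^bsub>?L\<^esub> \<notin> E" unfolding loc.one_L using memE[of \<one> \<one>] loc.one_S by auto
  have big: "J \<subseteq> E" if J: "ideal J ?L" "J \<noteq> carrier ?L" for J
  proof
    interpret J: ideal J ?L by (rule J)
    fix x assume x: "x \<in> J"
    obtain a s where as: "a \<in> carrier R" "s \<in> carrier R - M" "x = ?f a s"
      using loc.L_cases J.Icarr[OF x] by metis
    have "a \<in> M"
    proof (rule ccontr)
      assume a: "a \<notin> M"
      have aS: "a \<in> carrier R - M" using a as by simp
      have "?f (s \<otimes> a) (a \<otimes> s) = ?f \<one> \<one>"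
        using aS as loc.one_S loc.mult_S[of a s] by (intro loc.fr_eqI) (simp_all add: m_ac)
      then have "?f s a \<otimes>\<^bsub>?L\<^esub> x = \<one>\<^bsub>?L\<^esub>"
        using loc.mult_frac[of s a a s] aS as by (simp add: loc.one_L)
      moreover have "?f s a \<otimes>\<^bsub>?L\<^esub> x \<in> J" using x as a by (intro J.I_l_closed loc.fr_closed) auto
      ultimately show False using J.one_imp_carrier J(2) by auto
    qed
    then show "x \<in> E" using memE as by simp
  qed
  have maxE: "maximalideal E ?L"
  proof (rule maximalidealI[OF iE])
    show "carrier ?L \<noteq> E" using oneE loc.L.one_closed by metis
    fix J assume "ideal J ?L" "E \<subseteq> J" "J \<subseteq> carrier ?L"
    then show "J = E \<or> J = carrier ?L" using big by blast
  qed
  have uniq: "N' = E" if N': "maximalideal N' ?L" for N'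
  proof -
    interpret N': maximalideal N' ?L by fact
    have "N' \<subseteq> E" using big N'.is_ideal N'.I_notcarr by metis
    moreover have "E \<subseteq> carrier ?L" using ideal.Icarr[OF iE] by auto
    ultimately show ?thesis using N'.I_maximal[OF iE] oneE loc.L.one_closed by metis
  qed
  have Nloc: "noetherian_ring ?L" by (rule loc.noetherian_L[OF N])
  have primeE: "primeideal E ?L" by (rule loc.L.maximalideal_prime[OF maxE])
  have le: "depth ?L E \<le> krull_dim ?L" by (rule depth_le_krull_dim[OF loc.cring_L Nloc primeE])
  have "krull_dim ?L \<le> enat d"
  proof (rule krull_dim_leI)
    fix k P assume P: "\<forall>i\<le>k. primeideal (P i) ?L" "\<forall>i<k. P i \<subset> P (Suc i)"
    then have "\<forall>i\<le>k. ideal (P i) ?L" using primeideal.axioms(1) by blast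
    then have "\<forall>i<k. loc.contr (P i) \<subset> loc.contr (P (Suc i))"
      using loc.contr_strict_mono P(2) by (metis Suc_leI less_imp_le)
    moreover have "\<forall>i\<le>k. primeideal (loc.contr (P i)) R" using P(1) loc.prime_contr by blast
    ultimately show "k \<le> d" using dim[of k "\<lambda>i. loc.contr (P i)"] by blast
  qed
  moreover have "enat d \<le> depth ?L E"
  proof -
    let ?ys = "map (\<lambda>a. ?f a \<one>) xs"
    have sub: "set ?ys \<subseteq> E" using xs(2) memE[of _ \<one>] loc.one_S M.Icarr by auto
    have "genideal ?L (set ?ys) \<subseteq> E" by (rule loc.L.genideal_minimal[OF iE sub])
    then have "regular_sequence ?L ?ys"
      using loc.weakly_regular_L[OF xs(1)] oneE loc.L.one_closed unfolding loc.L.regular_sequence_iff by auto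
    then show ?thesis unfolding depth_def using sub xs(3)
      by (intro Sup_upper) (auto intro!: exI[of _ ?ys])
  qed
  ultimately have "depth ?L E = krull_dim ?L" using le by auto
  then show ?thesis
    unfolding cohen_macaulay_local_def localization_at_def
    using loc.cring_L Nloc maxE uniq by blast
qed

definition prime_chain :: "('a, 'b) ring_scheme \<Rightarrow> nat \<Rightarrow> (nat \<Rightarrow> 'a set) \<Rightarrow> bool" where
  "prime_chain R k P \<longleftrightarrow> (\<forall>i\<le>k. primeideal (P i) R) \<and> (\<forall>i<k. P i \<subset> P (Suc i))"

text \<open>
  Unlike the Cohen--Macaulay property itself, this condition does not mention localizations, which
  makes it easy to transport along isomorphisms.
\<close>
definition cm_criterion :: "nat \<Rightarrow> ('a, 'b) ring_scheme \<Rightarrow> bool" where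
  "cm_criterion d R \<longleftrightarrow> cring R \<and> noetherian_ring R \<and> (\<forall>k P. prime_chain R k P \<longrightarrow> k \<le> d) \<and>
     (\<forall>M. maximalideal M R \<longrightarrow> (\<exists>xs. weakly_regular R xs \<and> set xs \<subseteq> M \<and> length xs = d))"

lemma cohen_macaulay_if_cm_criterion:
  assumes "cm_criterion d R" shows "cohen_macaulay R"
proof -
  note crit = assms[unfolded cm_criterion_def]
  have R: "cring R" "noetherian_ring R"
    using crit[THEN conjunct1] crit[THEN conjunct2, THEN conjunct1] by this
  have dim: "k \<le> d" if "\<forall>i\<le>k. primeideal (P i) R" "\<forall>i<k. P i \<subset> P (Suc i)" for k P
  proof -
    have "prime_chain R k P" unfolding prime_chain_def by (rule conjI[OF that])
    then show ?thesis by (rule crit[THEN conjunct2, THEN conjunct2, THEN conjunct1, rule_format])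
  qed
  have "cohen_macaulay_local (localization_at R M)" if M: "maximalideal M R" for M
  proof -
    obtain xs where xs: "weakly_regular R xs" "set xs \<subseteq> M" "length xs = d"
      using crit[THEN conjunct2, THEN conjunct2, THEN conjunct2, rule_format, OF M] by (elim exE conjE)
    show ?thesis
      by (rule cring.cohen_macaulay_localization[OF R M dim xs])
  qed
  then show ?thesis unfolding cohen_macaulay_def by (intro conjI allI impI R)
qed

section \<open>Subrings of a ring type\<close>

text \<open>
  The algebra of \<open>S\<close> is a subring of a ring that is a type of class \<open>comm_ring_1\<close>, where arithmetic is
  available to the simplifier; only ideals need the locale-based record.
\<close>
definition subring_rec :: "'r::comm_ring_1 set \<Rightarrow> 'r ring" where
  "subring_rec C = \<lparr>carrier = C, mult = (*), one = 1, zero = 0, add = (+)\<rparr>"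

lemma subring_rec_simps [simp]:
  "carrier (subring_rec C) = C" "x \<otimes>\<^bsub>subring_rec C\<^esub> y = x * y" "\<one>\<^bsub>subring_rec C\<^esub> = 1"
  "\<zero>\<^bsub>subring_rec C\<^esub> = 0" "x \<oplus>\<^bsub>subring_rec C\<^esub> y = x + y"
  by (simp_all add: subring_rec_def)

locale csubring =
  fixes C :: "'r::comm_ring_1 set"
  assumes one_C: "1 \<in> C" and add_C: "x \<in> C \<Longrightarrow> y \<in> C \<Longrightarrow> x + y \<in> C"
    and mult_C: "x \<in> C \<Longrightarrow> y \<in> C \<Longrightarrow> x * y \<in> C" and uminus_C: "x \<in> C \<Longrightarrow> - x \<in> C"
begin

lemma zero_C: "0 \<in> C" using add_C[OF one_C uminus_C[OF one_C]] by simp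

lemma diff_C: "x \<in> C \<Longrightarrow> y \<in> C \<Longrightarrow> x - y \<in> C"
  using add_C[of x "- y"] uminus_C[of y] by simp

lemma sum_C: "(\<And>i. i \<in> A \<Longrightarrow> f i \<in> C) \<Longrightarrow> sum f A \<in> C"
  by (induction A rule: infinite_finite_induct) (auto simp: zero_C add_C)

lemma power_C: "x \<in> C \<Longrightarrow> x ^ n \<in> C"
  by (induction n) (auto simp: one_C mult_C)

lemma cring_subring_rec: "cring (subring_rec C)"
proof (rule cringI)
  show "abelian_group (subring_rec C)"
    by (rule abelian_groupI) (auto simp: zero_C add_C add_ac intro!: bexI[OF _ uminus_C])
  show "comm_monoid (subring_rec C)"
    by (rule comm_monoidI) (auto simp: one_C mult_C mult_ac)
qed (auto simp: distrib_right)

sublocale R: cring "subring_rec C" by (rule cring_subring_rec)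

lemma ideal_iff:
  "ideal I (subring_rec C) \<longleftrightarrow>
     I \<subseteq> C \<and> 0 \<in> I \<and> (\<forall>x\<in>I. \<forall>y\<in>I. x + y \<in> I) \<and> (\<forall>x\<in>C. \<forall>y\<in>I. x * y \<in> I)"
proof
  assume "ideal I (subring_rec C)"
  then interpret I: ideal I "subring_rec C" .
  show "I \<subseteq> C \<and> 0 \<in> I \<and> (\<forall>x\<in>I. \<forall>y\<in>I. x + y \<in> I) \<and> (\<forall>x\<in>C. \<forall>y\<in>I. x * y \<in> I)"
    using I.a_subset I.zero_closed I.a_closed I.I_l_closed by auto
next
  assume *: "I \<subseteq> C \<and> 0 \<in> I \<and> (\<forall>x\<in>I. \<forall>y\<in>I. x + y \<in> I) \<and> (\<forall>x\<in>C. \<forall>y\<in>I. x * y \<in> I)"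
  show "ideal I (subring_rec C)"
  proof (rule idealI)
    show "ring (subring_rec C)" by (rule R.ring_axioms)
    show "subgroup I (add_monoid (subring_rec C))"
    proof (rule R.add.subgroupI)
      fix x assume x: "x \<in> I"
      have "\<ominus>\<^bsub>subring_rec C\<^esub> x = - x"
        using R.minus_equality[of "- x" x] * x by (auto simp: uminus_C)
      moreover have "- x = (- 1) * x" by simp
      ultimately show "\<ominus>\<^bsub>subring_rec C\<^esub> x \<in> I" using * x one_C uminus_C by metis
    qed (use * in auto)
    fix a x assume "a \<in> I" "x \<in> carrier (subring_rec C)"
    then show "x \<otimes>\<^bsub>subring_rec C\<^esub> a \<in> I" "a \<otimes>\<^bsub>subring_rec C\<^esub> x \<in> I"
      using * by (simp_all add: mult.commute[of a x])
  qed
qed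

lemma ideal_uminus: "ideal I (subring_rec C) \<Longrightarrow> x \<in> I \<Longrightarrow> - x \<in> I"
  unfolding ideal_iff using uminus_C[OF one_C] mult_minus1 by metis

lemma ideal_diff: "ideal I (subring_rec C) \<Longrightarrow> x \<in> I \<Longrightarrow> y \<in> I \<Longrightarrow> x - y \<in> I"
  using ideal_uminus[of I y] ideal_iff[of I] by (metis diff_conv_add_uminus)

lemma ideal_sum: "ideal I (subring_rec C) \<Longrightarrow> (\<And>i. i \<in> A \<Longrightarrow> f i \<in> I) \<Longrightarrow> sum f A \<in> I"
  by (induction A rule: infinite_finite_induct) (auto simp: ideal_iff)

lemma maximalideal_inverse:
  assumes M: "maximalideal M (subring_rec C)" and x: "x \<in> C" "x \<notin> M"
  shows "\<exists>y\<in>C. x * y - 1 \<in> M"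
proof -
  interpret M: maximalideal M "subring_rec C" by (rule M)
  define J where "J = {x * y + m |y m. y \<in> C \<and> m \<in> M}"
  have MC: "M \<subseteq> C" "0 \<in> M" "\<And>a b. a \<in> M \<Longrightarrow> b \<in> M \<Longrightarrow> a + b \<in> M" "\<And>a b. a \<in> C \<Longrightarrow> b \<in> M \<Longrightarrow> a * b \<in> M"
    using M.is_ideal unfolding ideal_iff by blast+
  have memJ: "x * y + m \<in> J" if "y \<in> C" "m \<in> M" for y m using that unfolding J_def by blast
  have caseJ: "\<exists>y m. a = x * y + m \<and> y \<in> C \<and> m \<in> M" if "a \<in> J" for a using that unfolding J_def by blast
  have JC: "J \<subseteq> C" unfolding J_def using x MC by (auto intro!: add_C mult_C)
  have MJ: "m \<in> J" if "m \<in> M" for m using memJ[OF zero_C that] by simp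
  have xJ: "x \<in> J" using memJ[OF one_C MC(2)] by simp
  have "ideal J (subring_rec C)"
    unfolding ideal_iff
  proof (intro conjI ballI)
    show "J \<subseteq> C" by (rule JC)
    show "0 \<in> J" by (rule MJ[OF MC(2)])
    fix a b assume "a \<in> J" "b \<in> J"
    then obtain y m y' m' where ab: "a = x * y + m" "y \<in> C" "m \<in> M" "b = x * y' + m'" "y' \<in> C" "m' \<in> M"
      using caseJ by metis
    have "a + b = x * (y + y') + (m + m')" using ab by (simp add: algebra_simps)
    also have "\<dots> \<in> J" using ab by (intro memJ add_C MC(3))
    finally show "a + b \<in> J" .
  next
    fix c a assume c: "c \<in> C" "a \<in> J"
    then obtain y m where a: "a = x * y + m" "y \<in> C" "m \<in> M" using caseJ by metis
    have "c * a = x * (c * y) + c * m" using a by (simp add: algebra_simps)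
    also have "\<dots> \<in> J" using a c by (intro memJ mult_C MC(4))
    finally show "c * a \<in> J" .
  qed
  moreover have "M \<subseteq> J" using MJ by blast
  ultimately have "J = M \<or> J = C" using M.I_maximal[of J] JC by simp
  then have "J = C" using xJ x by auto
  then obtain y m where y: "1 = x * y + m" "y \<in> C" "m \<in> M" using caseJ one_C by metis
  have "x * y - 1 = - m" using y(1) by (simp add: algebra_simps)
  have "x * y - 1 \<in> M" unfolding \<open>x * y - 1 = - m\<close> by (rule ideal_uminus[OF M.is_ideal y(3)])
  then show ?thesis using y(2) ..
qed

end

section \<open>Dickson's lemma\<close>

text \<open>
  Induction on the index set: after finding a finite set \<open>F\<close> for the indices in \<open>I\<close>, the elements whose
  new coordinate is below the maximum over \<open>F\<close> fall into finitely many slices, and in each slice the new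
  coordinate is constant.
\<close>
lemma dickson:
  fixes v :: "'a \<Rightarrow> 'i \<Rightarrow> nat"
  assumes "finite I"
  shows "\<exists>F. finite F \<and> F \<subseteq> A \<and> (\<forall>g\<in>A. \<exists>f\<in>F. \<forall>i\<in>I. v f i \<le> v g i)"
  using assms
proof (induction I arbitrary: A rule: finite_induct)
  case empty
  show ?case
  proof (cases "A = {}")
    case False
    then obtain a where "a \<in> A" by auto
    then show ?thesis by (intro exI[of _ "{a}"]) auto
  qed auto
next
  case (insert j I)
  obtain F where F: "finite F" "F \<subseteq> A" "\<forall>g\<in>A. \<exists>f\<in>F. \<forall>i\<in>I. v f i \<le> v g i"
    using insert.IH[of A] by (elim exE conjE)
  obtain m where m: "\<forall>f\<in>F. v f j \<le> m" 
    using that[of "Max (insert 0 ((\<lambda>f. v f j) ` F))"] F(1) by simp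
  have "\<forall>k. \<exists>G. finite G \<and> G \<subseteq> {g\<in>A. v g j = k} \<and> (\<forall>g\<in>{g\<in>A. v g j = k}. \<exists>f\<in>G. \<forall>i\<in>I. v f i \<le> v g i)"
    (is "\<forall>k. \<exists>G. ?Q k G")
    by (intro allI insert.IH)
  from choice[OF this] obtain G where GQ: "\<forall>k. ?Q k (G k)" ..
  note G = GQ[THEN spec, THEN conjunct1] GQ[THEN spec, THEN conjunct2, THEN conjunct1]
    GQ[THEN spec, THEN conjunct2, THEN conjunct2]
  show ?case
  proof (intro exI[of _ "F \<union> (\<Union>k<m. G k)"] conjI ballI)
    show "finite (F \<union> (\<Union>k<m. G k))" using F G by auto
    show "F \<union> (\<Union>k<m. G k) \<subseteq> A" using F(2) G(2) by blast
    fix g assume g: "g \<in> A"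
    show "\<exists>f\<in>F \<union> (\<Union>k<m. G k). \<forall>i\<in>insert j I. v f i \<le> v g i"
    proof (cases "v g j < m")
      case True
      obtain f where f: "f \<in> G (v g j)" "\<forall>i\<in>I. v f i \<le> v g i"
        using G(3)[of "v g j"] g by blast
      moreover have "v f j = v g j" using G(2) f(1) by blast
      ultimately show ?thesis using True by (intro bexI[of _ f]) auto
    next
      case False
      obtain f where "f \<in> F" "\<forall>i\<in>I. v f i \<le> v g i" using F(3) g by blast
      then show ?thesis using False m by (intro bexI[of _ f]) (auto intro: order_trans)
    qed
  qed
qed

section \<open>The algebra of an order cone\<close>

abbreviation "keys \<equiv> Poly_Mapping.keys"
abbreviation "lookup \<equiv> Poly_Mapping.lookup"
abbreviation "single \<equiv> Poly_Mapping.single"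

text \<open>
  Exponent vectors are functions, added pointwise; the product of polynomials is then the convolution
  product of finitely supported functions.
\<close>
type_synonym 'k mpoly = "(nat \<Rightarrow> nat) \<Rightarrow>\<^sub>0 'k"

lemma ex_strict_bound:
  fixes X :: "nat list set"
  assumes "finite X" obtains k where "\<And>x. x \<in> X \<Longrightarrow> x < k"
proof -
  have less: "k < k @ [0]" for k :: "nat list" by (induction k) (auto simp: Cons_less_Cons)
  have "x < Max (insert [] X) @ [0]" if "x \<in> X" for x
    using Max_ge[of "insert [] X" x] assms that less[of "Max (insert [] X)"] by simp
  then show thesis by (rule that)
qed

abbreviation cst :: "'k::zero \<Rightarrow> 'k mpoly" where "cst \<equiv> single 0"

lemma poly_mapping_expand: "y = (\<Sum>g\<in>keys y. single g (lookup y g))"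
  by (rule poly_mapping_eqI)
     (auto simp: lookup_sum lookup_single when_def sum.delta in_keys_iff)

lemma lookup_single_times:
  fixes y :: "'k::comm_ring_1 mpoly"
  shows "lookup (single s c * y) (s + g) = c * lookup y g"
proof -
  have "single s c * y =
    (\<Sum>h\<in>keys y. single (s + h) (c * lookup y h))"
    by (subst poly_mapping_expand[of y]) (simp add: sum_distrib_left mult_single)
  then show ?thesis
    by (auto simp: lookup_sum lookup_single when_def sum.delta in_keys_iff)
qed

lemma lookup_cst_times:
  fixes y :: "'k::comm_ring_1 mpoly"
  shows "lookup (cst c * y) g = c * lookup y g"
  using lookup_single_times[of 0 c y g] by simp

lemma keys_single_times:
  fixes y :: "'k::comm_ring_1 mpoly"
  shows "keys (single s c * y) \<subseteq> (\<lambda>g. s + g) ` keys y"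
proof -
  have "keys (single s c * y) \<subseteq>
     {a + b |a b. a \<in> keys (single s c) \<and> b \<in> keys y}"
    by (rule keys_mult)
  then show ?thesis by (auto split: if_splits)
qed

text \<open>
  The labels of the positions form a linear extension of the relation \<open>E\<close>: a position that must have
  the larger value has the smaller label. Hence a sorting of the positions by decreasing value that
  breaks ties by the label always respects \<open>E\<close>.
\<close>
locale cone =
  fixes P :: "nat set" and E :: "(nat \<times> nat) set"
  assumes finite_P: "finite P" and E_P: "E \<subseteq> P \<times> P" and E_less: "(a, b) \<in> E \<Longrightarrow> a < b"
begin

definition S :: "(nat \<Rightarrow> nat) set" where
  "S = {f. (\<forall>i. i \<notin> P \<longrightarrow> f i = 0) \<and> (\<forall>(a, b)\<in>E. f b \<le> f a)}"

lemma zero_S: "0 \<in> S" by (auto simp: S_def)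

lemma add_S: "f \<in> S \<Longrightarrow> g \<in> S \<Longrightarrow> f + g \<in> S" by (fastforce simp: S_def intro: add_mono)

lemma finite_E: "finite E" using E_P finite_P finite_subset by blast

definition A :: "'k::comm_ring_1 mpoly set" where "A = {y. keys y \<subseteq> S}"

lemma single_A: "s \<in> S \<Longrightarrow> single s c \<in> A" by (simp add: A_def)

sublocale A: csubring "A :: 'k::comm_ring_1 mpoly set"
proof
  show "(1::'k mpoly) \<in> A" unfolding A_def by (auto simp: zero_S)
  fix x y :: "'k mpoly" assume xy: "x \<in> A" "y \<in> A"
  show "x + y \<in> A" using xy keys_add[of x y] by (auto simp: A_def)
  show "x * y \<in> A" using xy keys_mult[of x y] add_S by (fastforce simp: A_def)
  show "- x \<in> A" using xy by (auto simp: A_def in_keys_iff)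
qed

text \<open>
  If \<open>f\<close> is below \<open>g\<close> in all coordinates \<open>f a\<close> and all slacks \<open>f a - f b\<close> for \<open>(a, b) \<in> E\<close>, then \<open>g - f\<close>
  is again in \<open>S\<close>, so \<open>f\<close> divides \<open>g\<close> in the monoid.
\<close>
lemma dickson_S:
  assumes "L \<subseteq> S"
  shows "\<exists>F. finite F \<and> F \<subseteq> L \<and> (\<forall>g\<in>L. \<exists>f\<in>F. \<exists>s\<in>S. g = f + s)"
proof -
  define v where "v f = case_sum f (\<lambda>(a, b). f a - f b)" for f :: "nat \<Rightarrow> nat"
  have fin: "finite (Inl ` P \<union> Inr ` E :: (nat + nat \<times> nat) set)" using finite_P finite_E by auto
  obtain F where F: "finite F" "F \<subseteq> L"
    "\<forall>g\<in>L. \<exists>f\<in>F. \<forall>i\<in>Inl ` P \<union> Inr ` E. v f i \<le> v g i"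
    using dickson[OF fin, of L v] by blast
  have "\<exists>s\<in>S. g = f + s" if fg: "f \<in> S" "g \<in> S" "\<forall>i\<in>Inl ` P \<union> Inr ` E. v f i \<le> v g i" for f g
  proof
    have le: "f i \<le> g i" for i
      using fg by (cases "i \<in> P") (auto simp: S_def v_def dest!: bspec[of _ _ "Inl i"])
    have le2: "f a - f b \<le> g a - g b" if "(a, b) \<in> E" for a b
      using fg(3) that by (auto simp: v_def dest!: bspec[of _ _ "Inr (a, b)"])
    show "g = f + (\<lambda>i. g i - f i)" using le by (auto simp: fun_eq_iff)
    have "g b - f b \<le> g a - f a" if ab: "(a, b) \<in> E" for a b
    proof -
      have "f b \<le> f a" "g b \<le> g a" using fg ab by (auto simp: S_def)
      then show ?thesis using le[of a] le[of b] le2[OF ab] by linarith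
    qed
    then show "(\<lambda>i. g i - f i) \<in> S" using fg by (auto simp: S_def)
  qed
  then have "\<forall>g\<in>L. \<exists>f\<in>F. \<exists>s\<in>S. g = f + s" using F assms by (meson subsetD)
  then show ?thesis using F by blast
qed

text \<open>
  Monomials are ordered lexicographically by the list of their exponents. Lists of naturals carry a
  well-order (by length, then lexicographically), so \<open>key\<close> yields a well-founded monomial order.
\<close>

definition key :: "(nat \<Rightarrow> nat) \<Rightarrow> nat list" where "key f = map f (sorted_list_of_set P)"

lemma key_inj: "f \<in> S \<Longrightarrow> g \<in> S \<Longrightarrow> key f = key g \<Longrightarrow> f = g"
  using finite_P by (auto simp: key_def S_def fun_eq_iff)

lemma map_add_less: "map f ps < map g ps \<Longrightarrow> map (s + f) ps < map (s + g) ps" for s f g :: "nat \<Rightarrow> nat"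
  by (induction ps) (auto simp: Cons_less_Cons)

lemma key_add_less: "key f < key g \<Longrightarrow> key (s + f) < key (s + g)"
  unfolding key_def by (rule map_add_less)

lemma zero_le_map: "map 0 ps \<le> map f ps" for f :: "nat \<Rightarrow> nat"
  by (induction ps) (auto simp: Cons_le_Cons)

lemma zero_le_key: "key 0 \<le> key f" unfolding key_def by (rule zero_le_map)

definition lm :: "'k::comm_ring_1 mpoly \<Rightarrow> nat \<Rightarrow> nat" where
  "lm y = (SOME f. f \<in> keys y \<and> (\<forall>g\<in>keys y. key g \<le> key f))"

lemma lm:
  assumes "y \<noteq> 0"
  shows lm_in_keys: "lm y \<in> keys y" and lm_greatest: "\<And>g. g \<in> keys y \<Longrightarrow> key g \<le> key (lm y)"
proof -
  have "keys y \<noteq> {}" using assms by simp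
  then have "Max (key ` keys y) \<in> key ` keys y" by (intro Max_in) auto
  then obtain f where f: "f \<in> keys y" "key f = Max (key ` keys y)" by auto
  have "\<exists>f. f \<in> keys y \<and> (\<forall>g\<in>keys y. key g \<le> key f)"
    using f by (intro exI[of _ f]) auto
  from someI_ex[OF this] show "lm y \<in> keys y"
    and "\<And>g. g \<in> keys y \<Longrightarrow> key g \<le> key (lm y)" unfolding lm_def by auto
qed

lemma lm_S: "y \<in> A \<Longrightarrow> y \<noteq> 0 \<Longrightarrow> lm y \<in> S" using lm_in_keys by (auto simp: A_def)

lemma keys_less_lm:
  assumes "y \<in> A" "y \<noteq> 0" "g \<in> keys y" "g \<noteq> lm y"
  shows "key g < key (lm y)"
proof -
  have "g \<in> S" using assms by (auto simp: A_def)
  then show ?thesis using lm_greatest[OF assms(2,3)] key_inj[of g "lm y"] lm_S[OF assms(1,2)] assms(4)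
    by (auto simp: le_less)
qed

text \<open>
  One division step. The coefficient ring need not be a field: \<open>c\<close> multiplies \<open>y\<close> so that the leading
  terms cancel. The case of coefficients in \<open>K[t]\<close> produces the denominators in the Nullstellensatz.
\<close>

lemma reduce_keys:
  fixes y z :: "'k::comm_ring_1 mpoly"
  assumes y: "y \<in> A" "y \<noteq> 0" and z: "z \<in> A" "z \<noteq> 0" and s: "lm y = lm z + s" "s \<in> S"
    and cd: "c * lookup y (lm y) = d * lookup z (lm z)"
    and g: "g \<in> keys (cst c * y - single s d * z)"
  shows "key g < key (lm y)"
proof -
  have s': "lm y = s + lm z" using s by (simp add: add.commute)
  have "lookup (cst c * y - single s d * z) (lm y) = 0"
    using cd lookup_single_times[of s d z "lm z"] by (simp add: lookup_minus lookup_cst_times s')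
  then have gl: "g \<noteq> lm y" using g by (auto simp: in_keys_iff)
  have "g \<in> keys (cst c * y) \<union> keys (single s d * z)"
    using g by (auto simp: in_keys_iff lookup_minus)
  then consider "g \<in> keys y" | h where "h \<in> keys z" "g = s + h"
    using keys_single_times[of 0 c y] keys_single_times[of s d z] by auto
  then show ?thesis
  proof cases
    case 1
    then show ?thesis using keys_less_lm[OF y] gl by blast
  next
    case 2
    then have "h \<noteq> lm z" using gl s' by auto
    then have "key h < key (lm z)" using keys_less_lm[OF z] 2 by blast
    then show ?thesis unfolding 2 s' by (rule key_add_less)
  qed
qed

text \<open>
  The elements chosen for a finite set of generating leading monomials generate the ideal: subtracting
  multiples of them lowers the leading monomial until nothing is left.
\<close>
theorem noetherian_A: "noetherian_ring (subring_rec (A :: 'k::field mpoly set))"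
proof (rule A.R.noetherian_ringI)
  fix I :: "'k mpoly set" assume "ideal I (subring_rec A)"
  note I = this[unfolded A.ideal_iff] and iI = this
  have IA: "I \<subseteq> A" using I by blast
  let ?L = "lm ` (I - {0})"
  have "?L \<subseteq> S" using lm_S IA by blast
  from dickson_S[OF this] obtain F where F: "finite F" "F \<subseteq> ?L" "\<forall>g\<in>?L. \<exists>f\<in>F. \<exists>s\<in>S. g = f + s" by blast
  have "\<forall>f\<in>F. \<exists>z. z \<in> I \<and> z \<noteq> 0 \<and> lm z = f" using F(2) by blast
  then obtain z where z: "\<And>f. f \<in> F \<Longrightarrow> z f \<in> I" "\<And>f. f \<in> F \<Longrightarrow> z f \<noteq> 0" "\<And>f. f \<in> F \<Longrightarrow> lm (z f) = f"
    by metis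
  have zA: "z ` F \<subseteq> A" using z IA by blast
  let ?J = "genideal (subring_rec A) (z ` F)"
  have iJ: "ideal ?J (subring_rec A)" using zA by (intro A.R.genideal_ideal) simp
  note J = iJ[unfolded A.ideal_iff]
  have zJ: "z ` F \<subseteq> ?J" using zA by (intro A.R.genideal_self) simp
  \<comment> \<open>a strict bound \<open>k\<close> on all monomials covers \<open>y = 0\<close>, which has no leading monomial\<close>
  have "y \<in> ?J" if "y \<in> I" "\<forall>g\<in>keys y. key g < k" for y k
    using that
  proof (induction k arbitrary: y rule: less_induct)
    case (less k)
    show ?case
    proof (cases "y = 0")
      case True
      then show ?thesis using J by blast
    next
      case False
      have yA: "y \<in> A" using less IA by blast
      obtain f s where f: "f \<in> F" "s \<in> S" "lm y = f + s" using F(3) less.prems(1) False by blast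
      let ?c = "lookup (z f) (lm (z f))" and ?d = "lookup y (lm y)"
      have c: "?c \<noteq> 0" using lm_in_keys[OF z(2)[OF f(1)]] by (simp add: in_keys_iff)
      let ?t = "single s (?d / ?c) * z f"
      have tJ: "?t \<in> ?J" using J zJ f single_A[OF f(2)] by blast
      have tI: "?t \<in> I" using I z(1)[OF f(1)] single_A[OF f(2)] by blast
      have "y - ?t \<in> ?J"
      proof (rule less.IH)
        show "key (lm y) < k" using less.prems(2) lm_in_keys[OF False] by blast
        show "y - ?t \<in> I" by (rule A.ideal_diff[OF iI less.prems(1) tI])
        show "\<forall>g\<in>keys (y - ?t). key g < key (lm y)"
          using reduce_keys[OF yA False _ z(2)[OF f(1)] _ f(2), of 1 "?d / ?c"] zA f z(3)[OF f(1)] c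
          by auto
      qed
      then have "(y - ?t) + ?t \<in> ?J" using J tJ by blast
      then show ?thesis by simp
    qed
  qed note red = this
  have "I \<subseteq> ?J"
  proof
    fix y assume y: "y \<in> I"
    obtain k where "\<And>x. x \<in> key ` keys y \<Longrightarrow> x < k" using ex_strict_bound[of "key ` keys y"] by auto
    then have "\<forall>g\<in>keys y. key g < k" by simp
    with y show "y \<in> ?J" by (rule red)
  qed
  moreover have "?J \<subseteq> I" using z(1) by (intro A.R.genideal_minimal iI) blast
  ultimately show "\<exists>B\<subseteq>carrier (subring_rec A). finite B \<and> I = genideal (subring_rec A) B"
    using F(1) zA by (intro exI[of _ "z ` F"]) auto
qed

end

section \<open>Residue fields of the algebra\<close>

context cone
begin

text \<open>The value \<open>q(t)\<close> of a univariate polynomial at an element of the algebra.\<close>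

definition pv :: "'k::comm_ring_1 mpoly \<Rightarrow> 'k poly \<Rightarrow> 'k mpoly" where
  "pv t q = poly (map_poly cst q) t"

lemma cst_mult: "cst (a * b) = cst a * cst (b::'k::comm_ring_1)"
  by (simp add: mult_single)

lemma pv_0: "pv t 0 = 0" by (simp add: pv_def)

lemma pv_pCons: "pv t (pCons a q) = cst a + t * pv t q"
  by (cases "a = 0 \<and> q = 0") (auto simp: pv_def map_poly_pCons)

lemma pv_add: "pv t (p + q) = pv t p + pv t q"
  by (induction p q rule: poly_induct2) (simp_all add: pv_0 pv_pCons single_add algebra_simps)

lemma pv_smult: "pv t (smult c q) = cst c * pv t q"
proof (induction q)
  case (pCons a q)
  have "pv t (smult c (pCons a q)) = cst c * cst a + t * (cst c * pv t q)"
    by (simp only: smult_pCons pv_pCons cst_mult pCons.IH)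
  then show ?case unfolding pv_pCons by (simp only: distrib_left mult.left_commute)
qed (simp add: pv_0)

lemma pv_mult: "pv t (p * q) = pv t p * pv t q"
  by (induction p) (simp_all add: pv_0 pv_pCons pv_add pv_smult algebra_simps)

lemma pv_1: "pv t 1 = 1"
  by (simp add: one_pCons pv_pCons pv_0)

lemma pv_power: "pv t (p ^ n) = pv t p ^ n"
  by (induction n) (simp_all add: pv_1 pv_mult)

lemma pv_linear: "pv t [:-a, 1:] = t - cst a"
  by (simp add: pv_pCons pv_0 single_uminus)

lemma pv_A: "t \<in> A \<Longrightarrow> pv t q \<in> A"
  by (induction q) (auto simp: pv_0 pv_pCons A.zero_C intro!: A.add_C A.mult_C single_A zero_S)

text \<open>
  The ring homomorphism from polynomials with coefficients in \<open>K[X]\<close> that fixes the monomials and sends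
  \<open>X\<close> to \<open>t\<close>.
\<close>

definition ev :: "'k::comm_ring_1 mpoly \<Rightarrow> 'k poly mpoly \<Rightarrow> 'k mpoly" where
  "ev t y = (\<Sum>s\<in>keys y. single s 1 * pv t (lookup y s))"

lemma ev_superset:
  assumes "finite B" "keys y \<subseteq> B"
  shows "ev t y = (\<Sum>s\<in>B. single s 1 * pv t (lookup y s))"
  unfolding ev_def using assms by (intro sum.mono_neutral_left) (auto simp: in_keys_iff pv_0)

lemma ev_add: "ev t (y + z) = ev t y + ev t z"
proof -
  let ?B = "keys y \<union> keys z"
  have "ev t x = (\<Sum>s\<in>?B. single s 1 * pv t (lookup x s))"
    if "x \<in> {y, z, y + z}" for x using that keys_add[of y z] by (intro ev_superset) auto
  then show ?thesis by (simp add: lookup_add pv_add distrib_left sum.distrib)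
qed

lemma ev_0: "ev t 0 = 0" by (simp add: ev_def)

lemma ev_sum: "ev t (sum f B) = (\<Sum>i\<in>B. ev t (f i))"
  by (induction B rule: infinite_finite_induct) (auto simp: ev_0 ev_add)

lemma ev_uminus: "ev t (- y) = - ev t y"
  using ev_add[of t y "- y"] by (simp add: ev_0 eq_neg_iff_add_eq_0 add.commute)

lemma ev_diff: "ev t (y - z) = ev t y - ev t z"
  using ev_add[of t y "- z"] by (simp add: ev_uminus)

lemma ev_single: "ev t (single s q) = single s 1 * pv t q"
  by (simp add: ev_superset[of "{s}"])

lemma ev_single_times: "ev t (single s q * y) = single s 1 * pv t q * ev t y"
proof -
  have "single s q * y =
      (\<Sum>g\<in>keys y. single (s + g) (q * lookup y g))"
    by (subst poly_mapping_expand[of y]) (simp add: sum_distrib_left mult_single)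
  then have "ev t (single s q * y) =
      (\<Sum>g\<in>keys y. single (s + g) 1 * pv t (q * lookup y g))"
    by (simp add: ev_sum ev_single)
  also have "\<dots> = (\<Sum>g\<in>keys y. (single s 1 * pv t q) *
      (single g 1 * pv t (lookup y g)))"
  proof (rule sum.cong[OF refl])
    fix g
    have "single (s + g) (1::'a) = single s 1 * single g 1"
      by (simp add: mult_single)
    then show "single (s + g) 1 * pv t (q * lookup y g) =
       (single s 1 * pv t q) * (single g 1 * pv t (lookup y g))"
      by (simp add: pv_mult mult_ac)
  qed
  also have "\<dots> = single s 1 * pv t q * ev t y"
    by (simp add: ev_def sum_distrib_left)
  finally show ?thesis .
qed

text \<open>
  A nonzero polynomial is a constant times a product of factors \<open>X - a\<close>, none of which vanishes at \<open>t\<close>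
  modulo the prime \<open>M\<close>.
\<close>
lemma pv_notin_prime:
  fixes t :: "'k::alg_closed_field mpoly"
  assumes M: "primeideal M (subring_rec A)" and t: "t \<in> A" "\<And>a. t - cst a \<notin> M"
  shows "q \<noteq> 0 \<Longrightarrow> pv t q \<notin> M"
proof (induction "degree q" arbitrary: q rule: less_induct)
  case less
  interpret M: primeideal M "subring_rec A" by (rule M)
  note MI = M.is_ideal[unfolded A.ideal_iff]
  show ?case
  proof (cases "degree q = 0")
    case True
    then obtain c where c: "q = [:c:]" "c \<noteq> 0" using less.prems by (auto elim!: degree_eq_zeroE)
    have p: "pv t q = cst c" by (simp add: c(1) pv_pCons pv_0)
    show ?thesis
    proof
      assume "pv t q \<in> M"
      then have "cst (inverse c) * cst c \<in> M" using MI single_A[OF zero_S] unfolding p by blast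
      then have "1 \<in> M" using c by (simp add: mult_single)
      then show False using M.one_imp_carrier M.I_notcarr by simp
    qed
  next
    case False
    then obtain x where "poly q x = 0" using alg_closed_imp_poly_has_root by blast
    then obtain q' where q': "q = [:-x, 1:] * q'" using poly_eq_0_iff_dvd by (metis dvdE)
    then have "q' \<noteq> 0" using less.prems by auto
    then have "degree q' < degree q" unfolding q' by (subst degree_mult_eq) auto
    then have "pv t q' \<notin> M" using less.hyps \<open>q' \<noteq> 0\<close> by blast
    moreover have "t - cst x \<in> A" using t(1) single_A[OF zero_S] by (rule A.diff_C)
    ultimately show ?thesis
      using M.I_prime[of "t - cst x" "pv t q'"] pv_A[OF t(1), of q'] t(2)[of x]
      unfolding q' pv_mult pv_linear by auto
  qed
qed

text \<open>
  Suppose that no \<open>t - a\<close> lies in \<open>M\<close>. Let \<open>N\<close> consist of the polynomials over \<open>K[X]\<close> that vanish modulo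
  \<open>M\<close> at \<open>X = t\<close>; it is closed under multiplication by \<open>K[X]\<close> and by monomials, so its leading monomials
  \<open>L\<close> are generated by finitely many of them. With \<open>D\<close> the product of the corresponding leading
  coefficients, division shows that each polynomial, multiplied by a power of \<open>D\<close>, is congruent modulo
  \<open>N\<close> to one that has no monomial in \<open>L\<close>; such a polynomial is in \<open>N\<close> only if it is zero. Apply this to
  an inverse \<open>y\<close> of \<open>t - r\<close> modulo \<open>M\<close>, where \<open>D(r) \<noteq> 0\<close>: the reduced form \<open>w\<close> of \<open>D\<^sup>k y\<close> satisfies
  \<open>(X - r) w = D\<^sup>k\<close>, which fails at \<open>X = r\<close>.
\<close>
theorem nullstellensatz:
  fixes t :: "'k::{alg_closed_field, field_char_0} mpoly"
  assumes M: "maximalideal M (subring_rec A)" and t: "t \<in> A"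
  shows "\<exists>a. t - cst a \<in> M"
proof (rule ccontr)
  assume "\<not> ?thesis"
  then have no: "t - cst a \<notin> M" for a by blast
  have pM: "primeideal M (subring_rec A)" by (rule A.R.maximalideal_prime[OF M])
  interpret M: primeideal M "subring_rec A" by (rule pM)
  note iM = M.is_ideal
  note MI = iM[unfolded A.ideal_iff]
  note pv_notin = pv_notin_prime[OF pM t no]
  define N where "N = {y \<in> (A :: 'k poly mpoly set). ev t y \<in> M}"
  have N0: "0 \<in> N" using MI A.zero_C by (auto simp: N_def ev_0)
  have N_diff: "y - z \<in> N" if "y \<in> N" "z \<in> N" for y z
    using that A.ideal_diff[OF iM] by (auto simp: N_def ev_diff intro: A.diff_C)
  have N_add: "y + z \<in> N" if "y \<in> N" "z \<in> N" for y z
    using that MI by (auto simp: N_def ev_add intro: A.add_C)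
  have N_single: "single s q * y \<in> N" if "y \<in> N" "s \<in> S" for s q y
  proof -
    have "single s 1 * pv t q \<in> A" using that pv_A[OF t] single_A by (intro A.mult_C) auto
    then show ?thesis using that MI by (auto simp: N_def ev_single_times intro!: A.mult_C single_A)
  qed
  have N_A: "N \<subseteq> A" by (auto simp: N_def)
  define L where "L = lm ` (N - {0})"
  have "L \<subseteq> S" using lm_S N_A unfolding L_def by blast
  from dickson_S[OF this] obtain F where F: "finite F" "F \<subseteq> L" "\<forall>g\<in>L. \<exists>f\<in>F. \<exists>s\<in>S. g = f + s" by blast
  have "\<forall>f\<in>F. \<exists>z. z \<in> N \<and> z \<noteq> 0 \<and> lm z = f" using F(2) unfolding L_def by blast
  then obtain z where z: "\<And>f. f \<in> F \<Longrightarrow> z f \<in> N" "\<And>f. f \<in> F \<Longrightarrow> z f \<noteq> 0" "\<And>f. f \<in> F \<Longrightarrow> lm (z f) = f"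
    by metis
  define d where "d f = lookup (z f) f" for f
  have d0: "d f \<noteq> 0" if "f \<in> F" for f
    using lm_in_keys[OF z(2)[OF that]] z(3)[OF that] by (simp add: d_def in_keys_iff)
  define D where "D = prod d F"
  have D0: "D \<noteq> 0" using d0 F(1) by (simp add: D_def)
  \<comment> \<open>the monomial 1 does not lead in \<open>N\<close>, as no nonzero \<open>q(t)\<close> lies in \<open>M\<close>; so \<open>D\<^sup>k\<close> is reduced\<close>
  have std0: "0 \<notin> L"
  proof
    assume "0 \<in> L"
    then obtain y where "0 = lm y" "y \<in> N - {0}" unfolding L_def by (rule imageE)
    then have y: "y \<in> N" "y \<noteq> 0" "lm y = 0" by auto
    have yA: "y \<in> A" using y N_A by blast
    have g0: "g = 0" if g: "g \<in> keys y" for g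
    proof (rule ccontr)
      assume "g \<noteq> 0"
      then have "key g < key 0" using keys_less_lm[OF yA y(2) g] y(3) by simp
      then show False using zero_le_key[of g] by (simp add: not_less[symmetric])
    qed
    then have "keys y \<subseteq> {0}" by blast
    then have "ev t y = single 0 1 * pv t (lookup y 0)"
      by (subst ev_superset[of "{0}"]) simp_all
    then have "ev t y = pv t (lookup y 0)" by simp
    moreover have "lookup y 0 \<noteq> 0" using lm_in_keys[OF y(2)] y(3) by (simp add: in_keys_iff)
    ultimately have "ev t y \<notin> M" using pv_notin by simp
    then show False using y(1) by (simp add: N_def)
  qed
  have red: "\<exists>k w. w \<in> A \<and> keys w \<inter> L = {} \<and> cst (D ^ k) * y - w \<in> N"
    if "y \<in> A" "\<forall>g\<in>keys y. key g < \<kappa>" for y :: "'k poly mpoly" and \<kappa>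
    using that
  proof (induction \<kappa> arbitrary: y rule: less_induct)
    case (less \<kappa>)
    show ?case
    proof (cases "y = 0")
      case True
      show ?thesis by (rule exI[of _ 0], rule exI[of _ 0]) (simp add: True N0 A.zero_C)
    next
      case False
      let ?f = "lm y"
      let ?c = "lookup y ?f"
      have fS: "?f \<in> S" by (rule lm_S[OF less.prems(1) False])
      have f\<kappa>: "key ?f < \<kappa>" using less.prems(2) lm_in_keys[OF False] by blast
      show ?thesis
      proof (cases "?f \<in> L")
        case True
        then obtain f0 s where f0: "f0 \<in> F" "s \<in> S" "?f = f0 + s" using F(3)[rule_format, OF True] by blast
        define e where "e = prod d (F - {f0})"
        have De: "D = d f0 * e" unfolding D_def e_def using f0(1) F(1) by (simp add: prod.remove)
        let ?t = "single s (e * ?c) * z f0"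
        let ?y = "cst D * y - ?t"
        have tN: "?t \<in> N" by (rule N_single[OF z(1)[OF f0(1)] f0(2)])
        have tA: "?t \<in> A" using tN N_A by blast
        have "?y \<in> A" by (rule A.diff_C[OF A.mult_C[OF single_A[OF zero_S] less.prems(1)] tA])
        moreover have "\<forall>g\<in>keys ?y. key g < key ?f"
        proof
          fix g assume g: "g \<in> keys ?y"
          have zA: "z f0 \<in> A" using z(1)[OF f0(1)] N_A by blast
          have l: "lm y = lm (z f0) + s" using f0(3) z(3)[OF f0(1)] by simp
          have c: "D * ?c = e * ?c * lookup (z f0) (lm (z f0))"
            unfolding De z(3)[OF f0(1)] by (simp add: d_def)
          show "key g < key ?f"
            by (rule reduce_keys[OF less.prems(1) False zA z(2)[OF f0(1)] l f0(2) c g])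
        qed
        ultimately obtain k w where kw: "w \<in> A" "keys w \<inter> L = {}" "cst (D ^ k) * ?y - w \<in> N"
          using less.IH[OF f\<kappa>] by blast
        have "(cst (D ^ k) * ?y - w) + cst (D ^ k) * ?t \<in> N" by (intro N_add kw N_single tN zero_S)
        also have "(cst (D ^ k) * ?y - w) + cst (D ^ k) * ?t = cst (D ^ Suc k) * y - w"
          by (simp add: cst_mult algebra_simps)
        finally show ?thesis using kw by blast
      next
        case nL: False
        let ?y = "y - single ?f ?c"
        have "?y \<in> A" using less.prems(1) fS by (intro A.diff_C single_A)
        moreover have "\<forall>g\<in>keys ?y. key g < key ?f"
        proof
          fix g assume g: "g \<in> keys ?y"
          then have "g \<noteq> ?f" by (auto simp: in_keys_iff lookup_minus)
          moreover from this g have "g \<in> keys y"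
            by (auto simp: in_keys_iff lookup_minus lookup_single_not_eq)
          ultimately show "key g < key ?f" using keys_less_lm[OF less.prems(1) False] by blast
        qed
        ultimately obtain k w where kw: "w \<in> A" "keys w \<inter> L = {}" "cst (D ^ k) * ?y - w \<in> N"
          using less.IH[OF f\<kappa>] by blast
        let ?w = "w + single ?f (D ^ k * ?c)"
        have eq: "cst (D ^ k) * ?y - w = cst (D ^ k) * y - ?w"
          by (simp add: algebra_simps mult_single)
        have "cst (D ^ k) * y - ?w \<in> N" using kw(3) unfolding eq .
        moreover have "?w \<in> A" using kw(1) fS by (intro A.add_C single_A)
        moreover have "keys ?w \<inter> L = {}"
        proof -
          have "keys ?w \<subseteq> insert ?f (keys w)"
            using keys_add[of w "single ?f (D ^ k * ?c)"] by (auto split: if_splits)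
          then show ?thesis using kw(2) nL by blast
        qed
        ultimately have "?w \<in> A \<and> keys ?w \<inter> L = {} \<and> cst (D ^ k) * y - ?w \<in> N"
          by (intro conjI)
        then show ?thesis by (intro exI)
      qed
    qed
  qed
  have "finite {r. poly D r = 0}" by (rule poly_roots_finite[OF D0])
  then obtain r where r: "poly D r \<noteq> 0" 
    using infinite_UNIV_char_0[where 'a = 'k] by (metis (mono_tags, lifting) UNIV_eq_I mem_Collect_eq)
  have "t - cst r \<in> A" using t single_A[OF zero_S] by (rule A.diff_C)
  then obtain y where y: "y \<in> A" "(t - cst r) * y - 1 \<in> M" using A.maximalideal_inverse[OF M _ no] by blast
  \<comment> \<open>\<open>y\<close> with its coefficients read as constant polynomials\<close>
  define Y where "Y = (\<Sum>s\<in>keys y. single s [:lookup y s:])"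
  have YA: "Y \<in> A" unfolding Y_def using y(1) by (intro A.sum_C single_A) (auto simp: A_def)
  have "ev t Y = y"
  proof -
    have "ev t Y = (\<Sum>s\<in>keys y. single s 1 * cst (lookup y s))"
      unfolding Y_def by (simp add: ev_sum ev_single pv_pCons pv_0)
    also have "\<dots> = y" by (subst (3) poly_mapping_expand[of y]) (simp add: mult_single)
    finally show ?thesis .
  qed
  obtain \<kappa> where "\<And>x. x \<in> key ` keys Y \<Longrightarrow> x < \<kappa>" using ex_strict_bound[of "key ` keys Y"] by auto
  then have "\<forall>g\<in>keys Y. key g < \<kappa>" by simp
  from red[OF YA this] obtain k w where kw: "w \<in> A" "keys w \<inter> L = {}" "cst (D ^ k) * Y - w \<in> N"
    by blast
  let ?q = "[:-r, 1:]"
  \<comment> \<open>the difference of the reduced forms of \<open>D\<^sup>k (X - r) Y\<close> and of \<open>D\<^sup>k\<close>\<close>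
  define v where "v = cst ?q * w - cst (D ^ k)"
  have vA: "v \<in> A" unfolding v_def using kw(1) by (intro A.diff_C A.mult_C single_A zero_S)
  have e1: "ev t v = (t - cst r) * ev t w - pv t D ^ k"
    by (simp add: v_def ev_diff ev_single_times ev_single pv_linear pv_power)
  have e2: "ev t (cst (D ^ k) * Y - w) = pv t D ^ k * y - ev t w"
    by (simp add: ev_diff ev_single_times pv_power \<open>ev t Y = y\<close>)
  have "ev t v = pv t D ^ k * ((t - cst r) * y - 1) - (t - cst r) * ev t (cst (D ^ k) * Y - w)"
    unfolding e1 e2 by (simp add: algebra_simps)
  moreover have "pv t D ^ k * ((t - cst r) * y - 1) \<in> M" using y(2) MI A.power_C[OF pv_A[OF t]] by blast
  moreover have "(t - cst r) * ev t (cst (D ^ k) * Y - w) \<in> M"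
    using kw(3) MI \<open>t - cst r \<in> A\<close> unfolding N_def by blast
  ultimately have "ev t v \<in> M" using A.ideal_diff[OF iM] by simp
  then have vN: "v \<in> N" using vA by (simp add: N_def)
  have "keys v \<subseteq> keys w \<union> {0}"
    unfolding v_def by (auto simp: in_keys_iff lookup_minus lookup_cst_times lookup_single when_def split: if_splits)
  then have "keys v \<inter> L = {}" using kw(2) std0 by blast
  moreover have "lm v \<in> L" if "v \<noteq> 0" using vN that by (simp add: L_def)
  ultimately have "v = 0" using lm_in_keys[of v] by blast
  then have "lookup v 0 = 0" by simp
  then have "?q * lookup w 0 = D ^ k"
    unfolding v_def lookup_minus lookup_cst_times by simp
  then have "poly (?q * lookup w 0) r = poly (D ^ k) r" by simp
  then show False using r by simp
qed

end

section \<open>The dimension of the algebra\<close>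

interpretation mpoly: vector_space "\<lambda>c y :: 'k::field mpoly. cst c * y"
proof
  fix a b :: 'k and x y :: "'k mpoly"
  show "cst a * (x + y) = cst a * x + cst a * y" by (rule distrib_left)
  show "cst (a + b) * x = cst a * x + cst b * x" by (simp only: single_add distrib_right)
  show "cst a * (cst b * x) = cst (a * b) * x" by (simp add: mult_single flip: mult.assoc)
  show "cst 1 * x = x" by simp
qed

text \<open>Independence of a family, unlike that of its range, excludes repetitions.\<close>
lemma independent_family_card_le:
  fixes v :: "'i \<Rightarrow> 'k::field mpoly"
  assumes I: "finite I" and T: "finite T" and v: "\<And>a. a \<in> I \<Longrightarrow> v a \<in> mpoly.span T"
    and ind: "\<And>c. (\<Sum>a\<in>I. cst (c a) * v a) = 0 \<Longrightarrow> \<forall>a\<in>I. c a = 0"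
  shows "card I \<le> card T"
proof -
  have inj: "inj_on v I"
  proof (rule inj_onI, rule ccontr)
    fix a b assume ab: "a \<in> I" "b \<in> I" "v a = v b" "a \<noteq> b"
    define c :: "'i \<Rightarrow> 'k" where "c i = (if i = a then 1 else if i = b then - 1 else 0)" for i
    have "(\<Sum>i\<in>I. cst (c i) * v i) = (\<Sum>i\<in>{a, b}. cst (c i) * v i)"
      using I ab by (intro sum.mono_neutral_right) (auto simp: c_def)
    also have "\<dots> = 0" using ab by (simp add: c_def single_uminus)
    finally have "c a = 0" using ind ab(1) by blast
    then show False by (simp add: c_def)
  qed
  have "mpoly.independent (v ` I)"
  proof
    assume "mpoly.dependent (v ` I)"
    then obtain u where u: "\<exists>w\<in>v ` I. u w \<noteq> 0" "(\<Sum>w\<in>v ` I. cst (u w) * w) = 0"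
      using mpoly.dependent_finite[of "v ` I"] I by auto
    then have "(\<Sum>a\<in>I. cst (u (v a)) * v a) = 0" by (simp add: sum.reindex[OF inj])
    then show False using ind[of "\<lambda>a. u (v a)"] u(1) by auto
  qed
  from mpoly.independent_span_bound[OF T this] v have "card (v ` I) \<le> card T" by blast
  then show ?thesis by (simp add: card_image[OF inj])
qed

text \<open>
  Exponents of the products of powers of \<open>k\<close> elements in which each power is below \<open>N\<close>.
\<close>
abbreviation "tuples N k \<equiv> {a :: nat list. set a \<subseteq> {..<N} \<and> length a = k}"

lemma sum_tuples_Suc: "(\<Sum>a\<in>tuples N (Suc k). f a) = (\<Sum>i<N. \<Sum>a\<in>tuples N k. f (i # a))"
proof -
  have "(\<Sum>a\<in>tuples N (Suc k). f a) = (\<Sum>(a, i)\<in>tuples N k \<times> {..<N}. f (i # a))"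
    unfolding lists_length_Suc_eq by (subst sum.reindex) (auto simp: inj_on_def intro!: sum.cong)
  also have "\<dots> = (\<Sum>a\<in>tuples N k. \<Sum>i<N. f (i # a))" by (simp add: sum.cartesian_product)
  also have "\<dots> = (\<Sum>i<N. \<Sum>a\<in>tuples N k. f (i # a))" by (rule sum.swap)
  finally show ?thesis .
qed

context cone
begin

text \<open>
  A filtration whose pieces have dimension at most \<open>(t + 1)\<^sup>p\<close>.
\<close>
definition V :: "nat \<Rightarrow> 'k::comm_ring_1 mpoly set" where
  "V t = {y \<in> A. \<forall>s\<in>keys y. \<forall>i. s i \<le> t}"

lemma V_A: "V t \<subseteq> A" by (auto simp: V_def)

lemma V_mono: "t \<le> u \<Longrightarrow> V t \<subseteq> V u" 
  by (auto simp: V_def intro: order_trans)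

lemma one_V: "1 \<in> V t" using A.one_C by (auto simp: V_def)

lemma mult_V:
  assumes "x \<in> V t" "y \<in> V u" shows "x * y \<in> V (t + u)"
proof -
  have "s i \<le> t + u" if s: "s \<in> keys (x * y)" for s i
  proof -
    obtain a b where "s = a + b" "a \<in> keys x" "b \<in> keys y"
      using s keys_mult[of x y] by blast
    then show ?thesis using assms by (auto simp: V_def intro!: add_mono)
  qed
  then show ?thesis using assms A.mult_C by (auto simp: V_def)
qed

lemma power_V: "x \<in> V t \<Longrightarrow> x ^ n \<in> V (n * t)"
  by (induction n) (simp_all add: one_V mult_V)

lemma ex_V: assumes "x \<in> A" shows "\<exists>t. x \<in> V t"
proof -
  let ?M = "(\<lambda>(s, i). s i) ` (keys x \<times> P)"
  have "s i \<le> Max (insert 0 ?M)" if "s \<in> keys x" for s i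
  proof (cases "i \<in> P")
    case True
    then have "s i \<in> ?M" using that by force
    then show ?thesis using finite_P by (intro Max_ge) auto
  next
    case False
    then show ?thesis using that assms by (auto simp: A_def S_def)
  qed
  then show ?thesis using assms by (auto simp: V_def)
qed

lemma bounded_monomials:
  shows finite_bounded_monomials: "finite {s\<in>S. \<forall>i. s i \<le> t}"
    and card_bounded_monomials: "card {s\<in>S. \<forall>i. s i \<le> t} \<le> (t + 1) ^ card P"
proof -
  let ?h = "\<lambda>f i. if i \<in> P then f i else (0::nat)"
  have sub: "{s\<in>S. \<forall>i. s i \<le> t} \<subseteq> ?h ` (P \<rightarrow>\<^sub>E {..t})"
  proof
    fix s assume "s \<in> {s\<in>S. \<forall>i. s i \<le> t}"
    then have "s = ?h (restrict s P)" "restrict s P \<in> P \<rightarrow>\<^sub>E {..t}" by (auto simp: S_def fun_eq_iff)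
    then show "s \<in> ?h ` (P \<rightarrow>\<^sub>E {..t})" by blast
  qed
  have fin: "finite (P \<rightarrow>\<^sub>E {..t})" using finite_P by (intro finite_PiE) auto
  show "finite {s\<in>S. \<forall>i. s i \<le> t}" using finite_subset[OF sub] fin by blast
  have "card {s\<in>S. \<forall>i. s i \<le> t} \<le> card (?h ` (P \<rightarrow>\<^sub>E {..t}))" using fin by (intro card_mono sub) auto
  also have "\<dots> \<le> card (P \<rightarrow>\<^sub>E {..t})" by (rule card_image_le[OF fin])
  also have "\<dots> = (t + 1) ^ card P" using finite_P by (simp add: card_PiE)
  finally show "card {s\<in>S. \<forall>i. s i \<le> t} \<le> (t + 1) ^ card P" .
qed

lemma V_span: "V t \<subseteq> mpoly.span ((\<lambda>s. single s 1) ` {s\<in>S. \<forall>i. s i \<le> t})"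
proof
  fix y :: "'a mpoly" assume y: "y \<in> V t"
  let ?T = "(\<lambda>s. single s (1::'a)) ` {s\<in>S. \<forall>i. s i \<le> t}"
  have "y = (\<Sum>s\<in>keys y. cst (lookup y s) * single s 1)"
    by (subst poly_mapping_expand[of y]) (simp add: mult_single)
  also have "\<dots> \<in> mpoly.span ?T"
    using y by (intro mpoly.span_sum mpoly.span_scale mpoly.span_base) (auto simp: V_def A_def)
  finally show "y \<in> mpoly.span ?T" .
qed

text \<open>
  Choose \<open>x\<^sub>i\<close> in the \<open>i\<close>-th prime but not in the one before it. The products of their powers are linearly
  independent modulo the smallest prime \<open>Q 0\<close>, by induction on the length. In a combination that lies in
  \<open>Q 0\<close>, take the least power \<open>x\<^sup>i\<close> of the first element that occurs. It can be cancelled, as \<open>x \<notin> Q 0\<close>;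
  the cofactor of \<open>x\<^sup>i\<close> plus a multiple of \<open>x\<close> then lies in \<open>Q 0\<close>, so the cofactor lies in \<open>Q 1\<close>, and the
  induction hypothesis for the rest of the chain makes its coefficients vanish.
\<close>
lemma prime_chain_independent:
  fixes Q :: "nat \<Rightarrow> 'k::field mpoly set"
  assumes "prime_chain (subring_rec A) k Q"
  shows "\<exists>e. \<forall>N. \<exists>v. (\<forall>a\<in>tuples N k. v a \<in> V (e * N)) \<and>
     (\<forall>c. (\<Sum>a\<in>tuples N k. cst (c a) * v a) \<in> Q 0 \<longrightarrow> (\<forall>a\<in>tuples N k. c a = 0))"
  using assms
proof (induction k arbitrary: Q)
  case 0
  then interpret Q: primeideal "Q 0" "subring_rec A" by (simp add: prime_chain_def)
  note QI = Q.is_ideal[unfolded A.ideal_iff]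
  have "c = 0" if c: "cst c \<in> Q 0" for c :: 'k
  proof (rule ccontr)
    assume "c \<noteq> 0"
    have "cst (inverse c) * cst c \<in> Q 0" using QI c single_A[OF zero_S] by blast
    then have "1 \<in> Q 0" using \<open>c \<noteq> 0\<close> by (simp add: mult_single)
    then show False using Q.one_imp_carrier Q.I_notcarr by simp
  qed
  then have ind: "\<forall>c :: nat list \<Rightarrow> 'k. (\<Sum>a\<in>{[]}. cst (c a) * 1) \<in> Q 0 \<longrightarrow> (\<forall>a\<in>{[]}. c a = 0)" by simp
  have tup: "tuples N 0 = {[]}" for N by auto
  have "\<exists>v. (\<forall>a\<in>tuples N 0. v a \<in> V (0 * N)) \<and>
     (\<forall>c. (\<Sum>a\<in>tuples N 0. cst (c a) * v a) \<in> Q 0 \<longrightarrow> (\<forall>a\<in>tuples N 0. c a = 0))" for N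
    unfolding tup by (rule exI[of _ "\<lambda>_. 1"], rule conjI[OF _ ind]) (simp add: one_V)
  then have "\<forall>N. \<exists>v. (\<forall>a\<in>tuples N 0. v a \<in> V (0 * N)) \<and>
     (\<forall>c. (\<Sum>a\<in>tuples N 0. cst (c a) * v a) \<in> Q 0 \<longrightarrow> (\<forall>a\<in>tuples N 0. c a = 0))" ..
  then show ?case by (rule exI)
next
  case (Suc k)
  have pr: "\<forall>i\<le>Suc k. primeideal (Q i) (subring_rec A)"
    by (rule Suc.prems[unfolded prime_chain_def, THEN conjunct1])
  have st: "\<forall>i<Suc k. Q i \<subset> Q (Suc i)"
    by (rule Suc.prems[unfolded prime_chain_def, THEN conjunct2])
  have p0: "primeideal (Q 0) (subring_rec A)" by (rule pr[rule_format]) simp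
  have p1: "primeideal (Q (Suc 0)) (subring_rec A)" by (rule pr[rule_format]) simp
  have Q01: "Q 0 \<subset> Q (Suc 0)" using st[rule_format, of 0] by simp
  interpret Q0: primeideal "Q 0" "subring_rec A" by (rule p0)
  interpret Q1: primeideal "Q (Suc 0)" "subring_rec A" by (rule p1)
  note Q0I = Q0.is_ideal[unfolded A.ideal_iff] and Q1I = Q1.is_ideal[unfolded A.ideal_iff]
  have "prime_chain (subring_rec A) k (\<lambda>i. Q (Suc i))"
    unfolding prime_chain_def
  proof (intro conjI allI impI)
    fix i show "primeideal (Q (Suc i)) (subring_rec A)" if "i \<le> k" by (rule pr[rule_format]) (use that in simp)
    show "Q (Suc i) \<subset> Q (Suc (Suc i))" if "i < k" by (rule st[rule_format]) (use that in simp)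
  qed
  from Suc.IH[OF this] obtain e where e: "\<forall>N. \<exists>v. (\<forall>a\<in>tuples N k. v a \<in> V (e * N)) \<and>
     (\<forall>c. (\<Sum>a\<in>tuples N k. cst (c a) * v a) \<in> Q (Suc 0) \<longrightarrow> (\<forall>a\<in>tuples N k. c a = 0))" by (rule exE)
  obtain x where x: "x \<in> Q (Suc 0)" "x \<notin> Q 0" using Q01 by blast
  have xA: "x \<in> A" using x Q1I by blast
  obtain t where t: "x \<in> V t" using ex_V[OF xA] by blast
  have xpow: "x ^ i \<notin> Q 0" for i
  proof (induction i)
    case 0
    then show ?case using Q0.one_imp_carrier Q0.I_notcarr by auto
  next
    case (Suc i)
    then show ?case using Q0.I_prime[of x "x ^ i"] x xA A.power_C[OF xA] by auto
  qed
  show ?case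
  proof (intro exI[of _ "t + e"] allI)
    fix N
    obtain v where v: "\<forall>a\<in>tuples N k. v a \<in> V (e * N)"
      and ind: "\<forall>c. (\<Sum>a\<in>tuples N k. cst (c a) * v a) \<in> Q (Suc 0) \<longrightarrow> (\<forall>a\<in>tuples N k. c a = 0)"
      using e by blast
    define w where "w a = x ^ hd a * v (tl a)" for a
    show "\<exists>v. (\<forall>a\<in>tuples N (Suc k). v a \<in> V ((t + e) * N)) \<and>
      (\<forall>c. (\<Sum>a\<in>tuples N (Suc k). cst (c a) * v a) \<in> Q 0 \<longrightarrow> (\<forall>a\<in>tuples N (Suc k). c a = 0))"
    proof (intro exI[of _ w] conjI ballI allI impI)
      fix a assume "a \<in> tuples N (Suc k)"
      then obtain i b where a: "a = i # b" "i < N" "b \<in> tuples N k" by (cases a) auto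
      have "x ^ i * v b \<in> V (i * t + e * N)" using t v a by (intro mult_V power_V) auto
      moreover have "i * t + e * N \<le> (t + e) * N" using a(2) by (simp add: algebra_simps)
      ultimately show "w a \<in> V ((t + e) * N)" using V_mono by (auto simp: w_def a)
    next
      fix c a0 assume sum: "(\<Sum>a\<in>tuples N (Suc k). cst (c a) * w a) \<in> Q 0" and a0: "a0 \<in> tuples N (Suc k)"
      define y where "y i = (\<Sum>a\<in>tuples N k. cst (c (i # a)) * v a)" for i
      have yA: "y i \<in> A" for i
        unfolding y_def using v V_A by (intro A.sum_C A.mult_C single_A zero_S) blast
      have s: "(\<Sum>a\<in>tuples N (Suc k). cst (c a) * w a) = (\<Sum>i<N. x ^ i * y i)"
        unfolding sum_tuples_Suc y_def w_def by (simp add: sum_distrib_left mult_ac)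
      have "\<forall>a\<in>tuples N k. c (i # a) = 0" if "i < N" for i
        using that
      proof (induction i rule: less_induct)
        case (less i)
        have y0: "y j = 0" if "j < i" for j using less that by (simp add: y_def)
        define r where "r = (\<Sum>j\<in>{Suc i..<N}. x ^ (j - Suc i) * y j)"
        have rA: "r \<in> A" unfolding r_def using yA A.power_C[OF xA] by (intro A.sum_C A.mult_C) auto
        have "(\<Sum>j<N. x ^ j * y j) = (\<Sum>j\<in>{i..<N}. x ^ j * y j)"
          using y0 by (intro sum.mono_neutral_right) auto
        also have "\<dots> = x ^ i * y i + (\<Sum>j\<in>{Suc i..<N}. x ^ j * y j)"
          using less.prems by (simp add: sum.atLeast_Suc_lessThan)
        also have "(\<Sum>j\<in>{Suc i..<N}. x ^ j * y j) = x ^ i * (x * r)"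
          unfolding r_def sum_distrib_left
        proof (rule sum.cong[OF refl])
          fix j assume "j \<in> {Suc i..<N}"
          then have "x ^ j = x ^ i * (x * x ^ (j - Suc i))"
            by (simp add: power_add[symmetric] flip: power_Suc)
          then show "x ^ j * y j = x ^ i * (x * (x ^ (j - Suc i) * y j))" by (simp add: mult_ac)
        qed
        finally have "x ^ i * (y i + x * r) \<in> Q 0" using sum s by (simp add: distrib_left)
        then have "y i + x * r \<in> Q 0"
          using Q0.I_prime[of "x ^ i" "y i + x * r"] xpow A.power_C[OF xA] yA rA xA
          by (simp add: A.add_C A.mult_C)
        then have "y i + x * r \<in> Q (Suc 0)" using Q01 by blast
        moreover have "x * r \<in> Q (Suc 0)" using Q1I x(1) rA by (metis mult.commute)
        ultimately have "(y i + x * r) - x * r \<in> Q (Suc 0)" using A.ideal_diff[OF Q1.is_ideal] by blast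
        then have "y i \<in> Q (Suc 0)" by simp
        then show ?case using ind[rule_format, of "\<lambda>a. c (i # a)"] unfolding y_def by blast
      qed
      then show "c a0 = 0" using a0 by (cases a0) auto
    qed
  qed
qed

theorem prime_chain_length_le:
  assumes "prime_chain (subring_rec (A :: 'k::field mpoly set)) k Q"
  shows "k \<le> card P"
proof (rule ccontr)
  assume "\<not> ?thesis"
  then have kp: "Suc (card P) \<le> k" by simp
  interpret Q: primeideal "Q 0" "subring_rec (A :: 'k mpoly set)" using assms by (simp add: prime_chain_def)
  obtain e where e: "\<forall>N. \<exists>v. (\<forall>a\<in>tuples N k. v a \<in> V (e * N)) \<and>
     (\<forall>c. (\<Sum>a\<in>tuples N k. cst (c a) * v a) \<in> Q 0 \<longrightarrow> (\<forall>a\<in>tuples N k. c a = 0))"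
    using prime_chain_independent[OF assms] by blast
  \<comment> \<open>large enough for \<open>(e N + 1)\<^sup>p \<le> (e + 1)\<^sup>p N\<^sup>p < N\<^sup>p\<^sup>+\<^sup>1\<close>\<close>
  define N where "N = (e + 1) ^ card P + 1"
  obtain v where v: "\<forall>a\<in>tuples N k. v a \<in> V (e * N)"
    and ind: "\<forall>c. (\<Sum>a\<in>tuples N k. cst (c a) * v a) \<in> Q 0 \<longrightarrow> (\<forall>a\<in>tuples N k. c a = 0)"
    using e by blast
  let ?B = "{s\<in>S. \<forall>i. s i \<le> e * N}"
  have "card (tuples N k) \<le> card ((\<lambda>s. single s (1::'k)) ` ?B)"
  proof (rule independent_family_card_le[where v = v])
    show "finite (tuples N k)" by (rule finite_lists_length_eq) simp
    show "finite ((\<lambda>s. single s (1::'k)) ` ?B)" using finite_bounded_monomials by simp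
    show "v a \<in> mpoly.span ((\<lambda>s. single s (1::'k)) ` ?B)" if "a \<in> tuples N k" for a
      using V_span v that by blast
    show "\<forall>a\<in>tuples N k. c a = 0" if "(\<Sum>a\<in>tuples N k. cst (c a) * v a) = 0" for c
      using ind that Q.zero_closed by auto
  qed
  also have "\<dots> \<le> card ?B" using finite_bounded_monomials by (rule card_image_le)
  also have "\<dots> \<le> (e * N + 1) ^ card P" by (rule card_bounded_monomials)
  also have "\<dots> \<le> ((e + 1) * N) ^ card P" by (intro power_mono) (auto simp: N_def)
  also have "\<dots> = (e + 1) ^ card P * N ^ card P" by (rule power_mult_distrib)
  also have "\<dots> < N * N ^ card P" by (intro mult_strict_right_mono) (auto simp: N_def)
  also have "\<dots> = N ^ Suc (card P)" by simp
  also have "\<dots> \<le> N ^ k" by (intro power_increasing kp) (simp add: N_def)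
  also have "\<dots> = card (tuples N k)" by (simp add: card_lists_length_eq)
  finally show False by simp
qed

end

section \<open>Sorting exponent vectors\<close>

lemma list_less_iff:
  fixes xs ys :: "'a::linorder list"
  assumes "length xs = length ys"
  shows "xs < ys \<longleftrightarrow> (\<exists>k<length xs. (\<forall>j<k. xs ! j = ys ! j) \<and> xs ! k < ys ! k)"
  using assms
  by (induction xs ys rule: list_induct2)
     (auto simp: Cons_less_Cons Ex_less_Suc2 All_less_Suc2)

lemma list_leI:
  fixes xs ys :: "'a::linorder list"
  assumes "length xs = length ys"
    and "\<And>k. k < length xs \<Longrightarrow> (\<And>j. j < k \<Longrightarrow> xs ! j = ys ! j) \<Longrightarrow> xs ! k \<le> ys ! k"
  shows "xs \<le> ys"
proof (rule ccontr)
  assume "\<not> xs \<le> ys"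
  then have "ys < xs" by simp
  then obtain k where "k < length ys" "\<forall>j<k. ys ! j = xs ! j" "ys ! k < xs ! k"
    using list_less_iff[of ys xs] assms(1) by auto
  then show False using assms(2)[of k] assms(1) by fastforce
qed

text \<open>
  The effect on a sorted list of values of adding the indicator function of its first \<open>i\<close> positions.
\<close>
definition bump :: "nat \<Rightarrow> nat list \<Rightarrow> nat list" where
  "bump i xs = map (\<lambda>j. xs ! j + (if j < i then 1 else 0)) [0..<length xs]"

lemma length_bump [simp]: "length (bump i xs) = length xs" by (simp add: bump_def)

lemma nth_bump: "j < length xs \<Longrightarrow> bump i xs ! j = xs ! j + (if j < i then 1 else 0)"
  by (simp add: bump_def)

lemma bump_less: "length xs = length ys \<Longrightarrow> xs < ys \<Longrightarrow> bump i xs < bump i ys"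
proof -
  assume len: "length xs = length ys" and "xs < ys"
  then obtain k where "k < length xs" "\<forall>j<k. xs ! j = ys ! j" "xs ! k < ys ! k"
    using list_less_iff by blast
  then have "k < length (bump i xs) \<and> (\<forall>j<k. bump i xs ! j = bump i ys ! j) \<and> bump i xs ! k < bump i ys ! k"
    using len by (simp add: nth_bump)
  then show "bump i xs < bump i ys" using len list_less_iff[of "bump i xs" "bump i ys"] by auto
qed

lemma less_bump: "0 < i \<Longrightarrow> xs \<noteq> [] \<Longrightarrow> xs < bump i xs"
  by (auto simp: list_less_iff nth_bump intro!: exI[of _ 0])

definition ind :: "nat set \<Rightarrow> nat \<Rightarrow> nat" where "ind I j = (if j \<in> I then 1 else 0)"

context cone
begin

abbreviation "p \<equiv> card P"

text \<open>
  The positions in order of decreasing value, ties broken by the label. Lists of length two serve as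
  lexicographically ordered pairs.
\<close>

definition w :: "(nat \<Rightarrow> nat) \<Rightarrow> nat list" where
  "w f = sort_key (\<lambda>i. [- int (f i), int i]) (sorted_list_of_set P)"

lemma set_w [simp]: "set (w f) = P" and distinct_w [simp]: "distinct (w f)" and length_w [simp]: "length (w f) = p"
  using finite_P by (simp_all add: w_def)

lemma nth_w_P [simp]: "j < p \<Longrightarrow> w f ! j \<in> P"
  using nth_mem[of j "w f"] by simp

lemma w_order:
  assumes "i < j" "j < p"
  shows "f (w f ! j) < f (w f ! i) \<or> f (w f ! j) = f (w f ! i) \<and> w f ! i < w f ! j"
proof -
  let ?k = "\<lambda>i. [- int (f i), int i]"
  have "sorted (map ?k (w f))" by (simp add: w_def)
  then have "?k (w f ! i) \<le> ?k (w f ! j)" using assms by (simp add: sorted_iff_nth_mono)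
  moreover have "w f ! i \<noteq> w f ! j" using assms by (simp add: nth_eq_iff_index_eq)
  ultimately show ?thesis by (auto simp: Cons_le_Cons)
qed

lemma w_antimono: "i \<le> j \<Longrightarrow> j < p \<Longrightarrow> f (w f ! j) \<le> f (w f ! i)"
  using w_order[of i j f] by (cases "i = j") auto

lemma w_unique:
  assumes u: "distinct u" "set u = P"
    and "\<And>i j. i < j \<Longrightarrow> j < p \<Longrightarrow> f (u ! j) < f (u ! i) \<or> f (u ! j) = f (u ! i) \<and> u ! i < u ! j"
  shows "w f = u"
proof -
  let ?k = "\<lambda>i. [- int (f i), int i]"
  have inj: "inj_on ?k X" for X by (auto simp: inj_on_def)
  have len: "length u = p" using u distinct_card[of u] by simp
  have "sorted (map ?k u)"
  proof (intro sorted_iff_nth_mono_less[THEN iffD2] allI impI)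
    fix i j assume "i < j" "j < length (map ?k u)"
    then show "map ?k u ! i \<le> map ?k u ! j" using assms(3)[of i j] len by (auto simp: Cons_le_Cons)
  qed
  moreover have "sorted (map ?k (w f))" by (simp add: w_def)
  ultimately have "map ?k u = map ?k (w f)"
    using u inj by (intro sorted_distinct_set_unique) (auto simp: distinct_map)
  then show ?thesis by (intro map_inj_on[OF _ inj, symmetric])
qed

lemma index_w:
  assumes "x \<in> P" obtains j where "j < p" "x = w f ! j"
  using assms set_w[of f] length_w[of f] by (metis in_set_conv_nth)

text \<open>The \<open>i\<close> positions with the largest values.\<close>
definition init :: "nat \<Rightarrow> (nat \<Rightarrow> nat) \<Rightarrow> nat set" where "init i f = set (take i (w f))"

lemma init_P: "init i f \<subseteq> P" unfolding init_def using set_take_subset[of i "w f"] by simp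

lemma card_init: "i \<le> p \<Longrightarrow> card (init i f) = i"
  unfolding init_def by (simp add: distinct_card)

lemma nth_w_init_iff: "j < p \<Longrightarrow> w f ! j \<in> init i f \<longleftrightarrow> j < i"
proof -
  assume j: "j < p"
  have "w f ! j \<in> init i f \<longleftrightarrow> (\<exists>l<min p i. w f ! l = w f ! j)"
    unfolding init_def by (auto simp: in_set_conv_nth)
  also have "\<dots> \<longleftrightarrow> (\<exists>l<min p i. l = j)"
    using j by (intro ex_cong1 conj_cong refl) (simp add: nth_eq_iff_index_eq)
  also have "\<dots> \<longleftrightarrow> j < i" using j by auto
  finally show ?thesis .
qed

text \<open>
  The order for which the basis below has leading monomials \<open>x\<^sup>f\<close>: first the values in decreasing order
  are compared lexicographically, and then the words of positions, where a smaller word is larger.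
\<close>

definition wkey :: "(nat \<Rightarrow> nat) \<Rightarrow> nat list" where
  "wkey f = map f (w f) @ map (\<lambda>i. Max P - i) (w f)"

lemma length_wkey [simp]: "length (wkey f) = 2 * p" by (simp add: wkey_def)

lemma nth_wkey1: "j < p \<Longrightarrow> wkey f ! j = f (w f ! j)"
  and nth_wkey2: "j < p \<Longrightarrow> wkey f ! (p + j) = Max P - w f ! j"
  by (simp_all add: wkey_def nth_append)

lemma wkey_w_inj:
  assumes "\<And>k. k < p \<Longrightarrow> Max P - u ! k = Max P - v ! k" "set u = P" "set v = P" "length u = p" "length v = p"
  shows "u = v"
proof (rule nth_equalityI)
  fix k assume k: "k < length u"
  have "u ! k \<in> P" "v ! k \<in> P" using assms k nth_mem by metis+
  then have "u ! k \<le> Max P" "v ! k \<le> Max P" using finite_P by (auto intro: Max_ge)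
  moreover have "Max P - u ! k = Max P - v ! k" using assms(1)[of k] assms(4) k by simp
  ultimately show "u ! k = v ! k" by linarith
qed (use assms in simp)

lemma wkey_inj:
  assumes "f \<in> S" "g \<in> S" "wkey f = wkey g" shows "f = g"
proof -
  have eq: "wkey f ! j = wkey g ! j" for j using assms by simp
  have w: "w f = w g"
  proof (rule wkey_w_inj)
    fix k assume "k < p"
    then show "Max P - w f ! k = Max P - w g ! k" using eq[of "p + k"] by (simp add: nth_wkey2)
  qed simp_all
  show ?thesis
  proof
    fix x show "f x = g x"
    proof (cases "x \<in> P")
      case True
      then obtain j where "j < p" "x = w f ! j" by (rule index_w)
      then show ?thesis using eq[of j] w by (simp add: nth_wkey1)
    next
      case False
      then show ?thesis using assms by (simp add: S_def)
    qed
  qed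
qed

text \<open>The first \<open>k\<close> entries of \<open>w g\<close> maximise the sum of \<open>k\<close> values of \<open>g\<close>.\<close>
lemma sum_take_le:
  fixes g :: "nat \<Rightarrow> nat"
  assumes u: "distinct u" "set u = P" and k: "k \<le> p"
  shows "(\<Sum>j<k. g (u ! j)) \<le> (\<Sum>j<k. g (w g ! j))"
proof (cases "k = 0")
  case False
  have len: "length u = p" using u distinct_card[of u] by simp
  have s: "(\<Sum>j<k. g (l ! j)) = sum g (set (take k l))" if "distinct l" "length l = p" for l
  proof -
    have "sum g (set (take k l)) = sum_list (map g (take k l))" using that by (simp add: sum_list_distinct_conv_sum_set)
    also have "\<dots> = (\<Sum>j<k. g (l ! j))" using that k by (simp add: sum_list_sum_nth atLeast0LessThan)
    finally show ?thesis by simp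
  qed
  let ?J = "set (take k u)" and ?K = "set (take k (w g))"
  define t where "t = g (w g ! (k - 1))"
  have JP: "?J \<subseteq> P" using set_take_subset[of k u] u by simp
  have K: "?K = init k g" by (simp add: init_def)
  have c: "card ?J = card ?K" using u len k by (simp add: distinct_card)
  have hi: "t \<le> g x" if "x \<in> ?K" for x
  proof -
    have "x \<in> P" using that init_P K by blast
    then obtain j where j: "j < p" "x = w g ! j" by (rule index_w)
    then have "j < k" using that K nth_w_init_iff by blast
    then show ?thesis using j k False w_antimono[of j "k - 1" g] by (simp add: t_def)
  qed
  have lo: "g x \<le> t" if x: "x \<in> P" "x \<notin> ?K" for x
  proof -
    obtain j where j: "j < p" "x = w g ! j" using x(1) by (rule index_w)
    then have "\<not> j < k" using x K nth_w_init_iff by blast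
    then show ?thesis using j w_antimono[of "k - 1" j g] by (simp add: t_def)
  qed
  have "sum g (?J - ?K) \<le> of_nat (card (?J - ?K)) * t"
    using JP lo by (intro sum_bounded_above) auto
  also have "card (?J - ?K) = card (?K - ?J)"
    using c by (simp add: card_Diff_subset_Int Int_commute)
  also have "of_nat (card (?K - ?J)) * t \<le> sum g (?K - ?J)"
    using hi by (intro sum_bounded_below) auto
  finally have "sum g (?J - ?K) + sum g (?J \<inter> ?K) \<le> sum g (?K - ?J) + sum g (?J \<inter> ?K)" by simp
  then have "sum g ?J \<le> sum g ?K"
    using sum.Int_Diff[of ?J g ?K] sum.Int_Diff[of ?K g ?J] by (simp add: Int_commute add.commute)
  then show ?thesis using s[of u] s[of "w g"] u len by simp
qed simp

lemma sum_ind_le: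
  assumes u: "distinct u" "set u = P" and k: "k \<le> p" and I: "I \<subseteq> P"
  shows "(\<Sum>j<k. ind I (u ! j)) \<le> (\<Sum>j<k. if j < card I then 1 else 0)"
proof -
  have len: "length u = p" using u distinct_card[of u] by simp
  have "(\<Sum>j<k. ind I (u ! j)) = card {j. j < k \<and> u ! j \<in> I}"
    by (simp add: ind_def sum.If_cases Int_def)
  moreover have "card {j. j < k \<and> u ! j \<in> I} \<le> k"
    using card_mono[of "{..<k}" "{j. j < k \<and> u ! j \<in> I}"] by auto
  moreover have "card {j. j < k \<and> u ! j \<in> I} \<le> card I"
  proof (rule card_inj_on_le[where f = "\<lambda>j. u ! j"])
    show "inj_on ((!) u) {j. j < k \<and> u ! j \<in> I}" using u k len by (auto simp: inj_on_def nth_eq_iff_index_eq)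
  qed (use I finite_P finite_subset in auto)
  moreover have "(\<Sum>j<k. if j < card I then 1 else 0) = min k (card I)"
    by (induction k) auto
  ultimately show ?thesis by simp
qed

text \<open>
  Adding the indicator function of \<open>I\<close> to \<open>g\<close> raises each partial sum of sorted values by at most
  \<open>min k (card I)\<close>, so the sorted values of the sum are lexicographically at most those of \<open>g\<close> with the
  first \<open>card I\<close> raised by one. If they agree, then all partial sums agree: the word \<open>u\<close> of the sum also
  sorts \<open>g\<close>, and \<open>I\<close> consists of its first \<open>card I\<close> letters. But \<open>w g\<close> is the lexicographically least word
  that sorts \<open>g\<close>, so the second part of the key does not increase either, and equality forces \<open>u = w g\<close>.
\<close>
lemma wkey_add:
  assumes I: "I \<subseteq> P"
  shows wkey_add_le: "wkey (g + ind I) \<le> bump (card I) (wkey g)"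
    and wkey_add_eq: "wkey (g + ind I) = bump (card I) (wkey g) \<Longrightarrow> I = init (card I) g"
proof -
  let ?i = "card I"
  define u where "u = w (g + ind I)"
  define v where "v = w g"
  have u: "distinct u" "set u = P" "length u = p" by (simp_all add: u_def)
  have v: "distinct v" "set v = P" "length v = p" by (simp_all add: v_def)
  have ip: "?i \<le> p" using I finite_P by (rule card_mono[rotated])
  have G: "(\<Sum>j<k. g (u ! j)) \<le> (\<Sum>j<k. g (v ! j))" if "k \<le> p" for k
    unfolding v_def by (rule sum_take_le[OF u(1,2) that])
  have H: "(\<Sum>j<k. ind I (u ! j)) \<le> (\<Sum>j<k. if j < ?i then 1 else 0)" if "k \<le> p" for k
    by (rule sum_ind_le[OF u(1,2) that I])
  have pointwise: "g (u ! j) = g (v ! j) \<and> (u ! j \<in> I \<longleftrightarrow> j < ?i)"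
    if eq: "\<And>j. j < p \<Longrightarrow> g (u ! j) + ind I (u ! j) = g (v ! j) + (if j < ?i then 1 else 0)" and j: "j < p" for j
  proof -
    have sums: "(\<Sum>j<k. g (u ! j)) = (\<Sum>j<k. g (v ! j)) \<and>
       (\<Sum>j<k. ind I (u ! j)) = (\<Sum>j<k. if j < ?i then 1 else 0)" if "k \<le> p" for k
    proof -
      have "(\<Sum>j<k. g (u ! j) + ind I (u ! j)) = (\<Sum>j<k. g (v ! j) + (if j < ?i then 1 else 0))"
        using that by (intro sum.cong) (auto simp: eq)
      then show ?thesis using G[OF that] H[OF that] by (simp add: sum.distrib)
    qed
    have "g (u ! j) = g (v ! j)" using sums[of j] sums[of "Suc j"] j by simp
    moreover have "ind I (u ! j) = (if j < ?i then 1 else 0)" using sums[of j] sums[of "Suc j"] j by simp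
    ultimately show ?thesis by (simp add: ind_def split: if_splits)
  qed
  show le: "wkey (g + ind I) \<le> bump ?i (wkey g)"
  proof (rule list_leI)
    show "length (wkey (g + ind I)) = length (bump ?i (wkey g))" by simp
    fix k assume k: "k < length (wkey (g + ind I))"
      and prev: "\<And>j. j < k \<Longrightarrow> wkey (g + ind I) ! j = bump ?i (wkey g) ! j"
    have prev1: "g (u ! j) + ind I (u ! j) = g (v ! j) + (if j < ?i then 1 else 0)" if "j < k" "j < p" for j
      using prev[OF that(1)] that by (simp add: nth_bump nth_wkey1 u_def v_def)
    show "wkey (g + ind I) ! k \<le> bump ?i (wkey g) ! k"
    proof (cases "k < p")
      case True
      have "(\<Sum>j<k. g (u ! j) + ind I (u ! j)) = (\<Sum>j<k. g (v ! j) + (if j < ?i then 1 else 0))"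
        using True by (intro sum.cong) (auto simp: prev1)
      moreover have "(\<Sum>j<Suc k. g (u ! j)) \<le> (\<Sum>j<Suc k. g (v ! j))" using True by (intro G) simp
      moreover have "(\<Sum>j<Suc k. ind I (u ! j)) \<le> (\<Sum>j<Suc k. if j < ?i then 1 else 0)" using True by (intro H) simp
      ultimately have "g (u ! k) + ind I (u ! k) \<le> g (v ! k) + (if k < ?i then 1 else 0)"
        unfolding sum.distrib sum.lessThan_Suc by linarith
      then show ?thesis using True by (simp add: nth_bump nth_wkey1 u_def v_def)
    next
      case False
      define l where "l = k - p"
      have l: "k = p + l" "l < p" using False k by (auto simp: l_def)
      have pw: "g (u ! j) = g (v ! j) \<and> (u ! j \<in> I \<longleftrightarrow> j < ?i)" if "j < p" for j
      proof (rule pointwise[OF _ that])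
        fix j assume "j < p"
        then show "g (u ! j) + ind I (u ! j) = g (v ! j) + (if j < ?i then 1 else 0)" using prev1[of j] False by simp
      qed
      have le: "x \<le> Max P" if "x \<in> P" for x using that finite_P by (rule Max_ge[rotated])
      have prev2: "u ! j = v ! j" if "j < l" for j
      proof -
        have "Max P - u ! j = Max P - v ! j"
          using prev[of "p + j"] that l ip by (simp add: nth_bump nth_wkey2 u_def v_def)
        moreover have "u ! j \<in> P" "v ! j \<in> P" using that l by (simp_all add: u_def v_def)
        ultimately show ?thesis using le by (metis diff_diff_cancel)
      qed
      have "v ! l \<le> u ! l"
      proof (cases "u ! l = v ! l")
        case neq: False
        have "u ! l \<in> P" using l by (simp add: u_def)
        then obtain r where r: "r < p" "u ! l = v ! r" unfolding v_def by (rule index_w)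
        have "\<not> r < l"
        proof
          assume "r < l"
          then have "u ! l = u ! r" using prev2[of r] r by simp
          then show False using u l r \<open>r < l\<close> by (simp add: nth_eq_iff_index_eq)
        qed
        then have "l < r" using neq r by (cases "r = l") auto
        then show ?thesis using w_order[of l r g] r(1) r(2) pw[OF l(2)] by (simp add: v_def)
      qed simp
      then show ?thesis using l ip by (simp add: nth_bump nth_wkey2 u_def v_def)
    qed
  qed
  show "I = init ?i g" if eq: "wkey (g + ind I) = bump ?i (wkey g)"
  proof -
    have e: "wkey (g + ind I) ! j = bump ?i (wkey g) ! j" for j using eq by simp
    have pw: "g (u ! j) = g (v ! j) \<and> (u ! j \<in> I \<longleftrightarrow> j < ?i)" if "j < p" for j
    proof (rule pointwise[OF _ that])
      fix j assume "j < p"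
      then show "g (u ! j) + ind I (u ! j) = g (v ! j) + (if j < ?i then 1 else 0)"
        using e[of j] by (simp add: nth_bump nth_wkey1 u_def v_def)
    qed
    have "u = v"
    proof (rule wkey_w_inj[OF _ u(2) v(2) u(3) v(3)])
      fix k assume "k < p"
      then show "Max P - u ! k = Max P - v ! k"
        using e[of "p + k"] ip by (simp add: nth_bump nth_wkey2 u_def v_def)
    qed
    show ?thesis
    proof (rule Set.set_eqI)
      fix x show "x \<in> I \<longleftrightarrow> x \<in> init ?i g"
      proof (cases "x \<in> P")
        case True
        then obtain j where j: "j < p" "x = v ! j" unfolding v_def by (rule index_w)
        then show ?thesis using pw[OF j(1)] \<open>u = v\<close> nth_w_init_iff[of j g ?i] by (simp add: v_def)
      next
        case False
        then show ?thesis using I init_P by blast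
      qed
    qed
  qed
qed

text \<open>
  The extremal case of the preceding lemma: it keeps the word and raises the first \<open>i\<close> values. Up to
  smaller monomials, it is the effect on \<open>x\<^sup>f\<close> of multiplication by the \<open>i\<close>-th parameter.
\<close>
definition \<sigma> :: "nat \<Rightarrow> (nat \<Rightarrow> nat) \<Rightarrow> nat \<Rightarrow> nat" where "\<sigma> i f = f + ind (init i f)"

lemma w_\<sigma>: "w (\<sigma> i f) = w f"
proof (rule w_unique)
  fix k l assume kl: "k < l" "l < p"
  then show "\<sigma> i f (w f ! l) < \<sigma> i f (w f ! k) \<or> \<sigma> i f (w f ! l) = \<sigma> i f (w f ! k) \<and> w f ! k < w f ! l"
    using w_order[OF kl, of f] by (auto simp: \<sigma>_def ind_def nth_w_init_iff)
qed simp_all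

lemma wkey_\<sigma>: "i \<le> p \<Longrightarrow> wkey (\<sigma> i f) = bump i (wkey f)"
proof (rule nth_equalityI)
  fix j assume i: "i \<le> p" and j: "j < length (wkey (\<sigma> i f))"
  show "wkey (\<sigma> i f) ! j = bump i (wkey f) ! j"
  proof (cases "j < p")
    case True
    then show ?thesis by (simp add: nth_bump nth_wkey1 w_\<sigma>) (simp add: \<sigma>_def ind_def nth_w_init_iff)
  next
    case False
    then obtain l where "j = p + l" by (metis le_add_diff_inverse not_less)
    then show ?thesis using j i by (simp add: nth_bump nth_wkey2 w_\<sigma>)
  qed
qed simp

lemma wkey_add_le_\<sigma>:
  assumes I: "I \<subseteq> P" "card I = i" and gf: "wkey g \<le> wkey f" "g \<in> S" "f \<in> S"
  shows "wkey (g + ind I) \<le> wkey (\<sigma> i f)"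
    and "wkey (g + ind I) = wkey (\<sigma> i f) \<Longrightarrow> g = f \<and> I = init i f"
proof -
  have ip: "i \<le> p" using card_mono[OF finite_P I(1)] I(2) by simp
  have 1: "wkey (g + ind I) \<le> bump i (wkey g)" using wkey_add_le[OF I(1)] I(2) by simp
  have 2: "bump i (wkey g) < bump i (wkey f)" if "g \<noteq> f"
  proof (rule bump_less)
    show "wkey g < wkey f" using gf that wkey_inj by (auto simp: le_less)
  qed simp
  show "wkey (g + ind I) \<le> wkey (\<sigma> i f)"
    using 1 2 by (cases "g = f") (auto simp: wkey_\<sigma>[OF ip])
  assume eq: "wkey (g + ind I) = wkey (\<sigma> i f)"
  have "g = f"
  proof (rule ccontr)
    assume "g \<noteq> f"
    from 2[OF this] 1 eq show False by (simp add: wkey_\<sigma>[OF ip])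
  qed
  moreover from this have "I = init (card I) g" using eq I(2) by (intro wkey_add_eq[OF I(1)]) (simp add: wkey_\<sigma>[OF ip])
  ultimately show "g = f \<and> I = init i f" using I(2) by simp
qed

lemma wkey_less_\<sigma>: "0 < i \<Longrightarrow> i \<le> p \<Longrightarrow> wkey g \<le> wkey f \<Longrightarrow> wkey g < wkey (\<sigma> i f)"
proof -
  assume i: "0 < i" "i \<le> p" and "wkey g \<le> wkey f"
  have "wkey f \<noteq> []" using i by (auto simp flip: length_0_conv)
  then have "wkey f < wkey (\<sigma> i f)" using i by (simp add: wkey_\<sigma> less_bump)
  then show ?thesis using \<open>wkey g \<le> wkey f\<close> by simp
qed

end

section \<open>The descent basis and a regular sequence\<close>

context cone
begin

text \<open>A tie between \<open>a\<close> and \<open>b\<close> is broken in favour of \<open>a\<close>, since \<open>E\<close> increases labels.\<close>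

lemma E_init:
  assumes f: "f \<in> S" and ab: "(a, b) \<in> E" and b: "b \<in> init i f"
  shows "a \<in> init i f"
proof -
  have P: "a \<in> P" "b \<in> P" using ab E_P by auto
  obtain k where k: "k < p" "a = w f ! k" using P(1) by (rule index_w)
  obtain l where l: "l < p" "b = w f ! l" using P(2) by (rule index_w)
  have li: "l < i" using b l nth_w_init_iff by simp
  have fle: "f b \<le> f a" using f ab by (auto simp: S_def)
  have "\<not> l < k"
  proof
    assume "l < k"
    then show False using w_order[of l k f] k l fle E_less[OF ab] by auto
  qed
  then show ?thesis using li k nth_w_init_iff[of k f i] by simp
qed

lemma ind_init_S: "f \<in> S \<Longrightarrow> ind (init i f) \<in> S"
proof -
  assume f: "f \<in> S"
  have "ind (init i f) b \<le> ind (init i f) a" if "(a, b) \<in> E" for a b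
    using E_init[OF f that, of i] by (auto simp: ind_def)
  moreover have "ind (init i f) x = 0" if "x \<notin> P" for x
    using that init_P[of i f] by (auto simp: ind_def)
  ultimately show ?thesis by (auto simp: S_def)
qed

lemma \<sigma>_S: "f \<in> S \<Longrightarrow> \<sigma> i f \<in> S"
  unfolding \<sigma>_def by (intro add_S ind_init_S)

text \<open>
  The drop from the \<open>j\<close>-th to the next value (the value after the last one counts as zero) beyond what is
  forced: at a descent of the word the values must differ, since ties are broken by the label.
\<close>
definition gap :: "nat \<Rightarrow> (nat \<Rightarrow> nat) \<Rightarrow> nat" where
  "gap j f = f (w f ! j) - (if Suc j < p then f (w f ! Suc j) + (if w f ! Suc j < w f ! j then 1 else 0) else 0)"

lemma gap_bound:
  assumes "j < p"
  shows "(if Suc j < p then f (w f ! Suc j) + (if w f ! Suc j < w f ! j then 1 else 0) else 0) \<le> f (w f ! j)"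
  using w_order[of j "Suc j" f] by auto

lemma gap_\<sigma>:
  assumes "i < p" "j < p" shows "gap j (\<sigma> (Suc i) f) = gap j f + (if j = i then 1 else 0)"
proof -
  have s: "\<sigma> (Suc i) f (w f ! k) = f (w f ! k) + (if k \<le> i then 1 else 0)" if "k < p" for k
    using that by (simp add: \<sigma>_def ind_def nth_w_init_iff less_Suc_eq_le)
  show ?thesis
    using gap_bound[OF assms(2), of f] assms unfolding gap_def w_\<sigma> by (auto simp: s)
qed

text \<open>
  Lowering the first \<open>i + 1\<close> values by one keeps the word, because the drop after them is larger than it
  has to be; hence \<open>g\<close> satisfies the inequalities of \<open>S\<close> as well.
\<close>
lemma gap_pos_imp_\<sigma>:
  assumes f: "f \<in> S" and i: "i < p" and gap: "0 < gap i f"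
  obtains g where "g \<in> S" "f = \<sigma> (Suc i) g"
proof -
  define g where "g x = f x - ind (init (Suc i) f) x" for x
  \<comment> \<open>across the gap values drop, and if they drop by just one then the labels increase\<close>
  have drop: "f (w f ! l) < f (w f ! k) \<and> (f (w f ! k) - 1 = f (w f ! l) \<longrightarrow> w f ! k < w f ! l)"
    if kl: "k \<le> i" "i < l" "l < p" for k l
  proof -
    have a: "f (w f ! i) \<le> f (w f ! k)" using w_antimono[of k i f] kl by simp
    have b: "f (w f ! l) \<le> f (w f ! Suc i)" using w_antimono[of "Suc i" l f] kl by simp
    have c: "f (w f ! Suc i) + (if w f ! Suc i < w f ! i then 1 else 0) < f (w f ! i)"
      using gap kl by (simp add: gap_def split: if_splits)
    have "w f ! k < w f ! l" if e: "f (w f ! k) - 1 = f (w f ! l)"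
    proof -
      have eq: "f (w f ! k) = f (w f ! i)" "f (w f ! l) = f (w f ! Suc i)" and nd: "\<not> w f ! Suc i < w f ! i"
        using a b c e by (auto split: if_splits)
      have "w f ! k \<le> w f ! i" using w_order[of k i f] kl i eq by (cases "k = i") auto
      moreover have "w f ! i \<noteq> w f ! Suc i" using kl by (simp add: nth_eq_iff_index_eq)
      moreover have "w f ! Suc i \<le> w f ! l" using w_order[of "Suc i" l f] kl eq by (cases "l = Suc i") auto
      ultimately show ?thesis using nd by simp
    qed
    then show ?thesis using a b c by auto
  qed
  have gw: "g (w f ! k) = f (w f ! k) - (if k \<le> i then 1 else 0)" if "k < p" for k
    using that by (simp add: g_def ind_def nth_w_init_iff less_Suc_eq_le)
  have pos: "0 < f (w f ! k)" if "k \<le> i" for k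
  proof -
    have "f (w f ! i) \<le> f (w f ! k)" using w_antimono[of k i f] that i by simp
    moreover have "0 < f (w f ! i)" using gap by (simp add: gap_def)
    ultimately show ?thesis by simp
  qed
  have wg: "w g = w f"
  proof (rule w_unique)
    fix k l assume kl: "k < l" "l < p"
    consider "l \<le> i" | "k \<le> i" "i < l" | "i < k" by linarith
    then show "g (w f ! l) < g (w f ! k) \<or> g (w f ! l) = g (w f ! k) \<and> w f ! k < w f ! l"
    proof cases
      case 1
      then show ?thesis using w_order[OF kl, of f] kl pos[of k] pos[of l] by (auto simp: gw)
    next
      case 2
      then show ?thesis using drop[OF 2 kl(2)] kl by (auto simp: gw)
    next
      case 3
      then show ?thesis using w_order[OF kl, of f] kl by (auto simp: gw)
    qed
  qed simp_all
  have "g b \<le> g a" if ab: "(a, b) \<in> E" for a b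
  proof -
    have P: "a \<in> P" "b \<in> P" using ab E_P by auto
    obtain k where k: "k < p" "a = w f ! k" using P(1) by (rule index_w)
    obtain l where l: "l < p" "b = w f ! l" using P(2) by (rule index_w)
    have "f b \<le> f a" using f ab by (auto simp: S_def)
    then have "k \<le> l" using w_order[of l k f] k l E_less[OF ab] by (cases "k \<le> l") auto
    then show ?thesis using w_antimono[of k l g] l k by (simp add: wg)
  qed
  moreover have "g x = 0" if "x \<notin> P" for x using that f by (auto simp: g_def S_def)
  ultimately have "g \<in> S" by (auto simp: S_def)
  moreover have "f = \<sigma> (Suc i) g"
  proof
    fix x
    show "f x = \<sigma> (Suc i) g x"
    proof (cases "x \<in> P")
      case True
      then obtain k where k: "k < p" "x = w f ! k" by (rule index_w)
      have "x \<in> init (Suc i) g \<longleftrightarrow> k \<le> i" using nth_w_init_iff[of k g "Suc i"] k wg by (simp add: less_Suc_eq_le)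
      then show ?thesis using k gw[of k] pos[of k] by (auto simp: \<sigma>_def ind_def)
    next
      case False
      then have "x \<notin> init (Suc i) g" using init_P by blast
      then show ?thesis using False f \<open>g \<in> S\<close> by (simp add: \<sigma>_def ind_def S_def)
    qed
  qed
  ultimately show thesis by (rule that)
qed

text \<open>The order ideals of size \<open>i\<close>: a position is in \<open>I\<close> if one that it dominates is.\<close>

definition OI :: "nat \<Rightarrow> nat set set" where "OI i = {I. I \<subseteq> P \<and> card I = i \<and> ind I \<in> S}"

lemma finite_OI: "finite (OI i)"
  by (rule finite_subset[of _ "Pow P"]) (auto simp: OI_def finite_P)

lemma init_OI: "f \<in> S \<Longrightarrow> i \<le> p \<Longrightarrow> init i f \<in> OI i"
  by (simp add: OI_def init_P card_init ind_init_S)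

definition level_sum :: "nat \<Rightarrow> 'k::comm_ring_1 mpoly" where
  "level_sum i = (\<Sum>I\<in>OI i. single (ind I) 1)"

lemma level_sum_A: "level_sum i \<in> A"
  unfolding level_sum_def by (intro A.sum_C single_A) (simp add: OI_def)

definition \<theta> :: "(nat \<Rightarrow> 'k::comm_ring_1) \<Rightarrow> nat \<Rightarrow> 'k mpoly" where
  "\<theta> c j = level_sum (Suc j) - cst (c j)"

lemma \<theta>_A: "\<theta> c j \<in> A" unfolding \<theta>_def by (intro A.diff_C level_sum_A single_A zero_S)

text \<open>
  What is left of \<open>f\<close> when all gaps are closed: the sum of the indicator functions of \<open>init (j + 1) f\<close> over
  the descents \<open>j\<close> of its word.
\<close>
definition base :: "(nat \<Rightarrow> nat) \<Rightarrow> nat \<Rightarrow> nat" where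
  "base f x = f x - (\<Sum>j<p. gap j f * ind (init (Suc j) f) x)"

text \<open>
  The element of the descent basis with leading monomial \<open>x\<^sup>f\<close>.
\<close>
definition basis :: "(nat \<Rightarrow> 'k::comm_ring_1) \<Rightarrow> (nat \<Rightarrow> nat) \<Rightarrow> 'k mpoly" where
  "basis c f = (\<Prod>j<p. \<theta> c j ^ gap j f) * single (base f) 1"

lemma base_\<sigma>: "i < p \<Longrightarrow> base (\<sigma> (Suc i) f) = base f"
proof
  fix x assume i: "i < p"
  have init: "init (Suc j) (\<sigma> (Suc i) f) = init (Suc j) f" for j by (simp add: init_def w_\<sigma>)
  have "(\<Sum>j<p. gap j (\<sigma> (Suc i) f) * ind (init (Suc j) f) x) =
      (\<Sum>j<p. gap j f * ind (init (Suc j) f) x + (if j = i then ind (init (Suc j) f) x else 0))"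
    by (intro sum.cong) (auto simp: gap_\<sigma>[OF i] algebra_simps)
  also have "\<dots> = (\<Sum>j<p. gap j f * ind (init (Suc j) f) x) + ind (init (Suc i) f) x"
    using i by (simp add: sum.distrib sum.delta)
  finally show "base (\<sigma> (Suc i) f) x = base f x" unfolding base_def init by (simp add: \<sigma>_def)
qed

lemma basis_\<sigma>: "i < p \<Longrightarrow> basis c (\<sigma> (Suc i) f) = \<theta> c i * basis c f"
proof -
  assume i: "i < p"
  have "(\<Prod>j<p. \<theta> c j ^ gap j (\<sigma> (Suc i) f)) = (\<Prod>j<p. \<theta> c j ^ gap j f * (if j = i then \<theta> c j else 1))"
    by (intro prod.cong) (auto simp: gap_\<sigma>[OF i] mult.commute)
  also have "\<dots> = (\<Prod>j<p. \<theta> c j ^ gap j f) * \<theta> c i"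
    using i by (simp add: prod.distrib prod.delta)
  finally show ?thesis by (simp add: basis_def base_\<sigma>[OF i] mult_ac)
qed

lemma basis_primitive: "(\<And>j. j < p \<Longrightarrow> gap j f = 0) \<Longrightarrow> basis c f = single f 1"
proof -
  assume g: "\<And>j. j < p \<Longrightarrow> gap j f = 0"
  then have "base f = f" by (auto simp: base_def fun_eq_iff)
  then show ?thesis by (simp add: basis_def g)
qed

lemma sum_\<sigma>_less:
  assumes "i < p" shows "sum g P < sum (\<sigma> (Suc i) g) P"
proof -
  have "sum (ind (init (Suc i) g)) P = card (init (Suc i) g)"
    using finite_P init_P by (simp add: ind_def sum.If_cases Int_absorb1)
  then have "sum (\<sigma> (Suc i) g) P = sum g P + Suc i"
    using assms by (simp add: \<sigma>_def sum.distrib card_init)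
  then show ?thesis by simp
qed

text \<open>
  By induction, removing one unit of a gap at a time. If \<open>f = \<sigma> (i + 1) g\<close>, then the basis element of \<open>f\<close> is
  that of \<open>g\<close> times a parameter. All products of monomials \<open>x\<^sup>I x\<^sup>h\<close> that occur have key at most that of
  \<open>f\<close>, with equality only for \<open>h = g\<close> and \<open>I = init (i + 1) g\<close>, and the constant of the parameter
  contributes only smaller monomials.
\<close>
lemma basis_leading:
  assumes "f \<in> S"
  shows "basis c f \<in> A \<and> lookup (basis c f) f = 1 \<and> (\<forall>h\<in>keys (basis c f). wkey h \<le> wkey f)"
  using assms
proof (induction "sum f P" arbitrary: f rule: less_induct)
  case less
  show ?case
  proof (cases "\<exists>i<p. 0 < gap i f")
    case False
    then have "basis c f = single f 1" by (intro basis_primitive) auto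
    then show ?thesis using less.prems by (simp add: single_A)
  next
    case True
    then obtain i g where i: "i < p" and g: "g \<in> S" "f = \<sigma> (Suc i) g"
      using gap_pos_imp_\<sigma>[OF less.prems] by metis
    have IH: "basis c g \<in> A" "lookup (basis c g) g = 1" "\<And>h. h \<in> keys (basis c g) \<Longrightarrow> wkey h \<le> wkey g"
      using less.hyps[of g] g sum_\<sigma>_less[OF i] by auto
    have bf: "basis c f = (\<Sum>I\<in>OI (Suc i). single (ind I) 1 * basis c g) - cst (c i) * basis c g"
      unfolding g(2) basis_\<sigma>[OF i] by (simp add: \<theta>_def level_sum_def left_diff_distrib sum_distrib_right)
    have ip: "Suc i \<le> p" using i by simp
    have keyI: "wkey (ind I + h) \<le> wkey f \<and> (ind I + h = f \<longrightarrow> I = init (Suc i) g)"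
      if "I \<in> OI (Suc i)" "h \<in> keys (basis c g)" for I h
    proof -
      have I: "I \<subseteq> P" "card I = Suc i" using that by (auto simp: OI_def)
      have h: "h \<in> S" "wkey h \<le> wkey g" using that(2) IH by (auto simp: A_def)
      show ?thesis using wkey_add_le_\<sigma>[OF I h(2,1) g(1)] g(2) by (auto simp: add.commute)
    qed
    have key0: "wkey h < wkey f" if "h \<in> keys (basis c g)" for h
      using wkey_less_\<sigma>[OF _ ip IH(3)[OF that]] g(2) by simp
    have "basis c f \<in> A" unfolding g(2) basis_\<sigma>[OF i] using IH(1) by (intro A.mult_C \<theta>_A)
    moreover have "lookup (basis c f) f = 1"
    proof -
      have "lookup (single (ind I) 1 * basis c g) f = (if I = init (Suc i) g then 1 else 0)"
        if I: "I \<in> OI (Suc i)" for I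
      proof (cases "I = init (Suc i) g")
        case True
        then have "f = ind I + g" using g(2) by (simp add: \<sigma>_def add.commute)
        then show ?thesis using lookup_single_times[of "ind I" 1 "basis c g" g] IH(2) True by simp
      next
        case False
        have "f \<notin> keys (single (ind I) 1 * basis c g)"
          using keys_single_times[of "ind I" 1 "basis c g"] keyI[OF I] False by blast
        then show ?thesis using False by (simp add: in_keys_iff)
      qed
      then have "(\<Sum>I\<in>OI (Suc i). lookup (single (ind I) 1 * basis c g) f) =
          (\<Sum>I\<in>OI (Suc i). if I = init (Suc i) g then 1 else 0)" by (intro sum.cong) auto
      also have "\<dots> = 1" using init_OI[OF g(1) ip] finite_OI by simp
      finally have "lookup (\<Sum>I\<in>OI (Suc i). single (ind I) 1 * basis c g) f = 1"
        by (simp add: lookup_sum)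
      moreover have "f \<notin> keys (basis c g)" using key0[of f] by blast
      ultimately show ?thesis unfolding bf lookup_minus lookup_cst_times by (simp add: in_keys_iff)
    qed
    moreover have "wkey h \<le> wkey f" if h: "h \<in> keys (basis c f)" for h
    proof (cases "h \<in> keys (basis c g)")
      case True
      then show ?thesis using key0 by (simp add: less_imp_le)
    next
      case False
      then have "(\<Sum>I\<in>OI (Suc i). lookup (single (ind I) 1 * basis c g) h) \<noteq> 0"
        using h unfolding bf by (simp add: in_keys_iff lookup_minus lookup_cst_times lookup_sum)
      then obtain I where I: "I \<in> OI (Suc i)" "lookup (single (ind I) 1 * basis c g) h \<noteq> 0"
        by (meson sum.neutral)
      then have "h \<in> (\<lambda>g. ind I + g) ` keys (basis c g)"
        using keys_single_times[of "ind I" 1 "basis c g"] by (auto simp: in_keys_iff)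
      then show ?thesis using keyI[OF I(1)] by blast
    qed
    ultimately show ?thesis by blast
  qed
qed

text \<open>
  The linear map that sends each monomial \<open>x\<^sup>f\<close> to the basis element of \<open>f\<close>. It is bijective on \<open>A\<close>, as it is
  unitriangular for the well-order of the keys; so an element of \<open>A\<close> serves as its own coordinate space.
\<close>

definition comb :: "(nat \<Rightarrow> 'k::comm_ring_1) \<Rightarrow> 'k mpoly \<Rightarrow> 'k mpoly" where
  "comb c y = (\<Sum>f\<in>keys y. cst (lookup y f) * basis c f)"

lemma comb_superset:
  assumes "finite B" "keys y \<subseteq> B"
  shows "comb c y = (\<Sum>f\<in>B. cst (lookup y f) * basis c f)"
  unfolding comb_def using assms by (intro sum.mono_neutral_left) (auto simp: in_keys_iff)

lemma comb_add: "comb c (y + z) = comb c y + comb c z"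
proof -
  let ?B = "keys y \<union> keys z"
  have "comb c x = (\<Sum>s\<in>?B. cst (lookup x s) * basis c s)"
    if "x \<in> {y, z, y + z}" for x using that keys_add[of y z] by (intro comb_superset) auto
  then show ?thesis by (simp add: lookup_add single_add distrib_right sum.distrib)
qed

lemma comb_0: "comb c 0 = 0" by (simp add: comb_def)

lemma comb_single: "comb c (single f a) = cst a * basis c f"
  by (simp add: comb_superset[of "{f}"])

lemma comb_sum: "comb c (sum y B) = (\<Sum>i\<in>B. comb c (y i))"
  by (induction B rule: infinite_finite_induct) (auto simp: comb_0 comb_add)

lemma comb_uminus: "comb c (- y) = - comb c y"
  using comb_add[of c y "- y"] by (simp add: comb_0 eq_neg_iff_add_eq_0 add.commute)

lemma comb_diff: "comb c (y - z) = comb c y - comb c z"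
  using comb_add[of c y "- z"] by (simp add: comb_uminus)

lemma comb_A: "y \<in> A \<Longrightarrow> comb c y \<in> A"
proof -
  assume y: "y \<in> A"
  have "cst (lookup y f) * basis c f \<in> A" if "f \<in> keys y" for f
  proof -
    have "f \<in> S" using that y by (auto simp: A_def)
    then show ?thesis using basis_leading[of f c] by (intro A.mult_C single_A zero_S) blast
  qed
  then show "comb c y \<in> A" unfolding comb_def by (rule A.sum_C)
qed

lemma ex_wkey_max:
  assumes "y \<noteq> (0 :: 'k::comm_ring_1 mpoly)"
  obtains f where "f \<in> keys y" "\<And>g. g \<in> keys y \<Longrightarrow> wkey g \<le> wkey f"
proof -
  have "keys y \<noteq> {}" using assms by simp
  then have "Max (wkey ` keys y) \<in> wkey ` keys y" by (intro Max_in) auto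
  then obtain f where f: "f \<in> keys y" "wkey f = Max (wkey ` keys y)" by auto
  show thesis by (rule that[OF f(1)]) (simp add: f(2))
qed

lemma comb_injective:
  assumes y: "y \<in> A" and 0: "comb c y = 0" shows "y = 0"
proof (rule ccontr)
  assume "y \<noteq> 0"
  then obtain f where f: "f \<in> keys y" "\<And>g. g \<in> keys y \<Longrightarrow> wkey g \<le> wkey f"
    by (rule ex_wkey_max) blast
  have S: "g \<in> S" if "g \<in> keys y" for g using that y by (auto simp: A_def)
  have z: "lookup (basis c g) f = (if g = f then 1 else 0)" if g: "g \<in> keys y" for g
  proof (cases "g = f")
    case True
    then show ?thesis using basis_leading[OF S[OF g], of c] by simp
  next
    case False
    have "f \<notin> keys (basis c g)"
    proof
      assume "f \<in> keys (basis c g)"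
      then have "wkey f \<le> wkey g" using basis_leading[OF S[OF g], of c] by blast
      then show False using f(2)[OF g] wkey_inj[OF S[OF g] S[OF f(1)]] False by simp
    qed
    then show ?thesis using False by (simp add: in_keys_iff)
  qed
  have "lookup (comb c y) f =
      (\<Sum>g\<in>keys y. lookup y g * (if g = f then 1 else 0))"
    unfolding comb_def lookup_sum lookup_cst_times by (intro sum.cong) (auto simp: z)
  also have "\<dots> = (\<Sum>g\<in>keys y. if g = f then lookup y g else 0)"
    by (intro sum.cong) auto
  also have "\<dots> = lookup y f" using f(1) by simp
  finally show False using f(1) 0 by (simp add: in_keys_iff)
qed

lemma comb_surjective:
  assumes "y \<in> A" shows "\<exists>z\<in>A. comb c z = y"
proof -
  have "\<exists>z\<in>A. comb c z = y" if "y \<in> A" "\<forall>g\<in>keys y. wkey g < \<kappa>" for \<kappa> and y :: "'a mpoly"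
    using that
  proof (induction \<kappa> arbitrary: y rule: less_induct)
    case (less \<kappa>)
    show ?case
    proof (cases "y = 0")
      case True
      then show ?thesis using A.zero_C comb_0 by auto
    next
      case False
      then obtain f where f: "f \<in> keys y" "\<And>g. g \<in> keys y \<Longrightarrow> wkey g \<le> wkey f"
        by (rule ex_wkey_max) blast
      have fS: "f \<in> S" using f less.prems by (auto simp: A_def)
      note bl = basis_leading[OF fS, of c]
      let ?a = "lookup y f"
      let ?y = "y - cst ?a * basis c f"
      have yA: "?y \<in> A" using less.prems bl by (intro A.diff_C A.mult_C single_A zero_S) auto
      have "wkey g < wkey f" if g: "g \<in> keys ?y" for g
      proof -
        have "g \<noteq> f" using g bl by (auto simp: in_keys_iff lookup_minus lookup_cst_times)
        moreover have "g \<in> keys y \<or> g \<in> keys (basis c f)"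
          using g by (auto simp: in_keys_iff lookup_minus lookup_cst_times)
        then have "wkey g \<le> wkey f" using f(2) bl by blast
        moreover have "g \<in> S" using g yA by (auto simp: A_def)
        ultimately show ?thesis using wkey_inj[OF _ fS, of g] by (auto simp: le_less)
      qed
      moreover have "wkey f < \<kappa>" using f(1) less.prems by blast
      ultimately obtain z where z: "z \<in> A" "comb c z = ?y" using less.IH[OF _ yA, of "wkey f"] by blast
      have "comb c (z + single f ?a) = y" by (simp add: comb_add comb_single z)
      moreover have "z + single f ?a \<in> A" using z(1) fS by (intro A.add_C single_A)
      ultimately show ?thesis by blast
    qed
  qed note * = this
  obtain k where "\<And>x. x \<in> wkey ` keys y \<Longrightarrow> x < k" using ex_strict_bound[of "wkey ` keys y"] by auto
  then have "\<forall>g\<in>keys y. wkey g < k" by simp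
  then show ?thesis by (rule *[OF assms])
qed

text \<open>Multiplication by a parameter in coordinates: it maps basis elements injectively to basis elements.\<close>
definition shift :: "nat \<Rightarrow> 'k::comm_ring_1 mpoly \<Rightarrow> 'k mpoly" where
  "shift i y = (\<Sum>f\<in>keys y. single (\<sigma> (Suc i) f) (lookup y f))"

lemma comb_shift: "i < p \<Longrightarrow> comb c (shift i y) = \<theta> c i * comb c y"
  unfolding shift_def comb_sum comb_single comb_def[of c y] sum_distrib_left
  by (intro sum.cong refl) (simp add: basis_\<sigma> mult.left_commute)

lemma \<sigma>_inj: "\<sigma> i f = \<sigma> i g \<Longrightarrow> f = g"
proof -
  assume e: "\<sigma> i f = \<sigma> i g"
  then have "w f = w g" using w_\<sigma>[of i f] w_\<sigma>[of i g] by simp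
  then have "init i f = init i g" by (simp add: init_def)
  then show "f = g" using e by (simp add: \<sigma>_def)
qed

lemma keys_shift: "keys (shift i y) = \<sigma> (Suc i) ` keys y"
proof -
  have l: "lookup (shift i y) h =
     (\<Sum>f\<in>keys y. if \<sigma> (Suc i) f = h then lookup y f else 0)" for h
    by (simp add: shift_def lookup_sum lookup_single when_def)
  have "lookup (shift i y) (\<sigma> (Suc i) f) = lookup y f" if "f \<in> keys y" for f
  proof -
    have "(\<Sum>g\<in>keys y. if \<sigma> (Suc i) g = \<sigma> (Suc i) f then lookup y g else 0) =
       (\<Sum>g\<in>keys y. if g = f then lookup y g else 0)"
      using \<sigma>_inj by (intro sum.cong) auto
    then show ?thesis using that by (simp add: l)
  qed
  moreover have "h \<in> \<sigma> (Suc i) ` keys y" if "lookup (shift i y) h \<noteq> 0" for h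
  proof (rule ccontr)
    assume "h \<notin> \<sigma> (Suc i) ` keys y"
    then have "lookup (shift i y) h = 0" unfolding l by (intro sum.neutral) auto
    then show False using that by simp
  qed
  ultimately show ?thesis by (auto simp: in_keys_iff)
qed

lemma shift_A: "y \<in> A \<Longrightarrow> shift i y \<in> A"
  using \<sigma>_S by (auto simp: A_def keys_shift)

text \<open>
  Coordinates of the elements of the ideal generated by the first \<open>i\<close> parameters: that ideal is spanned
  by the basis elements which one of these parameters visibly divides.
\<close>

definition gapped :: "nat \<Rightarrow> 'k::comm_ring_1 mpoly set" where
  "gapped i = {y \<in> A. \<forall>f\<in>keys y. \<exists>j<i. 0 < gap j f}"

lemma gapped_A: "y \<in> gapped i \<Longrightarrow> y \<in> A" by (simp add: gapped_def)

lemma gapped_key: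
  assumes "y \<in> gapped i" "f \<in> keys y"
  obtains j where "f \<in> S" "j < i" "0 < gap j f"
  using assms unfolding gapped_def A_def by blast

lemma gapped_add: "x \<in> gapped i \<Longrightarrow> y \<in> gapped i \<Longrightarrow> x + y \<in> gapped i"
  using keys_add[of x y] A.add_C[of x y] unfolding gapped_def by blast

lemma gapped_0: "0 \<in> gapped i" by (simp add: gapped_def A.zero_C)

definition span_gap :: "(nat \<Rightarrow> 'k::comm_ring_1) \<Rightarrow> nat \<Rightarrow> 'k mpoly set" where
  "span_gap c i = comb c ` gapped i"

lemma span_gapI: "y \<in> gapped i \<Longrightarrow> comb c y \<in> span_gap c i"
  unfolding span_gap_def by (rule imageI)

lemma span_gapE:
  assumes "x \<in> span_gap c i" obtains y where "x = comb c y" "y \<in> gapped i"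
  using assms unfolding span_gap_def by (rule imageE)

lemma \<theta>_mult_span_gap:
  assumes "y \<in> A" "j < i" "i \<le> p" shows "\<theta> c j * y \<in> span_gap c i"
proof -
  obtain z where z: "z \<in> A" "comb c z = y" using comb_surjective[OF assms(1)] by blast
  have "\<exists>l<i. 0 < gap l f" if "f \<in> keys (shift j z)" for f
    using that assms by (auto simp: keys_shift gap_\<sigma> intro!: exI[of _ j])
  then have "shift j z \<in> gapped i" using shift_A[OF z(1)] by (simp add: gapped_def)
  from span_gapI[OF this, of c] show ?thesis using assms z by (simp add: comb_shift)
qed

lemma span_gap_add:
  assumes "x \<in> span_gap c i" "y \<in> span_gap c i" shows "x + y \<in> span_gap c i"
proof -
  obtain u where u: "x = comb c u" "u \<in> gapped i" using assms(1) by (rule span_gapE)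
  obtain v where v: "y = comb c v" "v \<in> gapped i" using assms(2) by (rule span_gapE)
  show ?thesis using span_gapI[OF gapped_add[OF u(2) v(2)], of c] by (simp add: comb_add u v)
qed

lemma span_gap_0: "0 \<in> span_gap c i"
  using span_gapI[OF gapped_0, of c i] by (simp add: comb_0)

lemma basis_gap_pos:
  assumes "f \<in> S" "j < p" "0 < gap j f"
  shows "\<exists>y\<in>A. basis c f = \<theta> c j * y"
proof -
  obtain g where g: "g \<in> S" "f = \<sigma> (Suc j) g" using gap_pos_imp_\<sigma>[OF assms] by blast
  then show ?thesis using basis_\<sigma>[OF assms(2)] basis_leading[OF g(1), of c] by auto
qed

lemma genideal_\<theta>:
  fixes c :: "nat \<Rightarrow> 'k::comm_ring_1"
  assumes i: "i \<le> p"
  shows "genideal (subring_rec A) (\<theta> c ` {..<i}) = span_gap c i"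
proof
  let ?T = "\<theta> c ` {..<i}"
  have TA: "?T \<subseteq> carrier (subring_rec A)" using \<theta>_A by auto
  have sumI: "(\<Sum>f\<in>B. x f) \<in> span_gap c i" if "\<And>f. f \<in> B \<Longrightarrow> x f \<in> span_gap c i" for B x
    using that by (induction B rule: infinite_finite_induct) (simp_all add: span_gap_0 span_gap_add)
  have "ideal (span_gap c i) (subring_rec A)"
    unfolding A.ideal_iff
  proof (intro conjI ballI span_gap_0 span_gap_add)
    show "span_gap c i \<subseteq> A" unfolding span_gap_def using comb_A gapped_A by blast
    fix x y :: "'k mpoly" assume x: "x \<in> A" and "y \<in> span_gap c i"
    then obtain z where z: "y = comb c z" "z \<in> gapped i" using span_gapE by blast
    have "x * y = (\<Sum>f\<in>keys z. x * (cst (lookup z f) * basis c f))"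
      by (simp add: z(1) comb_def sum_distrib_left)
    also have "\<dots> \<in> span_gap c i"
    proof (rule sumI)
      fix f assume f: "f \<in> keys z"
      from gapped_key[OF z(2) this] obtain j where "f \<in> S" and j: "j < i" "0 < gap j f" .
      then obtain u where u: "u \<in> A" "basis c f = \<theta> c j * u" using basis_gap_pos[of f j c] j i by auto
      have "x * (cst (lookup z f) * basis c f) = \<theta> c j * (x * (cst (lookup z f) * u))"
        by (simp add: u(2) mult_ac)
      also have "\<dots> \<in> span_gap c i"
        using x u j i by (intro \<theta>_mult_span_gap A.mult_C single_A zero_S)
      finally show "x * (cst (lookup z f) * basis c f) \<in> span_gap c i" .
    qed
    finally show "x * y \<in> span_gap c i" .
  qed
  moreover have "?T \<subseteq> span_gap c i" using \<theta>_mult_span_gap[OF A.one_C _ i] by auto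
  ultimately show "genideal (subring_rec A) ?T \<subseteq> span_gap c i" by (rule A.R.genideal_minimal)
  have J: "ideal (genideal (subring_rec A) ?T) (subring_rec A)" by (rule A.R.genideal_ideal[OF TA])
  note JI = J[unfolded A.ideal_iff]
  show "span_gap c i \<subseteq> genideal (subring_rec A) ?T"
  proof
    fix y assume "y \<in> span_gap c i"
    then obtain z where z: "y = comb c z" "z \<in> gapped i" using span_gapE by blast
    show "y \<in> genideal (subring_rec A) ?T"
      unfolding z(1) comb_def
    proof (rule A.ideal_sum[OF J])
      fix f assume f: "f \<in> keys z"
      from gapped_key[OF z(2) this] obtain j where "f \<in> S" and j: "j < i" "0 < gap j f" .
      then obtain u where u: "u \<in> A" "basis c f = \<theta> c j * u" using basis_gap_pos[of f j c] j i by auto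
      have "\<theta> c j \<in> genideal (subring_rec A) ?T" using A.R.genideal_self[OF TA] j by blast
      moreover have "cst (lookup z f) * u \<in> A" using u by (intro A.mult_C single_A zero_S)
      ultimately have "(cst (lookup z f) * u) * \<theta> c j \<in> genideal (subring_rec A) ?T" using JI by blast
      then show "cst (lookup z f) * basis c f \<in> genideal (subring_rec A) ?T"
        by (simp add: u(2) mult_ac)
    qed
  qed
qed

text \<open>
  In coordinates, multiplication by the \<open>i\<close>-th parameter only raises the gap \<open>i\<close>, so it neither creates
  nor destroys divisibility of basis elements by the earlier parameters.
\<close>
theorem weakly_regular_\<theta>:
  fixes c :: "nat \<Rightarrow> 'k::comm_ring_1"
  shows "weakly_regular (subring_rec A) (map (\<theta> c) [0..<p])"
  unfolding weakly_regular_def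
proof (intro conjI allI impI ballI)
  show "set (map (\<theta> c) [0..<p]) \<subseteq> carrier (subring_rec A)" using \<theta>_A by auto
  fix i and y :: "'k mpoly" assume "i < length (map (\<theta> c) [0..<p])" and "y \<in> carrier (subring_rec A)"
  then have i: "i < p" and y: "y \<in> A" by simp_all
  have "set (take i (map (\<theta> c) [0..<p])) = \<theta> c ` {..<i}" using i by (simp add: take_map atLeast0LessThan)
  then have gen: "genideal (subring_rec A) (set (take i (map (\<theta> c) [0..<p]))) = span_gap c i"
    using genideal_\<theta>[of i c] i by simp
  assume "map (\<theta> c) [0..<p] ! i \<otimes>\<^bsub>subring_rec A\<^esub> y \<in> genideal (subring_rec A) (set (take i (map (\<theta> c) [0..<p])))"
  then have "\<theta> c i * y \<in> span_gap c i" unfolding gen using i by simp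
  then obtain v where v: "\<theta> c i * y = comb c v" "v \<in> gapped i" by (rule span_gapE)
  obtain u where u: "u \<in> A" "comb c u = y" using comb_surjective[OF y] by blast
  have "comb c (shift i u - v) = 0" using u v i by (simp add: comb_diff comb_shift)
  from comb_injective[OF A.diff_C[OF shift_A[OF u(1)] gapped_A[OF v(2)]] this]
  have "shift i u - v = 0" .
  then have sv: "shift i u = v" by simp
  have "\<exists>j<i. 0 < gap j f" if "f \<in> keys u" for f
  proof -
    have "\<sigma> (Suc i) f \<in> keys v" using that by (simp add: keys_shift flip: sv)
    from gapped_key[OF v(2) this] obtain j where j: "j < i" "0 < gap j (\<sigma> (Suc i) f)" .
    then show ?thesis using gap_\<sigma>[OF i, of j f] i by auto
  qed
  then show "y \<in> genideal (subring_rec A) (set (take i (map (\<theta> c) [0..<p])))"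
    unfolding gen using span_gapI[of u i c] u by (simp add: gapped_def)
qed

theorem cm_criterion_A: "cm_criterion p (subring_rec (A :: 'k::{alg_closed_field, field_char_0} mpoly set))"
  unfolding cm_criterion_def
proof (intro conjI allI impI)
  show "cring (subring_rec (A :: 'k mpoly set))" by (rule A.cring_subring_rec)
  show "noetherian_ring (subring_rec (A :: 'k mpoly set))" by (rule noetherian_A)
  fix k and Q :: "nat \<Rightarrow> 'k mpoly set" assume "prime_chain (subring_rec A) k Q"
  then show "k \<le> p" by (rule prime_chain_length_le)
next
  fix M :: "'k mpoly set" assume M: "maximalideal M (subring_rec A)"
  have "\<forall>j. \<exists>a. level_sum (Suc j) - cst a \<in> M"
    using nullstellensatz[OF M level_sum_A] by blast
  then obtain c where c: "\<And>j. level_sum (Suc j) - cst (c j) \<in> M" by metis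
  have "weakly_regular (subring_rec A) (map (\<theta> c) [0..<p])" by (rule weakly_regular_\<theta>)
  moreover have "set (map (\<theta> c) [0..<p]) \<subseteq> M" using c by (auto simp: \<theta>_def)
  ultimately show "\<exists>xs. weakly_regular (subring_rec A) xs \<and> set xs \<subseteq> M \<and> length xs = p"
    by (intro exI[of _ "map (\<theta> c) [0..<p]"]) simp
qed

end

section \<open>Transport to monoid algebras\<close>

lemma cm_criterion_iso:
  assumes crit: "cm_criterion d R'" and g: "g \<in> ring_iso R' R" and R: "cring R"
  shows "cm_criterion d R"
proof -
  note crit = crit[unfolded cm_criterion_def]
  interpret R': cring R' using crit by (rule conjunct1)
  interpret R: cring R by (rule R)
  define h where "h = inv_into (carrier R') g"
  have h: "h \<in> ring_iso R R'" unfolding h_def by (rule ring_iso_set_sym[OF R'.ring_axioms g])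
  have bij: "bij_betw g (carrier R') (carrier R)" using g by (simp add: ring_iso_def)
  have gc: "g x \<in> carrier R" if "x \<in> carrier R'" for x using bij that by (rule bij_betwE[rule_format])
  have hc: "h y \<in> carrier R'" if "y \<in> carrier R" for y using h that unfolding ring_iso_def by (auto dest: bij_betwE)
  have hg: "h (g x) = x" if "x \<in> carrier R'" for x unfolding h_def using bij that by (simp add: bij_betw_inv_into_left)
  have gh: "g (h y) = y" if "y \<in> carrier R" for y unfolding h_def using bij that by (simp add: bij_betw_inv_into_right)
  interpret g: ring_hom_ring R' R g
    using g by (intro ring_hom_ringI2 R'.ring_axioms R.ring_axioms) (simp add: ring_iso_def)
  interpret h: ring_hom_ring R R' h
    using h by (intro ring_hom_ringI2 R'.ring_axioms R.ring_axioms) (simp add: ring_iso_def)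
  define pull where "pull I = {x \<in> carrier R'. g x \<in> I}" for I
  have pull_ideal: "ideal (pull I) R'" if "ideal I R" for I
    unfolding pull_def by (rule g.ideal_vimage[OF that])
  have push_ideal: "ideal {y \<in> carrier R. h y \<in> J} R" if "ideal J R'" for J
    by (rule h.ideal_vimage[OF that])
  \<comment> \<open>\<open>g\<close> maps the ideal generated by \<open>B\<close> onto the ideal generated by the image of \<open>B\<close>\<close>
  have gen: "g x \<in> genideal R (g ` B) \<longleftrightarrow> x \<in> genideal R' B" if B: "B \<subseteq> carrier R'" and x: "x \<in> carrier R'" for B x
  proof
    have gB: "g ` B \<subseteq> carrier R" using B gc by blast
    show "g x \<in> genideal R (g ` B)" if "x \<in> genideal R' B"
    proof -
      have "B \<subseteq> pull (genideal R (g ` B))" using R.genideal_self[OF gB] B by (auto simp: pull_def)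
      then have "genideal R' B \<subseteq> pull (genideal R (g ` B))"
        by (intro R'.genideal_minimal pull_ideal R.genideal_ideal gB)
      then show ?thesis using that by (auto simp: pull_def)
    qed
    show "x \<in> genideal R' B" if "g x \<in> genideal R (g ` B)"
    proof -
      have "g ` B \<subseteq> {y \<in> carrier R. h y \<in> genideal R' B}"
      proof (rule image_subsetI)
        fix a assume a: "a \<in> B"
        then have "a \<in> carrier R'" "a \<in> genideal R' B" using B R'.genideal_self[OF B] by blast+
        then show "g a \<in> {y \<in> carrier R. h y \<in> genideal R' B}" using gc hg by simp
      qed
      then have "genideal R (g ` B) \<subseteq> {y \<in> carrier R. h y \<in> genideal R' B}"
        by (intro R.genideal_minimal push_ideal R'.genideal_ideal B)
      then have "h (g x) \<in> genideal R' B" using that by blast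
      then show ?thesis using hg[OF x] by simp
    qed
  qed
  have noeth: "noetherian_ring R"
  proof (rule R.noetherian_ringI)
    interpret N: noetherian_ring R' by (rule crit[THEN conjunct2, THEN conjunct1])
    fix I assume I: "ideal I R"
    obtain B where B: "B \<subseteq> carrier R'" "finite B" "pull I = genideal R' B"
      using N.finetely_gen[OF pull_ideal[OF I]] by blast
    have gB: "g ` B \<subseteq> carrier R" using B(1) gc by blast
    have mem: "y \<in> I \<longleftrightarrow> y \<in> genideal R (g ` B)" if y: "y \<in> carrier R" for y
    proof -
      have "y \<in> I \<longleftrightarrow> h y \<in> pull I" using y hc gh by (simp add: pull_def)
      also have "\<dots> \<longleftrightarrow> g (h y) \<in> genideal R (g ` B)" unfolding B(3) using gen[OF B(1) hc[OF y]] by simp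
      finally show ?thesis using gh[OF y] by simp
    qed
    have "I = genideal R (g ` B)"
    proof (rule Set.set_eqI)
      fix y show "y \<in> I \<longleftrightarrow> y \<in> genideal R (g ` B)"
        using mem ideal.Icarr[OF I] ideal.Icarr[OF R.genideal_ideal[OF gB]] by blast
    qed
    then show "\<exists>C\<subseteq>carrier R. finite C \<and> I = genideal R C" using gB B(2) by (intro exI[of _ "g ` B"]) simp
  qed
  have dim: "k \<le> d" if chain: "prime_chain R k Q" for k Q
  proof -
    have pr: "primeideal (Q i) R" if "i \<le> k" for i
      using chain[unfolded prime_chain_def, THEN conjunct1] that by simp
    have st: "Q i \<subset> Q (Suc i)" if "i < k" for i
      using chain[unfolded prime_chain_def, THEN conjunct2] that by simp
    have "prime_chain R' k (\<lambda>i. pull (Q i))"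
      unfolding prime_chain_def
    proof (intro conjI allI impI)
      fix i assume "i \<le> k"
      then interpret Q: primeideal "Q i" R by (rule pr)
      show "primeideal (pull (Q i)) R'"
      proof (rule primeidealI[OF pull_ideal[OF Q.is_ideal] R'.is_cring])
        have "\<one>\<^bsub>R'\<^esub> \<notin> pull (Q i)" using Q.one_imp_carrier Q.I_notcarr by (auto simp: pull_def)
        then show "carrier R' \<noteq> pull (Q i)" by auto
        fix a b assume "a \<in> carrier R'" "b \<in> carrier R'" "a \<otimes>\<^bsub>R'\<^esub> b \<in> pull (Q i)"
        then show "a \<in> pull (Q i) \<or> b \<in> pull (Q i)" using Q.I_prime[of "g a" "g b"] by (auto simp: pull_def)
      qed
    next
      fix i assume i: "i < k"
      interpret Q: primeideal "Q (Suc i)" R using i by (intro pr) simp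
      obtain y where y: "y \<in> Q (Suc i)" "y \<notin> Q i" using st[OF i] by blast
      then have "h y \<in> pull (Q (Suc i))" "h y \<notin> pull (Q i)" using gh[OF Q.Icarr] hc[OF Q.Icarr] by (auto simp: pull_def)
      moreover have "pull (Q i) \<subseteq> pull (Q (Suc i))" using st[OF i] by (auto simp: pull_def)
      ultimately show "pull (Q i) \<subset> pull (Q (Suc i))" by blast
    qed
    then show ?thesis by (rule crit[THEN conjunct2, THEN conjunct2, THEN conjunct1, rule_format])
  qed
  have reg: "\<exists>xs. weakly_regular R xs \<and> set xs \<subseteq> M \<and> length xs = d" if M: "maximalideal M R" for M
  proof -
    interpret M: maximalideal M R by (rule M)
    have "maximalideal (pull M) R'"
    proof (rule maximalidealI[OF pull_ideal[OF M.is_ideal]])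
      have "\<one>\<^bsub>R'\<^esub> \<notin> pull M" using M.one_imp_carrier M.I_notcarr by (auto simp: pull_def)
      then show "carrier R' \<noteq> pull M" by auto
      fix J assume J: "ideal J R'" "pull M \<subseteq> J" "J \<subseteq> carrier R'"
      let ?K = "{y \<in> carrier R. h y \<in> J}"
      have "M \<subseteq> ?K" using J(2) M.Icarr gh hc by (fastforce simp: pull_def)
      then have "?K = M \<or> ?K = carrier R" by (intro M.I_maximal push_ideal[OF J(1)]) auto
      then show "J = pull M \<or> J = carrier R'"
      proof
        assume K: "?K = M"
        have "J \<subseteq> pull M"
        proof
          fix x assume x: "x \<in> J"
          then have "g x \<in> ?K" using J(3) gc hg by auto
          then show "x \<in> pull M" using K x J(3) by (auto simp: pull_def)
        qed
        then show ?thesis using J(2) by blast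
      next
        assume K: "?K = carrier R"
        have "carrier R' \<subseteq> J"
        proof
          fix x assume x: "x \<in> carrier R'"
          then have "g x \<in> ?K" using K gc by blast
          then show "x \<in> J" using hg[OF x] by simp
        qed
        then show ?thesis using J(3) by blast
      qed
    qed
    from crit[THEN conjunct2, THEN conjunct2, THEN conjunct2, rule_format, OF this]
    obtain xs where xs: "weakly_regular R' xs" "set xs \<subseteq> pull M" "length xs = d" by (elim exE conjE)
    have xc: "set xs \<subseteq> carrier R'" using xs(1) by (simp add: weakly_regular_def)
    have "weakly_regular R (map g xs)"
      unfolding weakly_regular_def
    proof (intro conjI allI impI ballI)
      show "set (map g xs) \<subseteq> carrier R" using xc gc by auto
      fix i y assume i: "i < length (map g xs)" and y: "y \<in> carrier R"
      have sub: "set (take i xs) \<subseteq> carrier R'" using xc set_take_subset by fast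
      have st: "set (take i (map g xs)) = g ` set (take i xs)" by (simp add: take_map)
      have x: "xs ! i \<in> carrier R'" using xc i nth_mem[of i xs] by (simp add: subset_iff)
      assume "map g xs ! i \<otimes>\<^bsub>R\<^esub> y \<in> genideal R (set (take i (map g xs)))"
      then have "g (xs ! i \<otimes>\<^bsub>R'\<^esub> h y) \<in> genideal R (g ` set (take i xs))"
        using i x y hc gh by (simp add: st)
      then have "xs ! i \<otimes>\<^bsub>R'\<^esub> h y \<in> genideal R' (set (take i xs))"
        using gen[OF sub, of "xs ! i \<otimes>\<^bsub>R'\<^esub> h y"] x hc[OF y] by simp
      then have "h y \<in> genideal R' (set (take i xs))"
        using xs(1) i hc[OF y] by (simp add: weakly_regular_def)
      then have "g (h y) \<in> genideal R (g ` set (take i xs))" using gen[OF sub hc[OF y]] by simp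
      then show "y \<in> genideal R (set (take i (map g xs)))" using gh[OF y] by (simp add: st)
    qed
    moreover have "set (map g xs) \<subseteq> M" using xs(2) by (auto simp: pull_def)
    ultimately show ?thesis using xs(3) by (intro exI[of _ "map g xs"]) simp
  qed
  show ?thesis unfolding cm_criterion_def
    using R noeth dim reg by (intro conjI allI impI)
qed

text \<open>
  An isomorphism of the monoid onto \<open>S\<close> extends linearly to an isomorphism of the algebras; the commutative
  ring laws of the monoid algebra are inherited along it.
\<close>
lemma (in cone) cohen_macaulay_monoid_algebra:
  fixes G :: "('a, 'b) monoid_scheme" and \<phi> :: "'a \<Rightarrow> nat \<Rightarrow> nat"
  assumes \<phi>: "bij_betw \<phi> (carrier G) S"
    and mult: "\<And>x y. x \<in> carrier G \<Longrightarrow> y \<in> carrier G \<Longrightarrow> x \<otimes>\<^bsub>G\<^esub> y \<in> carrier G \<and> \<phi> (x \<otimes>\<^bsub>G\<^esub> y) = \<phi> x + \<phi> y"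
    and one: "\<one>\<^bsub>G\<^esub> \<in> carrier G" "\<phi> \<one>\<^bsub>G\<^esub> = 0"
  shows "cohen_macaulay (monoid_algebra G :: ('a \<Rightarrow>\<^sub>0 'k::{alg_closed_field, field_char_0}) ring)"
proof -
  let ?R = "monoid_algebra G :: ('a \<Rightarrow>\<^sub>0 'k) ring"
  let ?C = "{y :: 'a \<Rightarrow>\<^sub>0 'k. keys y \<subseteq> carrier G}"
  define h where "h y = (\<Sum>x\<in>keys y. single (\<phi> x) (lookup y x))"
    for y :: "'a \<Rightarrow>\<^sub>0 'k"
  have R: "carrier ?R = ?C" "\<one>\<^bsub>?R\<^esub> = single \<one>\<^bsub>G\<^esub> 1" "\<zero>\<^bsub>?R\<^esub> = 0" "y \<oplus>\<^bsub>?R\<^esub> z = y + z"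
    "y \<otimes>\<^bsub>?R\<^esub> z = (\<Sum>a\<in>keys y. \<Sum>b\<in>keys z.
        single (a \<otimes>\<^bsub>G\<^esub> b) (lookup y a * lookup z b))" for y z
    by (simp_all add: monoid_algebra_def)
  have inj: "inj_on \<phi> (carrier G)" and im: "\<phi> ` carrier G = S" using \<phi> by (simp_all add: bij_betw_def)
  have h_super: "h y = (\<Sum>x\<in>B. single (\<phi> x) (lookup y x))"
    if "finite B" "keys y \<subseteq> B" for y B
    unfolding h_def using that by (intro sum.mono_neutral_left) (auto simp: in_keys_iff)
  have h_add: "h (y + z) = h y + h z" for y z
  proof -
    let ?B = "keys y \<union> keys z"
    have "h x = (\<Sum>a\<in>?B. single (\<phi> a) (lookup x a))"
      if "x \<in> {y, z, y + z}" for x using that keys_add[of y z] by (intro h_super) auto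
    then show ?thesis by (simp add: lookup_add single_add sum.distrib)
  qed
  have h_0: "h 0 = 0" by (simp add: h_def)
  have h_sum: "h (sum y B) = (\<Sum>i\<in>B. h (y i))" for y :: "'i \<Rightarrow> 'a \<Rightarrow>\<^sub>0 'k" and B
    by (induction B rule: infinite_finite_induct) (auto simp: h_0 h_add)
  have h_single: "h (single x c) = single (\<phi> x) c" for x c
    by (simp add: h_super[of "{x}"])
  have h_A: "h y \<in> A" if "y \<in> ?C" for y
    unfolding h_def using that im by (intro A.sum_C single_A) auto
  have h_lookup: "lookup (h y) (\<phi> x) = lookup y x" if "y \<in> ?C" "x \<in> carrier G" for y x
  proof -
    have "lookup (h y) (\<phi> x) =
        (\<Sum>a\<in>keys y. if a = x then lookup y a else 0)"
      unfolding h_def lookup_sum using that inj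
      by (intro sum.cong) (auto simp: lookup_single when_def inj_on_def)
    then show ?thesis by (auto simp: in_keys_iff)
  qed
  have h_inj: "inj_on h ?C"
  proof (rule inj_onI)
    fix y z assume yz: "y \<in> ?C" "z \<in> ?C" "h y = h z"
    show "y = z"
    proof (rule poly_mapping_eqI)
      fix x
      show "lookup y x = lookup z x"
      proof (cases "x \<in> carrier G")
        case True
        then show ?thesis using h_lookup[OF yz(1) True] h_lookup[OF yz(2) True] yz(3) by simp
      next
        case False
        then have "x \<notin> keys y" "x \<notin> keys z" using yz by blast+
        then show ?thesis by (simp add: in_keys_iff)
      qed
    qed
  qed
  have h_surj: "\<exists>y\<in>?C. h y = z" if z: "z \<in> A" for z
  proof
    define \<psi> where "\<psi> = inv_into (carrier G) \<phi>"
    have \<psi>: "\<psi> s \<in> carrier G" "\<phi> (\<psi> s) = s" if "s \<in> keys z" for s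
      using that z im inv_into_into[of s \<phi> "carrier G"] f_inv_into_f[of s \<phi> "carrier G"]
      by (auto simp: A_def \<psi>_def)
    let ?y = "\<Sum>s\<in>keys z. single (\<psi> s) (lookup z s)"
    show "?y \<in> ?C"
      using keys_sum[of "\<lambda>s. single (\<psi> s) (lookup z s)" "keys z"] \<psi>(1)
      by (auto split: if_splits)
    have "h ?y = (\<Sum>s\<in>keys z. single s (lookup z s))"
      by (simp add: h_sum h_single \<psi>(2))
    then show "h ?y = z" using poly_mapping_expand[of z] by simp
  qed
  have h_mult: "h (y \<otimes>\<^bsub>?R\<^esub> z) = h y * h z" if yz: "y \<in> ?C" "z \<in> ?C" for y z
  proof -
    have "h (y \<otimes>\<^bsub>?R\<^esub> z) = (\<Sum>a\<in>keys y. \<Sum>b\<in>keys z.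
        single (\<phi> (a \<otimes>\<^bsub>G\<^esub> b)) (lookup y a * lookup z b))"
      by (simp add: R(5) h_sum h_single)
    also have "\<dots> = (\<Sum>a\<in>keys y. \<Sum>b\<in>keys z.
        single (\<phi> a) (lookup y a) * single (\<phi> b) (lookup z b))"
    proof (intro sum.cong refl)
      fix a b assume "a \<in> keys y" "b \<in> keys z"
      then have "a \<in> carrier G" "b \<in> carrier G" using yz by blast+
      then show "single (\<phi> (a \<otimes>\<^bsub>G\<^esub> b)) (lookup y a * lookup z b) =
        single (\<phi> a) (lookup y a) * single (\<phi> b) (lookup z b)"
        using mult by (simp add: mult_single)
    qed
    also have "\<dots> = h y * h z" by (simp add: h_def sum_product)
    finally show ?thesis .
  qed
  have mult_closed: "y \<otimes>\<^bsub>?R\<^esub> z \<in> ?C" if yz: "y \<in> ?C" "z \<in> ?C" for y z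
  proof -
    have "keys (y \<otimes>\<^bsub>?R\<^esub> z) \<subseteq> (\<Union>a\<in>keys y. \<Union>b\<in>keys z. {a \<otimes>\<^bsub>G\<^esub> b})"
      unfolding R(5)
      by (intro order_trans[OF keys_sum] UN_mono order_refl) (auto split: if_splits)
    also have "\<dots> \<subseteq> carrier G"
    proof (intro UN_least)
      fix a b assume "a \<in> keys y" "b \<in> keys z"
      then have "a \<in> carrier G" "b \<in> carrier G" using yz by blast+
      then show "{a \<otimes>\<^bsub>G\<^esub> b} \<subseteq> carrier G" using mult by blast
    qed
    finally show ?thesis by blast
  qed
  have add_closed: "y + z \<in> ?C" if "y \<in> ?C" "z \<in> ?C" for y z
    using that keys_add[of y z] by blast
  have bij: "bij_betw h ?C A"
    unfolding bij_betw_def using h_inj h_A h_surj by (auto simp: image_iff)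
  define g where "g = inv_into ?C h"
  have g_C: "g x \<in> ?C" and hg: "h (g x) = x" if "x \<in> A" for x
    using bij that unfolding g_def by (auto simp: bij_betw_inv_into_right dest: bij_betw_inv_into bij_betwE)
  have gh: "g (h y) = y" if "y \<in> ?C" for y
    using bij that unfolding g_def by (rule bij_betw_inv_into_left)
  have one_C: "single \<one>\<^bsub>G\<^esub> 1 \<in> ?C" using one by simp
  have "h (single \<one>\<^bsub>G\<^esub> 1) = 1" by (simp add: h_single one)
  then have g1: "g 1 = \<one>\<^bsub>?R\<^esub>" using gh[OF one_C] by (simp add: R)
  have g0: "g 0 = \<zero>\<^bsub>?R\<^esub>" using gh[of 0] by (simp add: R h_0)
  have g_iso: "g \<in> ring_iso (subring_rec A) ?R"
  proof (rule ring_iso_memI)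
    fix x y :: "'k mpoly" assume "x \<in> carrier (subring_rec A)" "y \<in> carrier (subring_rec A)"
    then have x: "x \<in> A" and y: "y \<in> A" by simp_all
    show "g x \<in> carrier ?R" using g_C[OF x] by (simp only: R)
    have "h (g x \<otimes>\<^bsub>?R\<^esub> g y) = x * y" using h_mult[OF g_C[OF x] g_C[OF y]] by (simp add: hg x y)
    then show "g (x \<otimes>\<^bsub>subring_rec A\<^esub> y) = g x \<otimes>\<^bsub>?R\<^esub> g y"
      using gh[OF mult_closed[OF g_C[OF x] g_C[OF y]]] by simp
    have "h (g x + g y) = x + y" by (simp add: h_add hg x y)
    then show "g (x \<oplus>\<^bsub>subring_rec A\<^esub> y) = g x \<oplus>\<^bsub>?R\<^esub> g y"
      using gh[OF add_closed[OF g_C[OF x] g_C[OF y]]] by (simp add: R)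
  next
    show "g \<one>\<^bsub>subring_rec A\<^esub> = \<one>\<^bsub>?R\<^esub>" using g1 by simp
    show "bij_betw g (carrier (subring_rec A)) (carrier ?R)"
      unfolding g_def R(1) subring_rec_simps by (rule bij_betw_inv_into[OF bij])
  qed
  have "cring (?R\<lparr>zero := g \<zero>\<^bsub>subring_rec A\<^esub>\<rparr>)"
    by (rule A.R.ring_iso_imp_img_cring[OF g_iso])
  then have "cring ?R" by (simp add: g0)
  from cohen_macaulay_if_cm_criterion[OF cm_criterion_iso[OF cm_criterion_A g_iso this]] show ?thesis .
qed

section \<open>Tableaux as Gelfand--Tsetlin patterns\<close>

definition row :: "tableau \<Rightarrow> nat \<Rightarrow> nat list" where
  "row T i = (if i < length T then T ! i else [])"

definition le_count :: "nat list \<Rightarrow> nat \<Rightarrow> nat" where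
  "le_count r k = length (filter (\<lambda>x. x \<le> k) r)"

lemma row_Cons_0 [simp]: "row (r # T) 0 = r" and row_Cons_Suc [simp]: "row (r # T) (Suc i) = row T i"
  and row_Nil [simp]: "row [] i = []"
  by (simp_all add: row_def)

lemma le_count_Nil [simp]: "le_count [] k = 0" by (simp add: le_count_def)

lemma sorted_nth_le_iff:
  "sorted r \<Longrightarrow> j < length r \<Longrightarrow> r ! j \<le> k \<longleftrightarrow> j < le_count r k"
proof (induction r arbitrary: j)
  case (Cons a r)
  show ?case
  proof (cases "a \<le> k")
    case True
    then show ?thesis using Cons by (cases j) (auto simp: le_count_def)
  next
    case False
    then have "\<forall>x\<in>set (a # r). \<not> x \<le> k" using Cons.prems(1) by auto
    moreover from this have "le_count (a # r) k = 0" by (simp add: le_count_def filter_empty_conv)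
    ultimately show ?thesis using nth_mem[OF Cons.prems(2)] by auto
  qed
qed simp

lemma le_count_le_length: "le_count r k \<le> length r" by (simp add: le_count_def)

lemma le_count_mono: "k \<le> l \<Longrightarrow> le_count r k \<le> le_count r l"
  by (induction r) (auto simp: le_count_def)

lemma le_count_max: "set r \<subseteq> {1..m} \<Longrightarrow> m \<le> k \<Longrightarrow> le_count r k = length r"
  unfolding le_count_def by (subst filter_True) auto

lemma le_count_0: "set r \<subseteq> {1..m} \<Longrightarrow> le_count r 0 = 0"
  by (auto simp: le_count_def filter_empty_conv)

text \<open>
  In a sorted row the entry at index \<open>j\<close> is at most \<open>k\<close> iff \<open>j\<close> is below the number of entries at most
  \<open>k\<close>. Hence strictly increasing columns amount to inequalities between these numbers; for \<open>k = m\<close> they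
  also say that the lengths of the rows decrease.
\<close>
lemma SSYT_iff:
  "T \<in> SSYT n m \<longleftrightarrow> length T \<le> n \<and>
     (\<forall>i<length T. T ! i \<noteq> [] \<and> sorted (T ! i) \<and> set (T ! i) \<subseteq> {1..m}) \<and>
     (\<forall>i k. le_count (row T (Suc i)) (Suc k) \<le> le_count (row T i) k)" (is "?L \<longleftrightarrow> ?R")
proof
  assume L: ?L
  then have part: "is_partition (map length T)" and st: "\<And>r. r \<in> set T \<Longrightarrow> sorted r"
    and col: "\<And>i j. Suc i < length T \<Longrightarrow> j < length (T ! Suc i) \<Longrightarrow> T ! i ! j < T ! Suc i ! j"
    and len: "length T \<le> n" and ent: "\<And>r. r \<in> set T \<Longrightarrow> set r \<subseteq> {1..m}"
    by (auto simp: SSYT_def semistandard_def)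
  have "le_count (row T (Suc i)) (Suc k) \<le> le_count (row T i) k" for i k
  proof (cases "Suc i < length T \<and> le_count (T ! Suc i) (Suc k) \<noteq> 0")
    case False
    then show ?thesis by (auto simp: row_def)
  next
    case True
    then have i: "Suc i < length T" by simp
    define j where "j = le_count (T ! Suc i) (Suc k) - 1"
    have j: "j < le_count (T ! Suc i) (Suc k)" using True by (simp add: j_def)
    have jl: "j < length (T ! Suc i)" using j le_count_le_length[of "T ! Suc i" "Suc k"] by simp
    have "T ! Suc i ! j \<le> Suc k" using j sorted_nth_le_iff[OF st jl] i by auto
    then have le: "T ! i ! j \<le> k" using col[OF i jl] by simp
    have "length (T ! Suc i) \<le> length (T ! i)"
      using part i by (auto simp: is_partition_def sorted_wrt_iff_nth_less)
    then have "j < length (T ! i)" using jl by simp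
    then have "j < le_count (T ! i) k" using sorted_nth_le_iff[of "T ! i" j k] st[of "T ! i"] i le by simp
    then show ?thesis using i by (simp add: row_def j_def)
  qed
  moreover have "T ! i \<noteq> []" if "i < length T" for i
    using part that by (auto simp: is_partition_def in_set_conv_nth)
  ultimately show ?R using len st ent by auto
next
  assume R: ?R
  then have len: "length T \<le> n" and ne: "\<And>i. i < length T \<Longrightarrow> T ! i \<noteq> []" and st: "\<And>i. i < length T \<Longrightarrow> sorted (T ! i)"
    and ent: "\<And>i. i < length T \<Longrightarrow> set (T ! i) \<subseteq> {1..m}"
    and cnt: "\<And>i k. le_count (row T (Suc i)) (Suc k) \<le> le_count (row T i) k" by auto
  have lens: "length (T ! Suc i) \<le> length (T ! i)" if "Suc i < length T" for i
    using cnt[of i m] that le_count_max[OF ent, of "Suc i" "Suc m"] le_count_max[OF ent, of i m]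
    by (simp add: row_def)
  have "is_partition (map length T)"
    unfolding is_partition_def
  proof
    show "sorted_wrt (\<ge>) (map length T)"
      using lens by (subst sorted_wrt_iff_nth_Suc_transp) (auto simp: transp_def)
    show "\<forall>k\<in>set (map length T). 0 < k" using ne by (auto simp: in_set_conv_nth)
  qed
  moreover have "T ! i ! j < T ! Suc i ! j" if ij: "Suc i < length T" "j < length (T ! Suc i)" for i j
  proof -
    have "T ! Suc i ! j \<in> set (T ! Suc i)" using ij by simp
    then have "T ! Suc i ! j \<ge> 1" using ent[OF ij(1)] by auto
    then obtain k where k: "T ! Suc i ! j = Suc k" by (cases "T ! Suc i ! j") auto
    then have "j < le_count (T ! Suc i) (Suc k)" using sorted_nth_le_iff[OF st[OF ij(1)] ij(2), of "Suc k"] by simp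
    then have "j < le_count (T ! i) k" using cnt[of i k] ij by (simp add: row_def)
    moreover have "j < length (T ! i)" using lens[OF ij(1)] ij(2) by simp
    ultimately have "T ! i ! j \<le> k" using sorted_nth_le_iff[of "T ! i" j k] st[of i] ij by simp
    then show ?thesis using k by simp
  qed
  moreover have "sorted r \<and> (\<forall>k\<in>set r. 0 < k) \<and> set r \<subseteq> {1..m}" if r: "r \<in> set T" for r
  proof -
    obtain i where "i < length T" "r = T ! i" using r by (auto simp: in_set_conv_nth)
    then show ?thesis using st[of i] ent[of i] by force
  qed
  ultimately show ?L using len by (auto simp: SSYT_def semistandard_def)
qed

lemma length_tableau_star: "length (tableau_star T U) = max (length T) (length U)"
  by (induction T U rule: tableau_star.induct) auto

lemma mset_row_star: "mset (row (tableau_star T U) i) = mset (row T i) + mset (row U i)"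
proof (induction T U arbitrary: i rule: tableau_star.induct)
  case (3 r T s U)
  then show ?case by (cases i) auto
qed auto

lemma sorted_row_star:
  "(\<And>i. sorted (row T i)) \<Longrightarrow> (\<And>i. sorted (row U i)) \<Longrightarrow> sorted (row (tableau_star T U) i)"
proof (induction T U arbitrary: i rule: tableau_star.induct)
  case (3 r T s U)
  have "sorted (row T i)" "sorted (row U i)" for i using 3(2,3)[of "Suc i"] by simp_all
  then show ?case using 3(1) by (cases i) auto
qed auto

lemma le_count_mset: "le_count r k = size (filter_mset (\<lambda>x. x \<le> k) (mset r))"
  by (simp add: le_count_def flip: mset_filter)

lemma le_count_star: "le_count (row (tableau_star T U) i) k = le_count (row T i) k + le_count (row U i) k"
  by (simp add: le_count_mset mset_row_star)

lemma tableau_star_SSYT: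
  assumes "T \<in> SSYT n m" "U \<in> SSYT n m" shows "tableau_star T U \<in> SSYT n m"
  unfolding SSYT_iff
proof (intro conjI allI impI)
  note T = assms(1)[unfolded SSYT_iff] and U = assms(2)[unfolded SSYT_iff]
  show "length (tableau_star T U) \<le> n" using T U by (simp add: length_tableau_star)
  show "le_count (row (tableau_star T U) (Suc i)) (Suc k) \<le> le_count (row (tableau_star T U) i) k" for i k
    unfolding le_count_star using T U by (intro add_mono) simp_all
  fix i assume i: "i < length (tableau_star T U)"
  have r: "tableau_star T U ! i = row (tableau_star T U) i" using i by (simp add: row_def)
  have srt: "sorted (row T j)" "sorted (row U j)" for j using T U by (auto simp: row_def)
  show "sorted (tableau_star T U ! i)" unfolding r by (rule sorted_row_star[OF srt])
  have "set (row T i) \<subseteq> {1..m}" "set (row U i) \<subseteq> {1..m}" using T U by (auto simp: row_def)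
  moreover have "set (row (tableau_star T U) i) = set (row T i) \<union> set (row U i)"
    using arg_cong[OF mset_row_star, of set_mset T U i] by simp
  ultimately show "set (tableau_star T U ! i) \<subseteq> {1..m}" unfolding r by simp
  have "i < length T \<or> i < length U" using i by (auto simp: length_tableau_star)
  then have "row T i \<noteq> [] \<or> row U i \<noteq> []" using T U by (auto simp: row_def)
  then have "mset (row (tableau_star T U) i) \<noteq> {#}" by (simp add: mset_row_star)
  then show "tableau_star T U ! i \<noteq> []" unfolding r by auto
qed

text \<open>Entries in row \<open>i\<close> (counted from zero) are larger than \<open>i\<close>, as columns strictly increase.\<close>
lemma SSYT_le_count_eq_0:
  assumes T: "T \<in> SSYT n m" and "k \<le> i" shows "le_count (row T i) k = 0"
  using \<open>k \<le> i\<close>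
proof (induction i arbitrary: k)
  case 0
  then show ?case using T[unfolded SSYT_iff] le_count_0[of "row T 0" m] by (auto simp: row_def)
next
  case (Suc i)
  show ?case
  proof (cases k)
    case 0
    then show ?thesis using T[unfolded SSYT_iff] le_count_0[of "row T (Suc i)" m] by (auto simp: row_def)
  next
    case (Suc l)
    have "le_count (row T (Suc i)) (Suc l) \<le> le_count (row T i) l" using T[unfolded SSYT_iff] by blast
    then show ?thesis using Suc.IH[of l] Suc.prems Suc by simp
  qed
qed

lemma sorted_eq_if_le_count_eq:
  assumes "sorted r" "sorted s" and eq: "\<And>k. le_count r k = le_count s k" shows "r = s"
proof -
  have c: "le_count r (Suc k) = le_count r k + count (mset r) (Suc k)" for r :: "nat list" and k
    by (induction r) (auto simp: le_count_def)
  have c0: "le_count r 0 = count (mset r) 0" for r :: "nat list"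
    by (induction r) (auto simp: le_count_def)
  have "count (mset r) x = count (mset s) x" for x
  proof (cases x)
    case 0
    then show ?thesis using c0[of r] c0[of s] eq[of 0] by simp
  next
    case (Suc k)
    then show ?thesis using c[of r k] c[of s k] eq[of k] eq[of "Suc k"] by simp
  qed
  then have "mset r = mset s" by (rule multiset_eqI)
  then show ?thesis using assms(1,2) by (metis properties_for_sort)
qed

lemma tableau_eqI:
  assumes "\<And>i. row T i = row U i"
    and "\<And>i. i < length T \<Longrightarrow> T ! i \<noteq> []" "\<And>i. i < length U \<Longrightarrow> U ! i \<noteq> []"
  shows "T = U"
proof -
  have le: "length T \<le> length U" if "\<And>i. row T i = row U i" "\<And>i. i < length T \<Longrightarrow> T ! i \<noteq> []" for T U
  proof (rule ccontr)
    assume "\<not> length T \<le> length U"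
    then show False using that(1)[of "length U"] that(2)[of "length U"] by (simp add: row_def)
  qed
  have "length T = length U" using le[of T U] le[of U T] assms by (simp add: le_antisym)
  then show ?thesis
  proof (rule nth_equalityI)
    fix i assume "i < length T"
    then show "T ! i = U ! i" using assms(1)[of i] \<open>length T = length U\<close> by (simp add: row_def)
  qed
qed

text \<open>
  The position for row \<open>i\<close> and entry bound \<open>k\<close>, where \<open>i < k \<le> m\<close>, has the label \<open>i * m + (m - k)\<close>. With
  this encoding both families of inequalities, between \<open>(i, k + 1)\<close> and \<open>(i, k)\<close> and between \<open>(i, k)\<close> and
  \<open>(i + 1, k + 1)\<close>, lead from a smaller to a larger label. For \<open>k \<le> i\<close> the counts vanish.
\<close>

definition gt_positions :: "nat \<Rightarrow> nat \<Rightarrow> nat set" where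
  "gt_positions n m = {x. x < n * m \<and> x div m < m - x mod m}"

definition gt_pos :: "nat \<Rightarrow> nat \<Rightarrow> nat \<Rightarrow> nat" where "gt_pos m i k = i * m + (m - k)"

definition gt_relations :: "nat \<Rightarrow> nat \<Rightarrow> (nat \<times> nat) set" where
  "gt_relations n m =
     {(gt_pos m i (Suc k), gt_pos m i k) |i k. i < n \<and> i < k \<and> k < m} \<union>
     {(gt_pos m i k, gt_pos m (Suc i) (Suc k)) |i k. Suc i < n \<and> i < k \<and> k < m}"

definition gt :: "nat \<Rightarrow> nat \<Rightarrow> tableau \<Rightarrow> nat \<Rightarrow> nat" where
  "gt n m T x = (if x \<in> gt_positions n m then le_count (row T (x div m)) (m - x mod m) else 0)"

lemma gt_pos:
  assumes "i < n" "i < k" "k \<le> m"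
  shows gt_pos_div: "gt_pos m i k div m = i" and gt_pos_mod: "m - gt_pos m i k mod m = k"
    and gt_pos_mem: "gt_pos m i k \<in> gt_positions n m"
proof -
  have l: "m - k < m" "0 < m" using assms by auto
  show d: "gt_pos m i k div m = i" using l by (simp add: gt_pos_def)
  have "(i * m + c) mod m = c" if "c < m" for c using that by simp
  from this[OF l(1)] show r: "m - gt_pos m i k mod m = k" using assms by (simp only: gt_pos_def)
  have "gt_pos m i k < i * m + m" using l by (simp add: gt_pos_def)
  also have "i * m + m \<le> n * m" using assms(1) by (metis Suc_leI add.commute mult_Suc mult_le_mono1)
  finally show "gt_pos m i k \<in> gt_positions n m" using d r assms by (simp add: gt_positions_def)
qed

lemma gt_positionsE:
  assumes "x \<in> gt_positions n m" obtains i k where "i < n" "i < k" "k \<le> m" "x = gt_pos m i k"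
proof (rule that)
  have x: "x < n * m" "x div m < m - x mod m" using assms by (auto simp: gt_positions_def)
  then have m: "0 < m" by (cases m) auto
  show "x div m < n" using x(1) by (simp add: less_mult_imp_div_less)
  show "x div m < m - x mod m" "m - x mod m \<le> m" using x by auto
  show "x = gt_pos m (x div m) (m - x mod m)" using m by (simp add: gt_pos_def less_imp_le)
qed

lemma gt_at: "i < n \<Longrightarrow> i < k \<Longrightarrow> k \<le> m \<Longrightarrow> gt n m T (gt_pos m i k) = le_count (row T i) k"
  by (simp add: gt_def gt_pos_mem gt_pos_div gt_pos_mod)

lemma cone_gt: "cone (gt_positions n m) (gt_relations n m)"
proof
  show "finite (gt_positions n m)" by (simp add: gt_positions_def)
  show "gt_relations n m \<subseteq> gt_positions n m \<times> gt_positions n m"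
    by (auto simp: gt_relations_def intro!: gt_pos_mem)
  fix a b assume "(a, b) \<in> gt_relations n m"
  then show "a < b" by (auto simp: gt_relations_def gt_pos_def)
qed

text \<open>The sorted row that has \<open>g k - g 0\<close> entries at most \<open>k\<close> for \<open>k \<le> m\<close>, when \<open>g\<close> is monotone.\<close>
definition row_of_counts :: "(nat \<Rightarrow> nat) \<Rightarrow> nat \<Rightarrow> nat list" where
  "row_of_counts g m = concat (map (\<lambda>k. replicate (g (Suc k) - g k) (Suc k)) [0..<m])"

lemma row_of_counts_Suc: "row_of_counts g (Suc m) = row_of_counts g m @ replicate (g (Suc m) - g m) (Suc m)"
  by (simp add: row_of_counts_def)

lemma set_row_of_counts: "set (row_of_counts g m) \<subseteq> {1..m}"
  by (auto simp: row_of_counts_def)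

lemma sorted_row_of_counts: "sorted (row_of_counts g m)"
proof (induction m)
  case (Suc m)
  then show ?case using set_row_of_counts[of g m]
    by (auto simp: row_of_counts_Suc sorted_append le_SucI subset_iff)
qed (simp add: row_of_counts_def)

lemma le_count_row_of_counts:
  assumes "mono g" "g 0 = 0" shows "le_count (row_of_counts g m) k = g (min k m)"
proof (induction m)
  case 0
  then show ?case using assms by (simp add: row_of_counts_def)
next
  case (Suc m)
  have "g m \<le> g (Suc m)" using assms(1) by (simp add: mono_def)
  moreover have "le_count (row_of_counts g (Suc m)) k = g (min k m) + (if Suc m \<le> k then g (Suc m) - g m else 0)"
    using Suc by (simp add: row_of_counts_Suc le_count_def)
  ultimately show ?case by (auto simp: min_def)
qed

text \<open>
  Injectivity: the pattern determines the counts, which determine the sorted rows. Surjectivity: extend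
  a pattern \<open>f\<close> to counts \<open>F i k\<close> for all \<open>i\<close> and \<open>k\<close>, by zero for \<open>k \<le> i\<close> and constantly for \<open>k \<ge> m\<close>, and
  take the rows with these counts. The rows after an empty one are empty, and all of these are cut off.
\<close>
lemma bij_betw_gt:
  assumes nm: "n \<le> m"
  shows "bij_betw (gt n m) (SSYT n m) (cone.S (gt_positions n m) (gt_relations n m))"
  unfolding bij_betw_def
proof
  interpret cone "gt_positions n m" "gt_relations n m" by (rule cone_gt)
  show "inj_on (gt n m) (SSYT n m)"
  proof (rule inj_onI)
    fix T U assume T: "T \<in> SSYT n m" and U: "U \<in> SSYT n m" and eq: "gt n m T = gt n m U"
    note T' = T[unfolded SSYT_iff] and U' = U[unfolded SSYT_iff]
    have small: "le_count (row T i) k = le_count (row U i) k" if "i < n" "k \<le> m" for i k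
    proof (cases "k \<le> i")
      case True
      then show ?thesis using SSYT_le_count_eq_0[OF T True] SSYT_le_count_eq_0[OF U True] by simp
    next
      case False
      then show ?thesis using gt_at[of i n k m T] gt_at[of i n k m U] that eq by simp
    qed
    have ent: "set (row T i) \<subseteq> {1..m}" "set (row U i) \<subseteq> {1..m}" for i using T' U' by (auto simp: row_def)
    have "row T i = row U i" for i
    proof (cases "i < n")
      case True
      have "le_count (row T i) k = le_count (row U i) k" for k
      proof (cases "k \<le> m")
        case False
        then show ?thesis using small[OF True, of m] le_count_max[OF ent(1), of m i] le_count_max[OF ent(1), of k i]
           le_count_max[OF ent(2), of m i] le_count_max[OF ent(2), of k i] by simp
      qed (rule small[OF True])
      then show ?thesis using T' U' by (intro sorted_eq_if_le_count_eq) (auto simp: row_def)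
    next
      case False
      then show ?thesis using T' U' by (simp add: row_def)
    qed
    then show "T = U" using T' U' by (intro tableau_eqI) auto
  qed
  show "gt n m ` SSYT n m = S"
  proof
    show "gt n m ` SSYT n m \<subseteq> S"
    proof (rule image_subsetI)
      fix T assume T: "T \<in> SSYT n m"
      have "gt n m T b \<le> gt n m T a" if ab: "(a, b) \<in> gt_relations n m" for a b
      proof -
        consider i k where "i < n" "i < k" "k < m" "a = gt_pos m i (Suc k)" "b = gt_pos m i k"
          | i k where "Suc i < n" "i < k" "k < m" "a = gt_pos m i k" "b = gt_pos m (Suc i) (Suc k)"
          using ab unfolding gt_relations_def by blast
        then show ?thesis
        proof cases
          case 1
          have "le_count (row T i) k \<le> le_count (row T i) (Suc k)"
            by (rule le_count_mono) simp
          then show ?thesis using 1 by (simp add: gt_at)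
        next
          case 2
          then show ?thesis using T[unfolded SSYT_iff] by (simp add: gt_at)
        qed
      qed
      moreover have "gt n m T x = 0" if "x \<notin> gt_positions n m" for x using that by (simp add: gt_def)
      ultimately show "gt n m T \<in> S" by (auto simp: S_def)
    qed
    show "S \<subseteq> gt n m ` SSYT n m"
    proof
      fix f assume f: "f \<in> S"
      define F where "F i k = (if i < n \<and> i < k then f (gt_pos m i (min k m)) else 0)" for i k
      have E1: "f (gt_pos m i k) \<le> f (gt_pos m i (Suc k))" if "i < n" "i < k" "k < m" for i k
      proof -
        have "(gt_pos m i (Suc k), gt_pos m i k) \<in> gt_relations n m" using that unfolding gt_relations_def by blast
        then show ?thesis using f by (auto simp: S_def)
      qed
      have E2: "f (gt_pos m (Suc i) (Suc k)) \<le> f (gt_pos m i k)" if "Suc i < n" "i < k" "k < m" for i k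
      proof -
        have "(gt_pos m i k, gt_pos m (Suc i) (Suc k)) \<in> gt_relations n m" using that unfolding gt_relations_def by blast
        then show ?thesis using f by (auto simp: S_def)
      qed
      have F_Suc: "F i k \<le> F i (Suc k)" for i k
      proof (cases "i < n \<and> i < k \<and> k < m")
        case True
        then show ?thesis using E1[of i k] by (simp add: F_def min_def)
      next
        case False
        then show ?thesis by (auto simp: F_def min_def)
      qed
      have F_mono: "mono (F i)" for i using F_Suc by (simp add: mono_iff_le_Suc)
      have F_0: "F i 0 = 0" for i by (simp add: F_def)
      have F_min: "F i (min k m) = F i k" for i k using nm by (auto simp: F_def min_def)
      have F_row: "F (Suc i) (Suc k) \<le> F i k" for i k
      proof (cases "Suc i < n \<and> i < k")
        case False
        then show ?thesis by (auto simp: F_def)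
      next
        case True
        show ?thesis
        proof (cases "k < m")
          case True
          then show ?thesis using E2[of i k] \<open>Suc i < n \<and> i < k\<close> by (simp add: F_def min_def)
        next
          case False
          \<comment> \<open>at the boundary \<open>k \<ge> m\<close> the inequality goes through the column \<open>m - 1\<close>, as \<open>i + 1 < n \<le> m\<close>\<close>
          define l where "l = m - 1"
          have l: "m = Suc l" "i < l" using True nm by (auto simp: l_def)
          have "F (Suc i) (Suc k) = f (gt_pos m (Suc i) (Suc l))" using True False l by (simp add: F_def min_def)
          also have "\<dots> \<le> f (gt_pos m i l)" using True l by (intro E2) auto
          also have "\<dots> \<le> f (gt_pos m i (Suc l))" using True l by (intro E1) auto
          also have "\<dots> = F i k" using True False l by (simp add: F_def min_def)
          finally show ?thesis .
        qed
      qed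
      define rs where "rs = map (\<lambda>i. row_of_counts (F i) m) [0..<n]"
      define T where "T = takeWhile (\<lambda>r. r \<noteq> []) rs"
      have cnt_rs: "le_count (row_of_counts (F i) m) k = F i k" for i k
        using le_count_row_of_counts[OF F_mono F_0] F_min by simp
      have len_rs: "length (row_of_counts (F i) m) = F i m" for i
        using cnt_rs[of i m] le_count_max[OF set_row_of_counts, of m m "F i"] by simp
      have lenT: "length T \<le> n" unfolding T_def using length_takeWhile_le[of _ rs] by (simp add: rs_def)
      have F_zero: "F (i + d) m = 0" if "F i m = 0" for i d
      proof (induction d)
        case (Suc d)
        have "F (Suc (i + d)) m \<le> F (Suc (i + d)) (Suc m)" by (rule F_Suc)
        also have "\<dots> \<le> F (i + d) m" by (rule F_row)
        finally show ?case using Suc by simp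
      qed (use that in simp)
      have rowT: "row T i = row_of_counts (F i) m" for i
      proof (cases "i < length T")
        case True
        then have "T ! i = rs ! i" unfolding T_def by (intro takeWhile_nth)
        then show ?thesis using True lenT by (simp add: row_def rs_def)
      next
        case False
        have "F i m = 0"
        proof (cases "length T < n")
          case True
          then have "rs ! length T = []" using nth_length_takeWhile[of "\<lambda>r. r \<noteq> []" rs] by (simp add: T_def rs_def)
          then have "row_of_counts (F (length T)) m = []" using True by (simp add: rs_def)
          then have "F (length T) m = 0" using len_rs[of "length T"] by simp
          then show ?thesis using F_zero[of "length T" "i - length T"] False by simp
        next
          case False
          then show ?thesis using \<open>\<not> i < length T\<close> lenT by (simp add: F_def)
        qed
        then have "row_of_counts (F i) m = []" using len_rs[of i] by simp
        then show ?thesis using False by (simp add: row_def)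
      qed
      have T: "T \<in> SSYT n m"
        unfolding SSYT_iff
      proof (intro conjI allI impI lenT)
        show "le_count (row T (Suc i)) (Suc k) \<le> le_count (row T i) k" for i k
          using F_row by (simp add: rowT cnt_rs)
        fix i assume i: "i < length T"
        have r: "T ! i = row_of_counts (F i) m" using rowT[of i] i by (simp add: row_def)
        show "T ! i \<noteq> []" using set_takeWhileD[of "T ! i" "\<lambda>r. r \<noteq> []" rs] i nth_mem[OF i] by (simp add: T_def)
        show "sorted (T ! i)" "set (T ! i) \<subseteq> {1..m}" unfolding r by (rule sorted_row_of_counts set_row_of_counts)+
      qed
      have "gt n m T = f"
      proof
        fix x show "gt n m T x = f x"
        proof (cases "x \<in> gt_positions n m")
          case True
          then obtain i k where "i < n" "i < k" "k \<le> m" "x = gt_pos m i k" by (rule gt_positionsE)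
          then show ?thesis by (simp add: gt_at rowT cnt_rs F_def min_def)
        next
          case False
          then show ?thesis using f by (simp add: gt_def S_def)
        qed
      qed
      then show "f \<in> gt n m ` SSYT n m" using T by blast
    qed
  qed
qed

lemma gt_star: "gt n m (tableau_star T U) = gt n m T + gt n m U"
  by (auto simp: gt_def le_count_star fun_eq_iff)

lemma gt_Nil: "gt n m [] = 0" by (auto simp: gt_def fun_eq_iff)

lemma Nil_SSYT: "[] \<in> SSYT n m" by (simp add: SSYT_iff)

theorem theorem5p9:
  fixes n m :: nat
  assumes "0 < n" and "n \<le> m"
  shows "cohen_macaulay
    (tableaux_algebra n m :: (tableau \<Rightarrow>\<^sub>0 'k::{alg_closed_field, field_char_0}) ring)"
proof -
  interpret cone "gt_positions n m" "gt_relations n m" by (rule cone_gt)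
  show ?thesis
    unfolding tableaux_algebra_def
  proof (rule cohen_macaulay_monoid_algebra)
    show "bij_betw (gt n m) (carrier (SSYT_monoid n m)) S"
      using bij_betw_gt[OF assms(2)] by (simp add: SSYT_monoid_def)
    fix T U assume "T \<in> carrier (SSYT_monoid n m)" "U \<in> carrier (SSYT_monoid n m)"
    then show "T \<otimes>\<^bsub>SSYT_monoid n m\<^esub> U \<in> carrier (SSYT_monoid n m) \<and>
        gt n m (T \<otimes>\<^bsub>SSYT_monoid n m\<^esub> U) = gt n m T + gt n m U"
      by (simp add: SSYT_monoid_def tableau_star_SSYT gt_star)
  qed (simp_all add: SSYT_monoid_def Nil_SSYT gt_Nil)
qed

end
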